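(* Fix $k\ge3$ and $0<c<\left(\frac{e}{(k-1)\alpha_k}\right)^{\frac1{k-1}}$. Let $[n]_p$ be the random subset of $[n]=\{1,\dots,n\}$ containing each element independently with probability $p$, and let $\mathbf X_k$ be the number of $k$-term arithmetic progressions contained in $[n]_p$. If $p\sim cn^{-\frac1{k-1}}$, then $$\lim_{n\to\infty}n^{-\frac{k-2}{k-1}}\log\mathbb{P}_p(\mathbf X_k=0)=\int_0^1\int_0^c\frac{x^\ast_{k,t}(s)}{t}\,dt\,ds-c,$$ and for each $j\in[n]$, $$n^{\frac1{k-1}}\,\mathbb{P}_p(j\in[n]_p\mid\mathbf X_k=0)=x_{k,c}^\ast(j/n)+o(1).$$
   Context: A $k$-term arithmetic progression is a set $\{a,a+b,\dots,a+(k-1)b\}$ with $a,b\in\mathbb N$, $b\ge1$. $\alpha_k=\frac12\sum_{i=1}^k\min\left(\frac1{i-1},\frac1{k-i}\right)$ (with $1/0=+\infty$). For $0<t<\left(\frac{e}{(k-1)\alpha_k}\right)^{\frac1{k-1}}$, $x_{k,t}^\ast:[0,1]\to[0,t]$ is the unique measurable fixed point of the operator $\Phi_t^{(k)}x(u)=t\exp\left[-\sum_{j=1}^k\int_0^{\min\{\frac u{j-1},\frac{1-u}{k-j}\}}\prod_{i=1}^{j-1}x(u-(j-i)s)\prod_{i=j+1}^kx(u+(i-j)s)\,ds\right]$ (quotients by $0$ interpreted as $+\infty$). *)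

theory Defs
  imports "HOL-Probability.Probability" "HOL-Library.Landau_Symbols"
begin

definition is_kAP :: "nat \<Rightarrow> nat set \<Rightarrow> bool" where
  "is_kAP k A \<longleftrightarrow> (\<exists>a b. b \<ge> 1 \<and> A = {a + i * b | i. i < k})"

definition num_kAP :: "nat \<Rightarrow> nat set \<Rightarrow> nat" where
  "num_kAP k S = card {A. is_kAP k A \<and> A \<subseteq> S}"

definition rand_subset :: "nat \<Rightarrow> real \<Rightarrow> (nat \<Rightarrow> bool) pmf" where
  "rand_subset n p = Pi_pmf {1..n} False (\<lambda>_. bernoulli_pmf p)"

text \<open>alpha_k = 1/2 sum_{i=1}^k min(1/(i-1), 1/(k-i)), with 1/0 = +infinity.\<close>
definition alpha :: "nat \<Rightarrow> real" where
  "alpha k = 1/2 * (\<Sum>i=1..k.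
      (if i = 1 then 1 / (real k - 1)
       else if i = k then 1 / (real i - 1)
       else min (1 / (real i - 1)) (1 / (real k - real i))))"

definition crit :: "nat \<Rightarrow> real" where
  "crit k = (exp 1 / ((real k - 1) * alpha k)) powr (1 / (real k - 1))"

text \<open>Upper limit min(u/(j-1), (1-u)/(k-j)) of the inner integral, quotients by 0 being +infinity.\<close>
definition upper :: "nat \<Rightarrow> nat \<Rightarrow> real \<Rightarrow> real" where
  "upper k j u =
     (if j = 1 then (1 - u) / (real k - 1)
      else if j = k then u / (real j - 1)
      else min (u / (real j - 1)) ((1 - u) / (real k - real j)))"

definition Phi :: "nat \<Rightarrow> real \<Rightarrow> (real \<Rightarrow> real) \<Rightarrow> real \<Rightarrow> real" where
  "Phi k t x u = t * exp (- (\<Sum>j=1..k. LBINT s:{0..upper k j u}.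
       (\<Prod>i=1..j-1. x (u - (real j - real i) * s)) *
       (\<Prod>i=j+1..k. x (u + (real i - real j) * s))))"

definition x_star :: "nat \<Rightarrow> real \<Rightarrow> real \<Rightarrow> real" where
  "x_star k t = (THE x. x \<in> borel_measurable lborel \<and>
       (\<forall>u. u \<notin> {0..1} \<longrightarrow> x u = 0) \<and>
       (\<forall>u\<in>{0..1}. 0 \<le> x u \<and> x u \<le> t) \<and>
       (\<forall>u\<in>{0..1}. x u = Phi k t x u))"

end

theory Submission
  imports Defs
begin

text \<open>
  Write \<open>h = n powr (1 / (k - 1))\<close> and let \<open>\<mu> w\<close> be the probability that \<open>w\<close> is occupied, given that
  no progression is. Removing \<open>w\<close>, this is \<open>p\<close> times the probability that none of the progressions
  through \<open>w\<close> becomes filled. Exposing these progressions one at a time, and the points of each one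
  at a time, expresses that probability through marginals of the same kind for families in which
  boundedly many points have been exposed. Two points lie in boundedly many progressions, so an
  exposed point changes only \<open>O(1)\<close> of the constraints at another point, and \<open>x w = h * \<mu> w\<close> satisfies
  \<open>x w = t * exp (- (1 / n) * (sum over progressions through w of the product of the other x's))\<close>
  up to \<open>o(1)\<close>, a discretisation of the fixed-point equation.

  Put \<open>a = 1 + (k - 1) * ln (t / x)\<close>. The product of \<open>x\<close> over \<open>k - 1\<close> points depends only on the sum
  of \<open>a\<close> over these points, and below the critical value the operator contracts \<open>ln a\<close> in the
  supremum norm by a factor \<open>\<theta> < 1\<close> with \<open>(k - 1) * t ^ (k - 1) * alpha k \<le> \<theta> * exp \<theta>\<close>. This gives
  existence, uniqueness and continuity of the fixed point. The trivial bound \<open>\<mu> w \<le> p\<close> is an upper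
  bound with an error factor \<open>exp \<rho>\<close> in \<open>a\<close>; the recursion turns upper bounds with error \<open>\<rho>\<close> into lower
  bounds with error \<open>\<theta> * \<rho> + o(1)\<close> and conversely, so the marginals converge.

  The derivative of the logarithm of the avoidance probability in \<open>p\<close> is
  \<open>((\<Sum>j. \<mu> j) - n * p) / (p * (1 - p))\<close>; integrating it and passing to the limit gives the first claim.
\<close>

section \<open>Avoidance probabilities of binomial subsets\<close>

text \<open>The form of \<open>a\<close> and the critical value come from one extremal problem. Put
  \<open>D = (k - 1) * t ^ (k - 1) * alpha k\<close>. If all \<open>a\<close> equal \<open>s\<close>
  and the integration ranges have total length \<open>alpha k\<close>, the operator sends
  \<open>s\<close> to \<open>1 + D * exp (1 - s)\<close>. Its logarithmic derivative is at most
  \<theta> in absolute value for all \<open>s \<ge> 1\<close> exactly when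
  \<open>D \<le> \<theta> * exp \<theta>\<close>, because
  \<open>(s - \<theta>) * exp (1 - s)\<close> has maximum \<open>exp (- \<theta>)\<close>. At
  \<open>D = exp 1\<close> the fixed point is \<open>s = 2\<close> with slope -1, so contraction
  ends there. Each pass consumes a bound for families with up to \<open>k\<close> more exposed
  points; a given accuracy takes finitely many passes, so the number of exposed points stays bounded
  while \<open>n\<close> grows. The two passes differ: for lower bounds, constraints damaged by
  exposed points need only a crude estimate, whereas for upper bounds an edge that contains another
  constraint may be impossible to fill and has to be discarded. Measurability of the fixed point in
  \<open>t\<close>, needed for the double integral, is itself drawn from the convergence.\<close>

definition rprob :: "'a set \<Rightarrow> real \<Rightarrow> ('a set \<Rightarrow> bool) \<Rightarrow> real" where
  "rprob V p A = (\<Sum>I\<in>Pow V. of_bool (A I) * (p ^ card I * (1 - p) ^ card (V - I)))"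

definition avoids :: "'a set set \<Rightarrow> 'a set \<Rightarrow> bool" where
  "avoids F I \<longleftrightarrow> (\<forall>f\<in>F. \<not> f \<subseteq> I)"

text \<open>What remains of the constraints once the points of \<open>C\<close> are known to be
  occupied; \<open>{}\<close> in the result records a constraint that is already violated.\<close>

definition contr :: "'a set set \<Rightarrow> 'a set \<Rightarrow> 'a set set" where
  "contr F C = (\<lambda>f. f - C) ` F"

lemma sum_Pow_remove:
  fixes g :: "'a set \<Rightarrow> real"
  assumes "finite V" "w \<in> V"
  shows "sum g (Pow V) = (\<Sum>J\<in>Pow (V - {w}). g J + g (insert w J))"
proof -
  have V: "Pow V = Pow (V - {w}) \<union> insert w ` Pow (V - {w})"
    using assms(2) by (metis Pow_insert insert_Diff)
  have inj: "inj_on (insert w) (Pow (V - {w}))"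
    by (rule inj_onI) (metis Diff_insert_absorb Pow_iff subset_Diff_insert)
  have "sum g (Pow V) = sum g (Pow (V - {w})) + sum g (insert w ` Pow (V - {w}))"
    unfolding V using assms(1) by (intro sum.union_disjoint) auto
  also have "sum g (insert w ` Pow (V - {w})) = (\<Sum>J\<in>Pow (V - {w}). g (insert w J))"
    using inj by (simp add: sum.reindex)
  finally show ?thesis by (simp add: sum.distrib)
qed

text \<open>Conditioning on the state of \<open>w\<close>. Both events on the right ignore that
  state, so they can still be measured over all of \<open>V\<close>, and the ground set never has to
  shrink when points are exposed.\<close>

lemma rprob_split:
  assumes "finite V" "w \<in> V"
  shows "rprob V p A = p * rprob V p (\<lambda>I. A (insert w I)) + (1 - p) * rprob V p (\<lambda>I. A (I - {w}))"
proof -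
  let ?V = "V - {w}"
  define wt where "wt J = p ^ card J * (1 - p) ^ card (?V - J)" for J
  have w1: "p ^ card J * (1 - p) ^ card (V - J) = (1 - p) * wt J"
    and w2: "p ^ card (insert w J) * (1 - p) ^ card (V - insert w J) = p * wt J"
    if "J \<in> Pow ?V" for J
  proof -
    have fJ: "finite J" "w \<notin> J" using that assms(1) finite_subset by auto
    have "V - J = insert w (?V - J)" using assms(2) fJ by auto
    then have "card (V - J) = Suc (card (?V - J))" using assms(1) by simp
    then show "p ^ card J * (1 - p) ^ card (V - J) = (1 - p) * wt J" by (simp add: wt_def)
    have "V - insert w J = ?V - J" by auto
    then show "p ^ card (insert w J) * (1 - p) ^ card (V - insert w J) = p * wt J"
      using fJ by (simp add: wt_def)
  qed
  have R: "rprob V p B = (\<Sum>J\<in>Pow ?V. (of_bool (B J) * (1 - p) + of_bool (B (insert w J)) * p) * wt J)" for B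
    unfolding rprob_def sum_Pow_remove[OF assms]
    by (intro sum.cong refl) (simp only: w1 w2, simp add: algebra_simps)
  have i: "insert w J - {w} = J" "J - {w} = J" if "J \<in> Pow ?V" for J using that by auto
  have "rprob V p (\<lambda>I. A (insert w I)) = (\<Sum>J\<in>Pow ?V. of_bool (A (insert w J)) * wt J)"
    unfolding R by (intro sum.cong refl) (simp add: algebra_simps)
  moreover have "rprob V p (\<lambda>I. A (I - {w})) = (\<Sum>J\<in>Pow ?V. of_bool (A J) * wt J)"
    unfolding R by (intro sum.cong refl) (simp only: i, simp add: algebra_simps)
  ultimately show ?thesis
    unfolding R[of A] by (simp add: sum_distrib_left sum.distrib[symmetric] algebra_simps)
qed

lemma rprob_pos:
  assumes "finite V" "0 \<le> q" "q < 1" "A {}"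
  shows "0 < rprob V q A"
proof -
  have "0 < (1 - q) ^ card V" using assms by simp
  also have "\<dots> = of_bool (A {}) * (q ^ card ({}::'a set) * (1 - q) ^ card (V - {}))" using assms by simp
  also have "\<dots> \<le> rprob V q A"
    unfolding rprob_def using assms by (intro member_le_sum) auto
  finally show ?thesis .
qed

lemma avoids_insert_iff: "avoids F (insert w I) \<longleftrightarrow> avoids (contr F {w}) I"
  unfolding avoids_def contr_def by auto

lemma avoids_remove_iff: "avoids F (I - {w}) \<longleftrightarrow> avoids {f\<in>F. w \<notin> f} I"
  unfolding avoids_def by auto

lemma contr_contr: "contr (contr F C) D = contr F (C \<union> D)"
proof -
  have "f - C - D = f - (C \<union> D)" for f :: "'a set" by auto
  then show ?thesis by (simp add: contr_def image_image)
qed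

lemma contr_empty [simp]: "contr F {} = F"
  unfolding contr_def by simp

section \<open>Marginals and chain rules at a fixed density\<close>

locale binomial_subset =
  fixes V :: "'a set" and p :: real
  assumes fin: "finite V" and p0: "0 < p" and p1: "p < 1"
begin

definition Q :: "'a set set \<Rightarrow> real" where
  "Q F = rprob V p (avoids F)"

definition marg :: "'a set set \<Rightarrow> 'a \<Rightarrow> real" where
  "marg F w = p * Q (contr F {w}) / Q F"

text \<open>The probability that \<open>f\<close> is fully occupied given that \<open>F\<close> is
  avoided, see \<open>rprob_superset\<close>. Like \<open>marg\<close> it is 0 by the convention on
  division when \<open>Q F = 0\<close>.\<close>

definition cond :: "'a set set \<Rightarrow> 'a set \<Rightarrow> real" where
  "cond F f = p ^ card f * Q (contr F f) / Q F"

lemma rprob_mono: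
  assumes "\<And>I. A I \<Longrightarrow> B I"
  shows "rprob V p A \<le> rprob V p B"
  unfolding rprob_def using assms p0 p1 by (intro sum_mono mult_right_mono) auto

lemma rprob_nonneg: "0 \<le> rprob V p A"
  unfolding rprob_def using p0 p1 by (intro sum_nonneg) auto

lemma Q_nonneg: "0 \<le> Q F"
  unfolding Q_def by (rule rprob_nonneg)

lemma Q_antimono: "F \<subseteq> G \<Longrightarrow> Q G \<le> Q F"
  unfolding Q_def by (rule rprob_mono) (auto simp: avoids_def)

lemma Q_pos: "{} \<notin> F \<Longrightarrow> 0 < Q F"
  unfolding Q_def using fin p0 p1 by (intro rprob_pos) (auto simp: avoids_def)

lemma Q_zero: "{} \<in> F \<Longrightarrow> Q F = 0"
  unfolding Q_def rprob_def avoids_def by (intro sum.neutral) auto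

lemma Q_split:
  assumes "w \<in> V"
  shows "Q F = p * Q (contr F {w}) + (1 - p) * Q {f\<in>F. w \<notin> f}"
  unfolding Q_def by (subst rprob_split[OF fin assms]) (simp add: avoids_insert_iff avoids_remove_iff)

lemma rprob_superset:
  assumes "finite f" "f \<subseteq> V"
  shows "rprob V p (\<lambda>I. f \<subseteq> I \<and> avoids F I) = p ^ card f * Q (contr F f)"
  using assms
proof (induction f arbitrary: F)
  case empty
  then show ?case by (simp add: Q_def)
next
  case (insert w f)
  have a: "f \<subseteq> insert w I \<longleftrightarrow> f \<subseteq> I" for I using insert.hyps by auto
  have "rprob V p (\<lambda>I. insert w f \<subseteq> I \<and> avoids F I) =
      p * rprob V p (\<lambda>I. f \<subseteq> I \<and> avoids (contr F {w}) I) + (1 - p) * rprob V p (\<lambda>I. False)"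
    by (subst rprob_split[OF fin, of w]) (use insert.prems in \<open>simp_all add: a avoids_insert_iff\<close>)
  also have "rprob V p (\<lambda>I. False) = 0" by (simp add: rprob_def)
  also have "rprob V p (\<lambda>I. f \<subseteq> I \<and> avoids (contr F {w}) I) = p ^ card f * Q (contr F (insert w f))"
    using insert by (simp add: contr_contr)
  finally show ?case using insert.hyps by simp
qed

lemma marg_eq:
  assumes "w \<in> V"
  shows "marg F w = rprob V p (\<lambda>I. w \<in> I \<and> avoids F I) / rprob V p (avoids F)"
  using rprob_superset[of "{w}" F] assms by (simp add: marg_def Q_def)

text \<open>Avoidance of \<open>F\<close> splits according to whether \<open>f\<close> is fully
  occupied. If \<open>Q F = 0\<close>, both sides vanish because a larger family is avoided less
  often.\<close>

lemma Q_insert: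
  assumes "f \<subseteq> V"
  shows "Q (insert f F) = Q F * (1 - cond F f)"
proof -
  have ff: "finite f" using assms fin finite_subset by auto
  have "Q F = Q (insert f F) + rprob V p (\<lambda>I. f \<subseteq> I \<and> avoids F I)"
    unfolding Q_def rprob_def sum.distrib[symmetric]
    by (intro sum.cong refl) (auto simp: avoids_def)
  then have e: "Q F = Q (insert f F) + p ^ card f * Q (contr F f)"
    using rprob_superset[OF ff assms] by simp
  show ?thesis
  proof (cases "Q F = 0")
    case True
    then show ?thesis using Q_antimono[of F "insert f F"] Q_nonneg[of "insert f F"] by auto
  next
    case False
    then show ?thesis using e by (simp add: cond_def field_simps)
  qed
qed

lemma cond_nonneg: "0 \<le> cond F f"
  unfolding cond_def using Q_nonneg p0 by simp

lemma marg_nonneg: "0 \<le> marg F w"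
  unfolding marg_def using Q_nonneg p0 by simp

text \<open>The chain rule for exposing an edge point by point: once \<open>f\<close> is occupied,
  the next point has the marginal of the contracted family. In the degenerate case the further
  contraction has probability 0 too, being a nonnegative summand of a vanishing \<open>Q\<close>
  with positive weight.\<close>

lemma cond_insert:
  assumes "w \<in> V" "w \<notin> f" "finite f"
  shows "cond F (insert w f) = cond F f * marg (contr F f) w"
proof (cases "Q (contr F f) = 0")
  case True
  have "0 \<le> (1 - p) * Q {g \<in> contr F f. w \<notin> g}" "0 \<le> p * Q (contr (contr F f) {w})"
    using Q_nonneg p0 p1 by auto
  then have "p * Q (contr (contr F f) {w}) = 0"
    using True Q_split[OF assms(1), of "contr F f"] by linarith
  then have "Q (contr F (insert w f)) = 0" using p0 by (simp add: contr_contr)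
  then show ?thesis using True by (simp add: cond_def)
next
  case False
  then show ?thesis using assms by (simp add: cond_def marg_def contr_contr)
qed

text \<open>Multiplies the chain rule along \<open>f\<close>. The points may be exposed in any
  order, so the bound on the marginal is asked for after every part \<open>C\<close> of
  \<open>f\<close>.\<close>

lemma cond_le_prod:
  assumes "finite f" "f \<subseteq> V"
    and "\<And>C w. C \<subseteq> f \<Longrightarrow> w \<in> f - C \<Longrightarrow> marg (contr F C) w \<le> hi w"
  shows "Q F = 0 \<or> cond F f \<le> prod hi f"
  using assms
proof (induction f)
  case empty
  then show ?case by (simp add: cond_def)
next
  case (insert w f)
  have m: "marg (contr F f) w \<le> hi w" using insert.hyps insert.prems(2)[of f w] by auto
  have "Q F = 0 \<or> cond F f \<le> prod hi f"
    using insert.prems by (intro insert.IH) auto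
  moreover have "cond F f * marg (contr F f) w \<le> prod hi f * hi w" if "cond F f \<le> prod hi f"
    using that m cond_nonneg marg_nonneg by (intro mult_mono) (auto intro: order_trans)
  ultimately show ?case
    using insert.hyps insert.prems(1) by (auto simp: cond_insert mult.commute)
qed

lemma prod_le_cond:
  assumes "finite f" "f \<subseteq> V" "Q F \<noteq> 0"
    and "\<And>C w. C \<subseteq> f \<Longrightarrow> w \<in> f - C \<Longrightarrow> lo w \<le> marg (contr F C) w"
    and "\<And>w. w \<in> f \<Longrightarrow> 0 \<le> lo w"
  shows "prod lo f \<le> cond F f"
  using assms
proof (induction f)
  case empty
  then show ?case by (simp add: cond_def)
next
  case (insert w f)
  have m: "lo w \<le> marg (contr F f) w" using insert.hyps insert.prems(3)[of f w] by auto
  have "prod lo f \<le> cond F f"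
    using insert.prems by (intro insert.IH) auto
  then have "prod lo f * lo w \<le> cond F f * marg (contr F f) w"
    using m insert.prems cond_nonneg marg_nonneg by (intro mult_mono) (auto intro: order_trans)
  then show ?case
    using insert.hyps insert.prems(1) by (auto simp: cond_insert mult.commute)
qed

text \<open>Telescopes \<open>Q_insert\<close> over \<open>A\<close>; again the order is open, so
  the bound on the filling probability is asked for after any part \<open>B\<close> of
  \<open>A\<close> has been imposed.\<close>

lemma Q_union_ge:
  assumes "finite A" "\<And>f. f \<in> A \<Longrightarrow> f \<subseteq> V"
    and "\<And>B f. B \<subseteq> A \<Longrightarrow> f \<in> A - B \<Longrightarrow> cond (G \<union> B) f \<le> hi f"
    and "\<And>f. f \<in> A \<Longrightarrow> hi f \<le> 1"
  shows "Q G * (\<Prod>f\<in>A. 1 - hi f) \<le> Q (G \<union> A)"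
  using assms
proof (induction A)
  case empty
  then show ?case by simp
next
  case (insert f A)
  have "Q G * (\<Prod>f\<in>A. 1 - hi f) * (1 - hi f) \<le> Q (G \<union> A) * (1 - cond (G \<union> A) f)"
  proof (intro mult_mono)
    show "Q G * (\<Prod>f\<in>A. 1 - hi f) \<le> Q (G \<union> A)"
      using insert.prems by (intro insert.IH) (auto intro!: insert.prems(2))
    show "1 - hi f \<le> 1 - cond (G \<union> A) f"
      using insert.prems(2)[of A f] insert.hyps by auto
  qed (use insert.prems Q_nonneg in auto)
  also have "\<dots> = Q (G \<union> insert f A)" using insert.prems by (simp add: Q_insert)
  finally show ?case using insert.hyps by (simp add: mult_ac)
qed

lemma Q_union_le:
  assumes "finite A" "\<And>f. f \<in> A \<Longrightarrow> f \<subseteq> V"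
    and "\<And>B f. B \<subseteq> A \<Longrightarrow> f \<in> A - B \<Longrightarrow> lo f \<le> cond (G \<union> B) f"
    and "\<And>f. f \<in> A \<Longrightarrow> lo f \<le> 1"
  shows "Q (G \<union> A) \<le> Q G * (\<Prod>f\<in>A. 1 - lo f)"
  using assms
proof (induction A)
  case empty
  then show ?case by simp
next
  case (insert f A)
  have "Q (G \<union> insert f A) = Q (G \<union> A) * (1 - cond (G \<union> A) f)"
    using insert.prems by (simp add: Q_insert)
  also have "\<dots> \<le> Q (G \<union> A) * (1 - lo f)"
    using insert.prems(2)[of A f] insert.hyps Q_nonneg by (intro mult_left_mono) auto
  also have "\<dots> \<le> (Q G * (\<Prod>f\<in>A. 1 - lo f)) * (1 - lo f)"
    using insert.prems by (intro mult_right_mono insert.IH) (auto intro!: insert.prems(2))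
  finally show ?case using insert.hyps by (simp add: mult_ac)
qed

lemma Q_contr_le: "Q (contr F {w}) \<le> Q {f\<in>F. w \<notin> f}"
  by (rule Q_antimono) (force simp: contr_def)

text \<open>The ratio \<open>q\<close> is the probability that occupying \<open>w\<close> violates
  nothing, given that the constraints not containing \<open>w\<close> are respected. The marginal
  equals \<open>p * q / (p * q + 1 - p)\<close>, whose denominator lies between \<open>1 - p\<close>
  and 1.\<close>

lemma marg_bounds:
  assumes "w \<in> V" "0 < Q {f\<in>F. w \<notin> f}"
  defines "q \<equiv> Q (contr F {w}) / Q {f\<in>F. w \<notin> f}"
  shows "p * q \<le> marg F w" "marg F w \<le> p * q / (1 - p)"
proof -
  define N D where "N = Q (contr F {w})" and "D = Q {f\<in>F. w \<notin> f}"
  have N: "0 \<le> N" "N \<le> D" "0 < D" using Q_nonneg Q_contr_le assms unfolding N_def D_def by auto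
  have m: "marg F w = p * N / (p * N + (1 - p) * D)"
    unfolding marg_def N_def D_def using Q_split[OF assms(1), of F] by simp
  have pos: "0 < (1 - p) * D" using N p1 by simp
  have "p * N \<le> p * D" using N p0 by simp
  then have le: "p * N + (1 - p) * D \<le> D" by (simp add: algebra_simps)
  have "p * N / D \<le> p * N / (p * N + (1 - p) * D)"
    using le N p0 pos by (intro divide_left_mono mult_pos_pos) (auto intro: add_nonneg_pos)
  then show "p * q \<le> marg F w" unfolding m q_def N_def D_def by simp
  have "p * N / (p * N + (1 - p) * D) \<le> p * N / ((1 - p) * D)"
    using N p0 p1 pos by (intro divide_left_mono mult_pos_pos) (auto intro: add_nonneg_pos)
  then show "marg F w \<le> p * q / (1 - p)" unfolding m q_def N_def D_def by (simp add: field_simps)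
qed

text \<open>Avoidance is a decreasing event, so conditioning on it can only make a point less
  likely. This is the a priori bound from which the later iteration starts.\<close>

lemma marg_le_p:
  assumes "w \<in> V"
  shows "marg F w \<le> p"
proof (cases "Q F = 0")
  case True
  then show ?thesis using p0 by (simp add: marg_def)
next
  case False
  have "(1 - p) * Q (contr F {w}) \<le> (1 - p) * Q {f\<in>F. w \<notin> f}"
    using Q_contr_le p1 by (intro mult_left_mono) auto
  then have "Q (contr F {w}) \<le> Q F" using Q_split[OF assms, of F] by (simp add: algebra_simps)
  then have "p * Q (contr F {w}) \<le> p * Q F" using p0 by simp
  then show ?thesis using False Q_nonneg[of F] by (simp add: marg_def pos_divide_le_eq)
qed

lemma marg_zero:
  assumes "{w} \<in> F"
  shows "marg F w = 0"
  using assms by (simp add: marg_def Q_zero contr_def image_iff bexI[of _ "{w}"])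

end

section \<open>Hypergraphs with bounded codegree\<close>

text \<open>The assumption \<open>links\<close> covers the one way in which an exposed point
  \<open>v\<close> can spoil an edge at \<open>w\<close> that \<open>codeg\<close> does not see:
  another edge through \<open>v\<close> that agrees with it except that \<open>v\<close> replaces
  \<open>w\<close>.\<close>

locale sparse_hypergraph = binomial_subset V p
  for V :: "'a set" and p :: real +
  fixes H :: "'a set set" and k K :: nat
  assumes k3: "3 \<le> k"
    and H_sub: "\<And>e. e \<in> H \<Longrightarrow> e \<subseteq> V"
    and H_card: "\<And>e. e \<in> H \<Longrightarrow> card e = k"
    and codeg: "\<And>v w. v \<noteq> w \<Longrightarrow> card {e\<in>H. v \<in> e \<and> w \<in> e} \<le> K"
    and links: "\<And>v w. v \<noteq> w \<Longrightarrow> card {e\<in>H. w \<in> e \<and> v \<notin> e \<and> insert v (e - {w}) \<in> H} \<le> K"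
begin

definition star :: "'a \<Rightarrow> 'a set set" where
  "star w = {e\<in>H. w \<in> e}"

text \<open>The families that arise when the vertices of \<open>S\<close> have been exposed: every edge disjoint from
  \<open>S\<close> is still present, and every other member is what is left of an edge outside \<open>S\<close>.\<close>
definition residual :: "'a set \<Rightarrow> 'a set set \<Rightarrow> bool" where
  "residual S F \<longleftrightarrow> (\<forall>e\<in>H. e \<inter> S = {} \<longrightarrow> e \<in> F) \<and> (\<forall>f\<in>F. \<exists>e\<in>H. f = e - S)"

definition marg_ub :: "nat \<Rightarrow> ('a \<Rightarrow> real) \<Rightarrow> bool" where
  "marg_ub s hi \<longleftrightarrow> (\<forall>S F w. S \<subseteq> V \<and> card S \<le> s \<and> residual S F \<and> w \<in> V - S \<longrightarrow> marg F w \<le> hi w)"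

text \<open>If \<open>{}\<close> or \<open>{w}\<close> belongs to \<open>F\<close>, the marginal is
  0, so a positive lower bound can only be expected when both are absent. Both bounds are uniform
  over residual families because the recursion passes through contracted and partly rebuilt
  families.\<close>

definition marg_lb :: "nat \<Rightarrow> ('a \<Rightarrow> real) \<Rightarrow> bool" where
  "marg_lb s lo \<longleftrightarrow> (\<forall>S F w. S \<subseteq> V \<and> card S \<le> s \<and> residual S F \<and> w \<in> V - S \<and>
      {} \<notin> F \<and> {w} \<notin> F \<longrightarrow> lo w \<le> marg F w)"

section \<open>Residual families and their recursion\<close>

lemma H_fin: "finite H"
proof (rule finite_subset)
  show "H \<subseteq> Pow V" by (intro subsetI PowI H_sub)
  show "finite (Pow V)" using fin by simp
qed

lemma e_fin: "e \<in> H \<Longrightarrow> finite e"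
  by (rule finite_subset[OF H_sub fin])

lemma star_fin: "finite (star w)"
  unfolding star_def by (rule finite_subset[OF Collect_restrict H_fin])

lemma inj_star: "inj_on (\<lambda>e. e - {w}) (star w)"
proof (rule inj_onI)
  fix e e' assume e: "e \<in> star w" "e' \<in> star w" "e - {w} = e' - {w}"
  then have "insert w (e - {w}) = insert w (e' - {w})" by simp
  moreover have "insert w (e - {w}) = e" "insert w (e' - {w}) = e'"
    using e(1,2) by (simp_all add: star_def insert_absorb)
  ultimately show "e = e'" by simp
qed

lemma card_star_meet:
  assumes "finite S" "w \<notin> S"
  shows "card {e\<in>star w. e \<inter> S \<noteq> {}} \<le> card S * K"
proof -
  have "{e\<in>star w. e \<inter> S \<noteq> {}} \<subseteq> (\<Union>v\<in>S. {e\<in>H. v \<in> e \<and> w \<in> e})"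
    by (auto simp: star_def)
  then have "card {e\<in>star w. e \<inter> S \<noteq> {}} \<le> card (\<Union>v\<in>S. {e\<in>H. v \<in> e \<and> w \<in> e})"
    using assms H_fin by (intro card_mono) auto
  also have "\<dots> \<le> (\<Sum>v\<in>S. card {e\<in>H. v \<in> e \<and> w \<in> e})"
    using assms by (intro card_UN_le) auto
  also have "\<dots> \<le> (\<Sum>v\<in>S. K)" using assms by (intro sum_mono codeg) auto
  finally show ?thesis by simp
qed

text \<open>The families met during an exposure at \<open>w\<close> consist of the constraints not
  through \<open>w\<close> and the part \<open>B\<close> of the shortened ones imposed so far,
  contracted by the points \<open>C\<close> already found occupied. They are residual again with
  \<open>w\<close> and \<open>C\<close> exposed, which closes the recursion.\<close>

lemma residual_contr:
  assumes "residual S F" "w \<notin> S" "B \<subseteq> (\<lambda>f. f - {w}) ` {f\<in>F. w \<in> f}" "w \<notin> C"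
  shows "residual (insert w S \<union> C) (contr ({f\<in>F. w \<notin> f} \<union> B) C)"
  unfolding residual_def
proof (intro conjI ballI impI)
  fix e assume e: "e \<in> H" "e \<inter> (insert w S \<union> C) = {}"
  then have "e \<in> F" "w \<notin> e" "e - C = e" using assms(1) unfolding residual_def by auto
  then show "e \<in> contr ({f\<in>F. w \<notin> f} \<union> B) C" unfolding contr_def
    by (metis (mono_tags, lifting) UnI1 image_eqI mem_Collect_eq)
next
  fix f assume "f \<in> contr ({f\<in>F. w \<notin> f} \<union> B) C"
  then obtain g where g: "f = g - C" "g \<in> {f\<in>F. w \<notin> f} \<union> B" unfolding contr_def by auto
  have "\<exists>e\<in>H. g = e - insert w S"
  proof (cases "g \<in> B")
    case True
    then obtain f' where "f' \<in> F" "g = f' - {w}" using assms(3) by auto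
    moreover then obtain e where "e \<in> H" "f' = e - S" using assms(1) unfolding residual_def by blast
    ultimately have "g = e - insert w S" by auto
    then show ?thesis using \<open>e \<in> H\<close> by blast
  next
    case False
    then have "g \<in> F" "w \<notin> g" using g by auto
    moreover then obtain e where "e \<in> H" "g = e - S" using assms(1) unfolding residual_def by blast
    ultimately have "g = e - insert w S" by auto
    then show ?thesis using \<open>e \<in> H\<close> by blast
  qed
  then obtain e where "e \<in> H" "g = e - insert w S" by blast
  then show "\<exists>e\<in>H. f = e - (insert w S \<union> C)" using g by (intro bexI[of _ e]) auto
qed

lemma residual_link:
  assumes "residual S F" "w \<notin> S"
  shows "(\<lambda>f. f - {w}) ` {f\<in>F. w \<in> f} \<subseteq> (\<lambda>e. e - S - {w}) ` star w"
proof
  fix g assume "g \<in> (\<lambda>f. f - {w}) ` {f\<in>F. w \<in> f}"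
  then obtain f where f: "f \<in> F" "w \<in> f" "g = f - {w}" by auto
  moreover then obtain e where "e \<in> H" "f = e - S" using assms(1) unfolding residual_def by blast
  ultimately show "g \<in> (\<lambda>e. e - S - {w}) ` star w" by (auto simp: star_def)
qed

lemma contr_eq: "contr F {w} = {f\<in>F. w \<notin> f} \<union> (\<lambda>f. f - {w}) ` {f\<in>F. w \<in> f}"
proof -
  have "(\<lambda>f. f - {w}) ` {f\<in>F. w \<notin> f} = id ` {f\<in>F. w \<notin> f}"
    by (rule image_cong) auto
  moreover have "contr F {w} = (\<lambda>f. f - {w}) ` ({f\<in>F. w \<notin> f} \<union> {f\<in>F. w \<in> f})"
    unfolding contr_def by (rule image_cong) auto
  ultimately show ?thesis by (simp only: image_Un image_id id_apply)
qed

text \<open>Common preparation for both passes. The budget \<open>s + k\<close> pays for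
  \<open>w\<close> and at most \<open>k - 1\<close> further points of an edge at
  \<open>w\<close>.\<close>

lemma residual_facts:
  assumes S: "S \<subseteq> V" "card S \<le> s" "residual S F" "w \<in> V - S" "{} \<notin> F" "{w} \<notin> F"
  defines "A \<equiv> (\<lambda>f. f - {w}) ` {f\<in>F. w \<in> f}"
  shows "A \<subseteq> (\<lambda>e. e - S - {w}) ` star w" "finite A" "\<And>f. f \<in> A \<Longrightarrow> f \<subseteq> V" "{} \<notin> A"
    and "\<And>B C v. B \<subseteq> A \<Longrightarrow> e \<in> star w \<Longrightarrow> e \<inter> S = {} \<Longrightarrow> C \<subseteq> e - {w} \<Longrightarrow> v \<in> e - {w} - C \<Longrightarrow>
      insert w S \<union> C \<subseteq> V \<and> card (insert w S \<union> C) \<le> s + k \<and>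
      residual (insert w S \<union> C) (contr ({f\<in>F. w \<notin> f} \<union> B) C) \<and> v \<in> V - (insert w S \<union> C)"
proof -
  have finS: "finite S" by (rule finite_subset[OF S(1) fin])
  show Alink: "A \<subseteq> (\<lambda>e. e - S - {w}) ` star w"
    unfolding A_def using residual_link S by auto
  show "finite A" by (rule finite_subset[OF Alink]) (use star_fin in simp)
  show "f \<subseteq> V" if "f \<in> A" for f using that Alink H_sub by (auto simp: star_def)
  show "{} \<notin> A" using S(5,6) unfolding A_def by (auto simp: subset_singleton_iff)
  fix B C v assume *: "B \<subseteq> A" "e \<in> star w" "e \<inter> S = {}" "C \<subseteq> e - {w}" "v \<in> e - {w} - C"
  have e: "e \<in> H" "w \<in> e" using *(2) by (auto simp: star_def)
  have "card (insert w S \<union> C) \<le> s + k"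
  proof -
    have "card (insert w S \<union> C) \<le> card (insert w S) + card C" by (rule card_Un_le)
    also have "card (insert w S) \<le> Suc s" using S finS by (simp add: card_insert_if)
    also have "card C \<le> card (e - {w})" using *(4) e_fin[OF e(1)] by (intro card_mono) auto
    also have "card (e - {w}) = k - 1" using e H_card e_fin by simp
    finally show ?thesis using k3 by simp
  qed
  moreover have "residual (insert w S \<union> C) (contr ({f\<in>F. w \<notin> f} \<union> B) C)"
    by (rule residual_contr) (use S * in \<open>auto simp: A_def\<close>)
  moreover have "insert w S \<union> C \<subseteq> V" "v \<in> V - (insert w S \<union> C)" using S * H_sub[OF e(1)] by auto
  ultimately show "insert w S \<union> C \<subseteq> V \<and> card (insert w S \<union> C) \<le> s + k \<and>
      residual (insert w S \<union> C) (contr ({f\<in>F. w \<notin> f} \<union> B) C) \<and> v \<in> V - (insert w S \<union> C)" by blast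
qed

text \<open>The factor of the edges meeting \<open>S\<close> is \<open>(1 - p) ^ (s * K)\<close>: there are at most \<open>s * K\<close> of
  them, and each is fully occupied with conditional probability at most \<open>p\<close>.\<close>
lemma marg_lower_step:
  assumes ub: "marg_ub (s + k) hi"
    and hi: "\<And>v. 0 \<le> hi v" "\<And>e. e \<in> star w \<Longrightarrow> prod hi (e - {w}) \<le> 1"
    and S: "S \<subseteq> V" "card S \<le> s" "residual S F" "w \<in> V - S" "{} \<notin> F" "{w} \<notin> F"
  shows "p * ((1 - p) ^ (s * K) * (\<Prod>e\<in>star w. 1 - prod hi (e - {w}))) \<le> marg F w"
proof -
  define G A where "G = {f\<in>F. w \<notin> f}" and "A = (\<lambda>f. f - {w}) ` {f\<in>F. w \<in> f}"
  have finS: "finite S" by (rule finite_subset[OF S(1) fin])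
  note facts = residual_facts[OF S, folded A_def G_def]
  note Alink = facts(1) and finA = facts(2) and AV = facts(3) and A0 = facts(4)
  define A1 where "A1 = (\<lambda>e. e - {w}) ` {e\<in>star w. e \<inter> S = {}}"
  define h where "h f = (if f \<in> A1 then prod hi f else p)" for f
  have condh: "cond (G \<union> B) f \<le> h f" if B: "B \<subseteq> A" and f: "f \<in> A - B" for B f
  proof -
    have ff: "f \<subseteq> V" "f \<noteq> {}" using f AV A0 by blast+
    have fw: "w \<notin> f" using f by (auto simp: A_def)
    have ff1: "finite f" using ff(1) fin by (rule finite_subset)
    have "{} \<notin> G \<union> B" using A0 B S(5) by (auto simp: G_def)
    then have Qp: "Q (G \<union> B) \<noteq> 0" using Q_pos[of "G \<union> B"] by simp
    show ?thesis
    proof (cases "f \<in> A1")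
      case True
      then obtain e where e: "e \<in> star w" "e \<inter> S = {}" "f = e - {w}" unfolding A1_def by auto
      have "marg (contr (G \<union> B) C) v \<le> hi v" if C: "C \<subseteq> f" "v \<in> f - C" for C v
      proof -
        have "C \<subseteq> e - {w}" "v \<in> e - {w} - C" using C e by auto
        note facts(5)[OF B e(1,2) this]
        then show ?thesis by (rule ub[unfolded marg_ub_def, rule_format])
      qed
      then have "cond (G \<union> B) f \<le> prod hi f" using cond_le_prod[OF ff1 ff(1)] Qp by blast
      then show ?thesis using True by (simp add: h_def)
    next
      case False
      have "cond (G \<union> B) f \<le> (\<Prod>v\<in>f. p)"
        using cond_le_prod[OF ff1 ff(1), of "G \<union> B" "\<lambda>_. p"] marg_le_p Qp ff(1) by blast
      also have "\<dots> \<le> p ^ 1" using p0 p1 ff1 ff(2) unfolding prod_constant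
        by (intro power_decreasing) (auto simp: Suc_leI card_gt_0_iff)
      finally show ?thesis using False by (simp add: h_def)
    qed
  qed
  have A1hi: "0 \<le> 1 - prod hi f" "1 - prod hi f \<le> 1" if "f \<in> (\<lambda>e. e - {w}) ` star w" for f
    using that hi(2) by (auto intro!: prod_nonneg hi(1))
  have "A - A1 \<subseteq> (\<lambda>e. e - S - {w}) ` {e\<in>star w. e \<inter> S \<noteq> {}}"
  proof
    fix f assume f: "f \<in> A - A1"
    then obtain e where e: "e \<in> star w" "f = e - S - {w}" using Alink by auto
    have "e \<inter> S \<noteq> {}"
    proof
      assume "e \<inter> S = {}"
      then have "e - S = e" by auto
      then have "f \<in> A1" using e \<open>e \<inter> S = {}\<close> unfolding A1_def by auto
      then show False using f by simp
    qed
    then show "f \<in> (\<lambda>e. e - S - {w}) ` {e\<in>star w. e \<inter> S \<noteq> {}}" using e by auto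
  qed
  then have "card (A - A1) \<le> card {e\<in>star w. e \<inter> S \<noteq> {}}"
    using star_fin by (intro surj_card_le) auto
  also have "\<dots> \<le> card S * K" using card_star_meet finS S by auto
  also have "\<dots> \<le> s * K" using S by simp
  finally have cA2: "card (A - A1) \<le> s * K" .
  have "(1 - p) ^ (s * K) * (\<Prod>e\<in>star w. 1 - prod hi (e - {w}))
      = (1 - p) ^ (s * K) * (\<Prod>f\<in>(\<lambda>e. e - {w}) ` star w. 1 - prod hi f)"
    by (simp add: prod.reindex[OF inj_star])
  \<comment> \<open>All factors lie between 0 and 1, so passing from the whole star to the links
    that occur in \<open>A\<close>, and from \<open>s * K\<close> to the actual number of damaged
    constraints, can only raise the product.\<close>
  also have "\<dots> \<le> (1 - p) ^ card (A - A1) * (\<Prod>f\<in>A \<inter> A1. 1 - prod hi f)"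
  proof (intro mult_mono)
    show "(1 - p) ^ (s * K) \<le> (1 - p) ^ card (A - A1)"
      using cA2 p0 p1 by (intro power_decreasing) auto
    have sub: "A \<inter> A1 \<subseteq> (\<lambda>e. e - {w}) ` star w" by (auto simp: A1_def)
    show "(\<Prod>f\<in>(\<lambda>e. e - {w}) ` star w. 1 - prod hi f) \<le> (\<Prod>f\<in>A \<inter> A1. 1 - prod hi f)"
    proof -
      have "(\<Prod>f\<in>(\<lambda>e. e - {w}) ` star w. 1 - prod hi f) =
        (\<Prod>f\<in>(\<lambda>e. e - {w}) ` star w - A \<inter> A1. 1 - prod hi f) * (\<Prod>f\<in>A \<inter> A1. 1 - prod hi f)"
        using prod.subset_diff[OF sub] star_fin by blast
      also have "\<dots> \<le> 1 * (\<Prod>f\<in>A \<inter> A1. 1 - prod hi f)"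
      proof (rule mult_right_mono)
        show "(\<Prod>f\<in>(\<lambda>e. e - {w}) ` star w - A \<inter> A1. 1 - prod hi f) \<le> 1"
        proof -
          have "0 \<le> 1 - prod hi f \<and> 1 - prod hi f \<le> 1" if "f \<in> (\<lambda>e. e - {w}) ` star w - A \<inter> A1" for f
            using A1hi[of f] that by simp
          then show ?thesis by (simp only: prod_le_1)
        qed
        show "0 \<le> (\<Prod>f\<in>A \<inter> A1. 1 - prod hi f)"
          by (rule prod_nonneg, rule A1hi(1), erule subsetD[OF sub])
      qed
      finally show ?thesis by simp
    qed
    show "0 \<le> (\<Prod>f\<in>(\<lambda>e. e - {w}) ` star w. 1 - prod hi f)"
      by (rule prod_nonneg, rule A1hi(1))
  qed (use p1 in auto)
  also have "\<dots> = (\<Prod>f\<in>A. 1 - h f)"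
  proof -
    have "(\<Prod>f\<in>A. 1 - h f) = (\<Prod>f\<in>A - A1. 1 - h f) * (\<Prod>f\<in>A \<inter> A1. 1 - h f)"
      using prod.Int_Diff[OF finA, of _ A1] by (simp add: mult.commute)
    then show ?thesis by (simp add: h_def)
  qed
  finally have le: "(1 - p) ^ (s * K) * (\<Prod>e\<in>star w. 1 - prod hi (e - {w})) \<le> (\<Prod>f\<in>A. 1 - h f)" .
  have QG: "0 < Q G" using S Q_pos[of G] by (auto simp: G_def)
  have "Q G * (\<Prod>f\<in>A. 1 - h f) \<le> Q (G \<union> A)"
  proof (rule Q_union_ge[OF finA AV condh])
    show "h f \<le> 1" for f
    proof (cases "f \<in> A1")
      case True
      then have "f \<in> (\<lambda>e. e - {w}) ` star w" by (auto simp: A1_def)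
      then show ?thesis using A1hi(1)[of f] True by (simp add: h_def)
    qed (use p1 in \<open>simp add: h_def\<close>)
  qed auto
  then have "(\<Prod>f\<in>A. 1 - h f) \<le> Q (contr F {w}) / Q G"
    using QG by (simp add: contr_eq G_def A_def field_simps)
  then have "p * ((1 - p) ^ (s * K) * (\<Prod>e\<in>star w. 1 - prod hi (e - {w}))) \<le> p * (Q (contr F {w}) / Q G)"
    using le p0 by (intro mult_left_mono) auto
  also have "\<dots> \<le> marg F w"
    using marg_bounds(1)[of w F] QG S unfolding G_def by auto
  finally show ?thesis .
qed

text \<open>Edges at \<open>w\<close> for which \<open>marg_lb\<close> gives no lower bound on the conditional probability of being
  filled, since some other constraint lies inside the edge.\<close>
definition blocked :: "'a set \<Rightarrow> 'a set set \<Rightarrow> 'a \<Rightarrow> 'a set set" where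
  "blocked S F w = {e\<in>star w. e \<inter> S \<noteq> {} \<or>
     (\<exists>g\<in>{f\<in>F. w \<notin> f} \<union> ((\<lambda>f. f - {w}) ` {f\<in>F. w \<in> f} - {e - {w}}). g \<subseteq> e - {w})}"

lemma blocked_iff: "e \<in> blocked S F w \<longleftrightarrow> e \<in> star w \<and> (e \<inter> S \<noteq> {} \<or>
     (\<exists>g\<in>{f\<in>F. w \<notin> f} \<union> ((\<lambda>f. f - {w}) ` {f\<in>F. w \<in> f} - {e - {w}}). g \<subseteq> e - {w}))"
  unfolding blocked_def mem_Collect_eq ..

text \<open>A constraint \<open>g\<close> inside \<open>e - {w}\<close> is what some edge
  \<open>e' \<noteq> e\<close> leaves outside \<open>insert w S\<close>. This \<open>e'\<close>
  meets \<open>S\<close>, since otherwise \<open>e' \<subseteq> e\<close> although both have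
  \<open>k\<close> points. If \<open>e'\<close> contains two points of \<open>insert w S\<close>,
  there are few such \<open>e'\<close>, and \<open>e\<close> passes through \<open>w\<close> and a
  further point of \<open>e'\<close>. Otherwise \<open>e'\<close> loses a single point, so
  \<open>g\<close> has \<open>k - 1\<close> points and equals \<open>e - {w}\<close>: the exchange
  counted by \<open>links\<close>.\<close>

lemma blocked_subset:
  assumes F: "residual S F" "w \<notin> S" "{} \<notin> F" "{w} \<notin> F"
  defines "E2 \<equiv> (\<Union>ab\<in>{ab\<in>insert w S \<times> insert w S. fst ab \<noteq> snd ab}. {e\<in>H. fst ab \<in> e \<and> snd ab \<in> e})"
  shows "blocked S F w \<subseteq> {e\<in>star w. e \<inter> S \<noteq> {}} \<union>
     ((\<Union>e'\<in>E2. \<Union>x\<in>e' - {w}. {e\<in>H. x \<in> e \<and> w \<in> e}) \<union>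
      (\<Union>v\<in>S. {e\<in>H. w \<in> e \<and> v \<notin> e \<and> insert v (e - {w}) \<in> H}))" (is "_ \<subseteq> ?R")
proof
  fix e assume eb: "e \<in> blocked S F w"
  show "e \<in> ?R"
  proof (cases "e \<inter> S = {}")
    case False
    have "e \<in> star w" using eb by (rule blocked_iff[THEN iffD1, THEN conjunct1])
    with False have "e \<in> {e\<in>star w. e \<inter> S \<noteq> {}}" by (intro CollectI conjI)
    then show ?thesis by (rule UnI1)
  next
    case True
    have e: "e \<in> H" "w \<in> e" using blocked_iff[THEN iffD1, OF eb, THEN conjunct1] by (auto simp: star_def)
    define U where "U = {f\<in>F. w \<notin> f} \<union> ((\<lambda>f. f - {w}) ` {f\<in>F. w \<in> f} - {e - {w}})"
    have "e \<inter> S \<noteq> {} \<or> (\<exists>g\<in>U. g \<subseteq> e - {w})"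
      unfolding U_def using eb by (rule blocked_iff[THEN iffD1, THEN conjunct2])
    then obtain g where g: "g \<in> U" "g \<subseteq> e - {w}" using True by blast
    have "\<exists>e'\<in>H. g = e' - insert w S \<and> e' \<noteq> e \<and> g \<noteq> {}"
    proof (cases "g \<in> F \<and> w \<notin> g")
      case gF: True
      then obtain e' where "e' \<in> H" "g = e' - S" using F(1) unfolding residual_def by blast
      moreover have "g \<noteq> {}" using gF F(3) by auto
      ultimately show ?thesis using gF F(2) e by (intro bexI[of _ e']) auto
    next
      case False
      then have "g \<notin> {f\<in>F. w \<notin> f}" by simp
      then have "g \<in> (\<lambda>f. f - {w}) ` {f\<in>F. w \<in> f} - {e - {w}}" using g(1) by (simp only: U_def Un_iff simp_thms)
      then have gA: "g \<in> (\<lambda>f. f - {w}) ` {f\<in>F. w \<in> f}" "g \<notin> {e - {w}}" by (simp_all only: Diff_iff simp_thms)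
      from gA(1) have "\<exists>f\<in>{f\<in>F. w \<in> f}. g = f - {w}" by (simp only: image_iff)
      then obtain f where "f \<in> {f\<in>F. w \<in> f}" "g = f - {w}" by (rule bexE)
      with gA(2) have f: "f \<in> F" "w \<in> f" "g = f - {w}" "g \<noteq> e - {w}" by simp_all
      then obtain e' where e': "e' \<in> H" "f = e' - S" using F(1) unfolding residual_def by blast
      have "g = e' - insert w S" using f e' by auto
      moreover have "e' \<noteq> e"
      proof
        assume "e' = e"
        then have "f = e" using e' True by auto
        then show False using f by simp
      qed
      moreover have "g \<noteq> {}"
      proof
        assume "g = {}"
        then have "f = {w}" using f by auto
        then show False using f F(4) by simp
      qed
      ultimately show ?thesis using e' by blast
    qed
    then obtain e' x where e': "e' \<in> H" "g = e' - insert w S" "e' \<noteq> e" "x \<in> g" by blast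
    have "e' \<inter> S \<noteq> {}"
    proof
      assume "e' \<inter> S = {}"
      then have "e' \<subseteq> e" using e' g(2) e by auto
      then have "e' = e" using card_subset_eq[OF e_fin[OF e(1)]] H_card e e' by simp
      then show False using e' by simp
    qed
    then obtain v where v: "v \<in> e'" "v \<in> S" by blast
    show ?thesis
    proof (cases "\<exists>a\<in>insert w S. \<exists>b\<in>insert w S. a \<noteq> b \<and> a \<in> e' \<and> b \<in> e'")
      case True
      then obtain a b where ab: "a \<in> insert w S" "b \<in> insert w S" "a \<noteq> b" "a \<in> e'" "b \<in> e'" by blast
      have "e' \<in> E2" unfolding E2_def by (rule UN_I[of "(a, b)"]) (use ab e' in auto)
      moreover have "x \<in> e' - {w}" "e \<in> {e\<in>H. x \<in> e \<and> w \<in> e}" using e' g e by auto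
      ultimately show ?thesis by blast
    next
      case False
      then have only: "e' \<inter> insert w S = {v}" using v by blast
      then have gv: "g = e' - {v}" using e' by blast
      have "w \<noteq> v" using F(2) v by auto
      then have "w \<notin> e'" using only by auto
      have "card g = k - 1" using gv v(1) e'(1) H_card e_fin by simp
      also have "\<dots> = card (e - {w})" using e H_card e_fin by simp
      finally have "g = e - {w}" using card_subset_eq[of "e - {w}" g] g(2) e_fin[OF e(1)] by simp
      then have "insert v (e - {w}) = e'" using gv v by auto
      moreover have "v \<notin> e" using v \<open>e \<inter> S = {}\<close> by auto
      ultimately have "e \<in> {e\<in>H. w \<in> e \<and> v \<notin> e \<and> insert v (e - {w}) \<in> H}" using e e' by simp
      then show ?thesis using v by blast
    qed
  qed
qed

text \<open>The summands count the edges meeting \<open>S\<close>, the edges sharing a point with an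
  edge through two points of \<open>insert w S\<close>, and the exchanges. The size of the ground
  set does not enter.\<close>

definition blocked_bound :: "nat \<Rightarrow> nat" where
  "blocked_bound s = s * K + (((s + 1) * (s + 1) * K) * (k * K) + s * K)"

lemma card_blocked:
  assumes F: "residual S F" "w \<notin> S" "{} \<notin> F" "{w} \<notin> F" and S: "finite S" "card S \<le> s"
  shows "card (blocked S F w) \<le> blocked_bound s"
proof -
  let ?T = "insert w S"
  let ?P = "{ab\<in>?T \<times> ?T. fst ab \<noteq> snd ab}"
  let ?E2 = "\<Union>ab\<in>?P. {e\<in>H. fst ab \<in> e \<and> snd ab \<in> e}"
  let ?X = "{e\<in>star w. e \<inter> S \<noteq> {}}"
  let ?Y = "\<Union>e'\<in>?E2. \<Union>x\<in>e' - {w}. {e\<in>H. x \<in> e \<and> w \<in> e}"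
  let ?Z = "\<Union>v\<in>S. {e\<in>H. w \<in> e \<and> v \<notin> e \<and> insert v (e - {w}) \<in> H}"
  have finP: "finite ?P" using S by simp
  have finE2: "finite ?E2" using H_fin by (intro finite_subset[OF _ H_fin]) auto
  have "card (blocked S F w) \<le> card (?X \<union> (?Y \<union> ?Z))"
    by (rule card_mono[OF _ blocked_subset[OF F]])
      (rule finite_subset[OF _ H_fin], auto simp: star_def)
  also have "\<dots> \<le> card ?X + (card ?Y + card ?Z)"
    by (rule order_trans[OF card_Un_le]) (intro add_mono order_refl card_Un_le)
  also have "card ?X \<le> s * K"
    using card_star_meet[OF S(1) F(2)] S(2) by (meson le_trans mult_le_mono1)
  also have "card ?Y \<le> ((s + 1) * (s + 1) * K) * (k * K)"
  proof -
    have "card ?P \<le> card (?T \<times> ?T)" using S by (intro card_mono) auto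
    also have "\<dots> = card ?T * card ?T" by (rule card_cartesian_product)
    also have "\<dots> \<le> (s + 1) * (s + 1)" using S by (intro mult_le_mono) (auto simp: card_insert_if)
    finally have cP: "card ?P \<le> (s + 1) * (s + 1)" .
    have "card ?E2 \<le> (\<Sum>ab\<in>?P. card {e\<in>H. fst ab \<in> e \<and> snd ab \<in> e})"
      using finP by (rule card_UN_le)
    also have "\<dots> \<le> (\<Sum>ab\<in>?P. K)" by (intro sum_mono codeg) auto
    also have "\<dots> = card ?P * K" by simp
    also have "\<dots> \<le> (s + 1) * (s + 1) * K" using cP by (rule mult_le_mono1)
    finally have cE2: "card ?E2 \<le> (s + 1) * (s + 1) * K" .
    have "card ?Y \<le> (\<Sum>e'\<in>?E2. card (\<Union>x\<in>e' - {w}. {e\<in>H. x \<in> e \<and> w \<in> e}))"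
      using finE2 by (rule card_UN_le)
    also have "\<dots> \<le> (\<Sum>e'\<in>?E2. k * K)"
    proof (rule sum_mono)
      fix e' assume "e' \<in> ?E2"
      then have e': "e' \<in> H" by auto
      have "card (\<Union>x\<in>e' - {w}. {e\<in>H. x \<in> e \<and> w \<in> e}) \<le> (\<Sum>x\<in>e' - {w}. card {e\<in>H. x \<in> e \<and> w \<in> e})"
        using e_fin[OF e'] by (intro card_UN_le) simp
      also have "\<dots> \<le> (\<Sum>x\<in>e' - {w}. K)" by (intro sum_mono codeg) auto
      also have "\<dots> = card (e' - {w}) * K" by simp
      also have "card (e' - {w}) \<le> k" using H_card[OF e'] e_fin[OF e'] by (metis card_Diff1_le)
      finally show "card (\<Union>x\<in>e' - {w}. {e\<in>H. x \<in> e \<and> w \<in> e}) \<le> k * K" by simp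
    qed
    also have "\<dots> = card ?E2 * (k * K)" by simp
    also have "\<dots> \<le> ((s + 1) * (s + 1) * K) * (k * K)" using cE2 by (rule mult_le_mono1)
    finally show ?thesis .
  qed
  also have "card ?Z \<le> s * K"
  proof -
    have "card ?Z \<le> (\<Sum>v\<in>S. card {e\<in>H. w \<in> e \<and> v \<notin> e \<and> insert v (e - {w}) \<in> H})"
      using S(1) by (rule card_UN_le)
    also have "\<dots> \<le> (\<Sum>v\<in>S. K)" using F(2) by (intro sum_mono links) auto
    also have "\<dots> \<le> s * K" using S(2) by simp
    finally show ?thesis .
  qed
  finally show ?thesis by (simp add: blocked_bound_def)
qed

text \<open>Leaving out the blocked edges costs boundedly many factors. For any other edge no
  constraint imposed so far lies inside it, so the families met while exposing it contain neither
  \<open>{}\<close> nor the singleton of the next point, and \<open>marg_lb\<close> applies to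
  them.\<close>

lemma marg_upper_step:
  assumes lb: "marg_lb (s + k) lo"
    and lo: "\<And>v. 0 \<le> lo v" "\<And>e. e \<in> star w \<Longrightarrow> prod lo (e - {w}) \<le> 1"
    and S: "S \<subseteq> V" "card S \<le> s" "residual S F" "w \<in> V - S"
  shows "\<exists>X\<subseteq>star w. card X \<le> blocked_bound s \<and>
    marg F w \<le> p / (1 - p) * (\<Prod>e\<in>star w - X. 1 - prod lo (e - {w}))"
proof (cases "{} \<in> F \<or> {w} \<in> F")
  case True
  then have "marg F w = 0" using marg_zero by (auto simp: marg_def Q_zero)
  moreover have "0 \<le> p / (1 - p) * (\<Prod>e\<in>star w - {}. 1 - prod lo (e - {w}))"
    using p0 p1 lo(2) by (intro mult_nonneg_nonneg prod_nonneg ballI) (auto simp: algebra_simps)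
  ultimately show ?thesis by (intro exI[of _ "{}"]) auto
next
  case False
  define G A where "G = {f\<in>F. w \<notin> f}" and "A = (\<lambda>f. f - {w}) ` {f\<in>F. w \<in> f}"
  define X where "X = blocked S F w"
  have XG: "X = {e\<in>star w. e \<inter> S \<noteq> {} \<or> (\<exists>g\<in>G \<union> (A - {e - {w}}). g \<subseteq> e - {w})}"
    by (simp add: X_def blocked_def G_def A_def)
  have finS: "finite S" by (rule finite_subset[OF S(1) fin])
  have F0: "{} \<notin> F" "{w} \<notin> F" using False by auto
  note facts = residual_facts[OF S F0, folded A_def G_def]
  note finA = facts(2) and AV = facts(3)
  define A1 where "A1 = (\<lambda>e. e - {w}) ` (star w - X)"
  have A1A: "A1 \<subseteq> A"
  proof
    fix f assume "f \<in> A1"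
    then obtain e where e: "e \<in> star w" "e \<inter> S = {}" "f = e - {w}" by (auto simp: A1_def XG)
    then have "e \<in> F" "w \<in> e" using S(3) by (auto simp: residual_def star_def)
    then show "f \<in> A" using e by (auto simp: A_def)
  qed
  \<comment> \<open>The value 0 is the trivial lower bound for the discarded constraints and turns
    their factors into 1.\<close>
  define l where "l f = (if f \<in> A1 then prod lo f else 0)" for f
  have condl: "l f \<le> cond (G \<union> B) f" if B: "B \<subseteq> A" and f: "f \<in> A - B" for B f
  proof (cases "f \<in> A1")
    case False
    then show ?thesis using cond_nonneg by (simp add: l_def)
  next
    case True
    then obtain e where e: "e \<in> star w" "e \<notin> X" "f = e - {w}" by (auto simp: A1_def)
    have eS: "e \<inter> S = {}" using e XG by blast
    have nosub: "\<not> g \<subseteq> f" if "g \<in> G \<union> B" for g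
      using that e B f unfolding XG by blast
    have ff: "f \<subseteq> V" using f AV by blast
    have ff1: "finite f" using ff fin by (rule finite_subset)
    have "{} \<notin> G \<union> B" using nosub by blast
    then have Qp: "Q (G \<union> B) \<noteq> 0" using Q_pos[of "G \<union> B"] by simp
    have "lo v \<le> marg (contr (G \<union> B) C) v" if C: "C \<subseteq> f" "v \<in> f - C" for C v
    proof -
      have "C \<subseteq> e - {w}" "v \<in> e - {w} - C" using C e by auto
      note facts(5)[OF B e(1) eS this]
      moreover have "{} \<notin> contr (G \<union> B) C"
      proof
        assume "{} \<in> contr (G \<union> B) C"
        then obtain g where "g \<in> G \<union> B" "g - C = {}" unfolding contr_def by (metis (no_types, lifting) imageE)
        then show False using nosub C by blast
      qed
      moreover have "{v} \<notin> contr (G \<union> B) C"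
      proof
        assume "{v} \<in> contr (G \<union> B) C"
        then obtain g where g: "g \<in> G \<union> B" "g - C = {v}" unfolding contr_def by (metis (no_types, lifting) imageE)
        then have "g \<subseteq> insert v C" by auto
        then have "g \<subseteq> f" using C by auto
        then show False using nosub g by blast
      qed
      ultimately show ?thesis using lb unfolding marg_lb_def by blast
    qed
    then have "prod lo f \<le> cond (G \<union> B) f" using prod_le_cond[OF ff1 ff Qp] lo(1) by blast
    then show ?thesis using True by (simp add: l_def)
  qed
  have QG: "0 < Q G" using False Q_pos[of G] by (auto simp: G_def)
  have "Q (G \<union> A) \<le> Q G * (\<Prod>f\<in>A. 1 - l f)"
  proof (rule Q_union_le[OF finA AV condl])
    show "l f \<le> 1" for f
    proof (cases "f \<in> A1")
      case True
      then obtain e where "e \<in> star w" "f = e - {w}" by (auto simp: A1_def)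
      then show ?thesis using lo(2)[of e] True by (simp add: l_def)
    qed (simp add: l_def)
  qed auto
  also have "(\<Prod>f\<in>A. 1 - l f) = (\<Prod>f\<in>A1. 1 - prod lo f)"
    by (rule prod.mono_neutral_cong_right[OF finA A1A]) (auto simp: l_def)
  also have "\<dots> = (\<Prod>e\<in>star w - X. 1 - prod lo (e - {w}))"
    unfolding A1_def by (subst prod.reindex) (auto intro: inj_on_subset[OF inj_star])
  finally have "Q (contr F {w}) / Q G \<le> (\<Prod>e\<in>star w - X. 1 - prod lo (e - {w}))"
    using QG by (simp add: contr_eq G_def A_def field_simps)
  then have "p / (1 - p) * (Q (contr F {w}) / Q G) \<le> p / (1 - p) * (\<Prod>e\<in>star w - X. 1 - prod lo (e - {w}))"
    using p0 p1 by (intro mult_left_mono) auto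
  moreover have "marg F w \<le> p / (1 - p) * (Q (contr F {w}) / Q G)"
    using marg_bounds(2)[of w F] QG S unfolding G_def by (auto simp: mult.commute)
  moreover have "card X \<le> blocked_bound s"
    unfolding X_def using card_blocked finS S False by auto
  moreover have "X \<subseteq> star w" by (auto simp: XG)
  ultimately show ?thesis by (intro exI[of _ X]) auto
qed

end

section \<open>The limit fixed point\<close>

text \<open>The fixed-point operator contracts the metric \<open>\<bar>ln (amp x) - ln (amp y)\<bar>\<close> all the way up to the
  critical value, which is not true of the more obvious choices \<open>\<bar>x - y\<bar>\<close> and \<open>\<bar>ln x - ln y\<bar>\<close>.\<close>
definition amp :: "nat \<Rightarrow> real \<Rightarrow> real \<Rightarrow> real" where
  "amp k t z = 1 + (real k - 1) * ln (t / z)"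

text \<open>The two products of \<open>Phi\<close> merged into one: \<open>u\<close> is the term in
  position \<open>j\<close> and \<open>s\<close> is the common difference.\<close>

abbreviation kern :: "nat \<Rightarrow> nat \<Rightarrow> (real \<Rightarrow> real) \<Rightarrow> real \<Rightarrow> real \<Rightarrow> real" where
  "kern k j x u s \<equiv> \<Prod>i\<in>{1..k} - {j}. x (u + (real i - real j) * s)"

definition Lam :: "nat \<Rightarrow> (real \<Rightarrow> real) \<Rightarrow> real \<Rightarrow> real" where
  "Lam k x u = (\<Sum>j=1..k. LBINT s:{0..upper k j u}. kern k j x u s)"

lemma prod_around:
  fixes x :: "real \<Rightarrow> real"
  assumes "j \<in> {1..k}"
  shows "(\<Prod>i=1..j-1. x (u - (real j - real i) * s)) * (\<Prod>i=j+1..k. x (u + (real i - real j) * s))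
    = kern k j x u s"
proof -
  have "{1..k} - {j} = {1..j-1} \<union> {j+1..k}" using assms by auto
  moreover have "{1..j-1} \<inter> {j+1..k} = {}" by auto
  ultimately show ?thesis
    by (simp add: prod.union_disjoint algebra_simps)
qed

lemma Phi_eq: "Phi k t x u = t * exp (- Lam k x u)"
proof -
  have "(\<Sum>j=1..k. LBINT s:{0..upper k j u}.
       (\<Prod>i=1..j-1. x (u - (real j - real i) * s)) * (\<Prod>i=j+1..k. x (u + (real i - real j) * s))) = Lam k x u"
    unfolding Lam_def by (intro sum.cong refl) (simp only: prod_around)
  then show ?thesis unfolding Phi_def by simp
qed

section \<open>Lengths of the integration ranges\<close>

lemma upper_nonneg:
  assumes "3 \<le> k" "u \<in> {0..1}" "j \<in> {1..k}"
  shows "0 \<le> upper k j u"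
  using assms unfolding upper_def by auto

text \<open>For steps up to \<open>upper k j u\<close> the first and the last term stay in the unit
  interval, and the other terms lie between them.\<close>

lemma upper_args:
  assumes k: "3 \<le> k" and u: "u \<in> {0..1}" and j: "j \<in> {1..k}" and i: "i \<in> {1..k}"
    and s: "s \<in> {0..upper k j u}"
  shows "u + (real i - real j) * s \<in> {0..1}"
proof -
  have s0: "0 \<le> s" using s by simp
  have a: "(real j - 1) * s \<le> u"
  proof (cases "j = 1")
    case True then show ?thesis using u by simp
  next
    case False
    then have "s \<le> u / (real j - 1)" using s by (auto simp: upper_def split: if_splits)
    then show ?thesis using False j by (simp add: field_simps)
  qed
  have b: "(real k - real j) * s \<le> 1 - u"
  proof (cases "j = k")
    case True then show ?thesis using u by simp
  next
    case False
    then have "s \<le> (1 - u) / (real k - real j)" using s by (auto simp: upper_def split: if_splits)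
    then show ?thesis using False j by (simp add: field_simps)
  qed
  have "(real j - real i) * s \<le> (real j - 1) * s" using i s0 by (intro mult_right_mono) auto
  moreover have "(real i - real j) * s \<le> (real k - real j) * s" using i s0 by (intro mult_right_mono) auto
  ultimately show ?thesis using a b by (auto simp: algebra_simps)
qed

lemma upper_reflect:
  assumes "3 \<le> k" "j \<in> {1..k}"
  shows "upper k (k + 1 - j) u = upper k j (1 - u)"
proof -
  have r: "real (k + 1 - j) = real k + 1 - real j" using assms by auto
  have "k + 1 - j = 1 \<longleftrightarrow> j = k" "k + 1 - j = k \<longleftrightarrow> j = 1" using assms by auto
  then show ?thesis using assms by (auto simp: upper_def r min.commute)
qed

text \<open>Concavity in \<open>u\<close>: \<open>upper k j\<close> is affine or a minimum of two
  affine functions.\<close>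

lemma upper_midpoint:
  assumes "3 \<le> k" "j \<in> {1..k}"
  shows "upper k j u + upper k j (1 - u) \<le> 2 * upper k j (1 / 2)"
proof -
  have "min a b + min c d \<le> 2 * min e f" if "a + c = 2 * e" "b + d = 2 * f" for a b c d e f :: real
    using that by (auto simp: min_def)
  note * = this
  have "u / c + (1 - u) / c = 2 * (1 / 2 / c)" "(1 - u) / c + u / c = 2 * (1 / 2 / c)" for c :: real
    by (simp_all add: add_divide_distrib[symmetric])
  then have "min (u / (real j - 1)) ((1 - u) / (real k - real j)) + min ((1 - u) / (real j - 1)) (u / (real k - real j))
    \<le> 2 * min (1 / 2 / (real j - 1)) (1 / 2 / (real k - real j))"
    by (intro *)
  then show ?thesis using assms
    by (auto simp: upper_def add_divide_distrib[symmetric]) (simp_all add: field_simps)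
qed

lemma sum_upper_half:
  assumes "3 \<le> k"
  shows "(\<Sum>j=1..k. upper k j (1 / 2)) = alpha k"
  unfolding alpha_def sum_distrib_left
  by (intro sum.cong refl) (use assms in \<open>auto simp: upper_def min_def field_simps\<close>)

text \<open>The total length is concave, and it is symmetric about 1/2 because reflection exchanges
  the positions \<open>j\<close> and \<open>k + 1 - j\<close>. So it is largest at the midpoint,
  where it equals \<open>alpha k\<close>; this is how \<open>alpha k\<close> enters the critical
  value.\<close>

lemma sum_upper_le:
  assumes "3 \<le> k"
  shows "(\<Sum>j=1..k. upper k j u) \<le> alpha k"
proof -
  have "(\<Sum>j=1..k. upper k j u) = (\<Sum>j=1..k. upper k (k + 1 - j) u)"
    by (rule sum.reindex_bij_witness[of _ "\<lambda>j. k + 1 - j" "\<lambda>j. k + 1 - j"]) auto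
  also have "\<dots> = (\<Sum>j=1..k. upper k j (1 - u))"
    using upper_reflect[OF assms] by (intro sum.cong) auto
  finally have "2 * (\<Sum>j=1..k. upper k j u) = (\<Sum>j=1..k. upper k j u + upper k j (1 - u))"
    by (simp add: sum.distrib)
  also have "\<dots> \<le> (\<Sum>j=1..k. 2 * upper k j (1 / 2))"
    using upper_midpoint[OF assms] by (intro sum_mono) auto
  also have "\<dots> = 2 * alpha k" unfolding sum_upper_half[OF assms, symmetric] sum_distrib_left ..
  finally show ?thesis by simp
qed

lemma alpha_pos:
  assumes "3 \<le> k"
  shows "0 < alpha k"
proof -
  have "0 < upper k 1 (1/2)" using assms by (simp add: upper_def)
  also have "\<dots> \<le> (\<Sum>j=1..k. upper k j (1 / 2))"
    using assms upper_nonneg[OF assms, of "1/2"] by (intro member_le_sum) auto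
  finally show ?thesis using sum_upper_half[OF assms] by simp
qed

text \<open>Equivalently, \<open>R powr \<theta> * (1 + B * exp (- R * \<sigma>))\<close> is increasing in \<open>R\<close> for
  \<open>B = \<theta> * exp (1 + \<theta>)\<close>.\<close>
lemma exp_rescale_le:
  fixes \<theta> \<rho> \<sigma> :: real
  assumes "0 < \<theta>" "0 \<le> \<rho>"
  shows "exp (- \<sigma>) \<le> exp (\<theta> * \<rho>) * exp (- (exp \<rho> * \<sigma>)) + (exp (\<theta> * \<rho>) - 1) / (\<theta> * exp (1 + \<theta>))"
proof -
  let ?B = "\<theta> * exp (1 + \<theta>)"
  let ?f = "\<lambda>v. exp (\<theta> * v) * (1 / ?B + exp (- (exp v * \<sigma>)))"
  have "?f 0 \<le> ?f \<rho>"
  proof (rule DERIV_nonneg_imp_nondecreasing[OF assms(2)])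
    fix v :: real
    define z where "z = exp v * \<sigma>"
    \<comment> \<open>The tangent of the exponential at 0, touched at
      \<open>z = 1 + \<theta>\<close>. There \<open>(z - \<theta>) * exp (- z)\<close> has its
      maximum \<open>exp (- 1 - \<theta>) = \<theta> / ?B\<close>, which determines
      \<open>?B\<close>.\<close>
    have "z - \<theta> \<le> exp (z - \<theta> - 1)" using exp_ge_add_one_self[of "z - \<theta> - 1"] by simp
    then have "(z - \<theta>) * exp (- z) \<le> exp (z - \<theta> - 1) * exp (- z)" by (intro mult_right_mono) auto
    also have "\<dots> = exp (- 1 - \<theta>)" by (simp add: exp_add[symmetric])
    also have "\<dots> = \<theta> / ?B" using assms by (simp add: exp_minus exp_add exp_diff field_simps)
    finally have "0 \<le> \<theta> * (1 / ?B + exp (- z)) - z * exp (- z)" by (simp add: algebra_simps)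
    then have "0 \<le> exp (\<theta> * v) * (\<theta> * (1 / ?B + exp (- z)) - z * exp (- z))" by simp
    moreover have "(?f has_real_derivative exp (\<theta> * v) * (\<theta> * (1 / ?B + exp (- z)) - z * exp (- z))) (at v)"
      unfolding z_def by (auto intro!: derivative_eq_intros simp: algebra_simps)
    ultimately show "\<exists>y. (?f has_real_derivative y) (at v) \<and> 0 \<le> y" by blast
  qed
  then show ?thesis by (simp add: algebra_simps diff_divide_distrib)
qed

lemma prod_eq_exp_amp:
  assumes "finite I" "card I = k - 1" "3 \<le> k" "0 < t" "\<And>i. i \<in> I \<Longrightarrow> 0 < x i"
  shows "prod x I = t ^ (k - 1) * exp (1 - (\<Sum>i\<in>I. amp k t (x i)) / (real k - 1))"
proof -
  have xi: "x i = t * exp (- ((amp k t (x i) - 1) / (real k - 1)))" if "i \<in> I" for i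
  proof -
    have "0 < x i" using assms(5) that .
    then show ?thesis using assms(3,4) by (simp add: amp_def ln_div exp_diff)
  qed
  have m: "real (k - 1) = real k - 1" "real k - 1 > 0" using assms by auto
  have "prod x I = (\<Prod>i\<in>I. t * exp (- ((amp k t (x i) - 1) / (real k - 1))))"
    using xi by (rule prod.cong[OF refl])
  also have "\<dots> = t ^ (k - 1) * exp (\<Sum>i\<in>I. - ((amp k t (x i) - 1) / (real k - 1)))"
    using assms by (simp add: prod.distrib exp_sum)
  also have "(\<Sum>i\<in>I. - ((amp k t (x i) - 1) / (real k - 1))) = - ((\<Sum>i\<in>I. amp k t (x i) - 1) / (real k - 1))"
    by (simp add: sum_negf sum_divide_distrib)
  also have "\<dots> = 1 - (\<Sum>i\<in>I. amp k t (x i)) / (real k - 1)"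
    using assms m by (simp add: sum_subtractf field_simps)
  finally show ?thesis .
qed

section \<open>Contraction below the critical value\<close>

locale subcritical =
  fixes k :: nat and t \<theta> :: real
  assumes k3: "3 \<le> k" and t0: "0 < t" and th: "0 < \<theta>" "\<theta> < 1"
    and sub: "(real k - 1) * t ^ (k - 1) * alpha k \<le> \<theta> * exp \<theta>"
begin

abbreviation kd :: real where
  "kd \<equiv> real k - 1"

text \<open>A purely multiplicative bound with exponent \<open>\<theta> * \<rho>\<close> fails when
  the \<open>amp\<close> values are large. The additive term of \<open>exp_rescale_le\<close> makes
  up for this; integrated over a total length of at most \<open>alpha k\<close> and multiplied by
  \<open>k - 1\<close>, it costs at most \<open>exp (\<theta> * \<rho>) - 1\<close>.\<close>

lemma prod_contract:
  assumes "finite I" "card I = k - 1" "0 \<le> \<rho>"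
    and "\<And>i. i \<in> I \<Longrightarrow> 0 < x i" "\<And>i. i \<in> I \<Longrightarrow> 0 < y i"
    and "\<And>i. i \<in> I \<Longrightarrow> amp k t (x i) \<le> exp \<rho> * amp k t (y i)"
  shows "prod y I \<le> exp (\<theta> * \<rho>) * prod x I + (exp (\<theta> * \<rho>) - 1) * (t ^ (k - 1) / (\<theta> * exp \<theta>))"
proof -
  define sx where "sx = (\<Sum>i\<in>I. amp k t (x i)) / kd"
  define sy where "sy = (\<Sum>i\<in>I. amp k t (y i)) / kd"
  have px: "prod x I = t ^ (k - 1) * exp (1 - sx)" and py: "prod y I = t ^ (k - 1) * exp (1 - sy)"
    unfolding sx_def sy_def by (rule prod_eq_exp_amp[OF assms(1,2) k3 t0]; fact assms)+
  have "sx \<le> exp \<rho> * sy" unfolding sx_def sy_def times_divide_eq_right sum_distrib_left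
    using assms k3 by (intro divide_right_mono sum_mono) auto
  then have "exp (\<theta> * \<rho>) * exp (- (exp \<rho> * sy)) \<le> exp (\<theta> * \<rho>) * exp (- sx)" by simp
  then have "exp (- sy) \<le> exp (\<theta> * \<rho>) * exp (- sx) + (exp (\<theta> * \<rho>) - 1) / (\<theta> * exp (1 + \<theta>))"
    using exp_rescale_le[OF th(1) assms(3), of sy] by linarith
  then have "t ^ (k - 1) * exp 1 * exp (- sy) \<le> t ^ (k - 1) * exp 1 *
    (exp (\<theta> * \<rho>) * exp (- sx) + (exp (\<theta> * \<rho>) - 1) / (\<theta> * exp (1 + \<theta>)))"
    using t0 by (intro mult_left_mono) auto
  also have "\<dots> = exp (\<theta> * \<rho>) * (t ^ (k - 1) * exp (1 - sx)) + (exp (\<theta> * \<rho>) - 1) * (t ^ (k - 1) / (\<theta> * exp \<theta>))"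
    using th by (simp add: exp_diff exp_add exp_minus field_simps)
  also have "t ^ (k - 1) * exp 1 * exp (- sy) = prod y I" unfolding py by (simp add: exp_diff exp_minus field_simps)
  finally show ?thesis unfolding px .
qed

text \<open>Bounds are asked on the whole line to make the integrands integrable for all arguments,
  positivity only on the unit interval, because the functions described in \<open>x_star\<close>
  vanish outside it.\<close>

definition admissible :: "(real \<Rightarrow> real) \<Rightarrow> bool" where
  "admissible x \<longleftrightarrow> x \<in> borel_measurable borel \<and> (\<forall>v. 0 \<le> x v \<and> x v \<le> t) \<and> (\<forall>v\<in>{0..1}. 0 < x v)"

lemma integrable_prod:
  assumes "admissible x"
  shows "set_integrable lborel {0..b} (\<lambda>s. kern k j x u s)"
proof -
  have x: "x \<in> borel_measurable borel" "\<And>v. 0 \<le> x v" "\<And>v. x v \<le> t" using assms by (auto simp: admissible_def)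
  have "set_integrable lborel {0..b} (\<lambda>s. \<Prod>i\<in>{1..k} - {j}. t)"
    by (rule borel_integrable_atLeastAtMost') auto
  then show ?thesis
  proof (rule set_integrable_bound)
    show "set_borel_measurable lborel {0..b} (\<lambda>s. kern k j x u s)"
      unfolding set_borel_measurable_def using x(1) by measurable
    show "AE s in lborel. s \<in> {0..b} \<longrightarrow> norm (kern k j x u s)
        \<le> norm (\<Prod>i\<in>{1..k} - {j}. t)"
    proof (intro AE_I2 impI)
      fix s
      have "kern k j x u s \<le> (\<Prod>i\<in>{1..k} - {j}. t)"
        using x by (intro prod_mono) auto
      moreover have "0 \<le> kern k j x u s"
        using x by (intro prod_nonneg) auto
      ultimately show "norm (kern k j x u s) \<le> norm (\<Prod>i\<in>{1..k} - {j}. t)"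
        by simp
    qed
  qed
qed

text \<open>The summand 1 in \<open>1 + kd * Lam k x u\<close> grows by exactly
  \<open>exp (\<theta> * \<rho>) - 1\<close> under the factor on the right and thereby absorbs the
  additive loss of \<open>prod_contract\<close>. This is the purpose of the constant 1 in
  \<open>amp\<close>.\<close>

lemma Lam_contract:
  assumes xy: "admissible x" "admissible y" and u: "u \<in> {0..1}" and r: "0 \<le> \<rho>"
    and le: "\<And>v. v \<in> {0..1} \<Longrightarrow> amp k t (x v) \<le> exp \<rho> * amp k t (y v)"
  shows "1 + kd * Lam k y u \<le> exp (\<theta> * \<rho>) * (1 + kd * Lam k x u)"
proof -
  let ?P = "\<lambda>x j s. kern k j x u s"
  let ?c = "(exp (\<theta> * \<rho>) - 1) * (t ^ (k - 1) / (\<theta> * exp \<theta>))"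
  have ci: "set_integrable lborel {0..b} (\<lambda>s. ?c)" for b :: real
    by (rule borel_integrable_atLeastAtMost') auto
  have c0: "0 \<le> exp (\<theta> * \<rho>) - 1" using th r by simp
  have "Lam k y u \<le> (\<Sum>j=1..k. exp (\<theta> * \<rho>) * (LBINT s:{0..upper k j u}. ?P x j s) + ?c * upper k j u)"
    unfolding Lam_def
  proof (rule sum_mono)
    fix j assume j: "j \<in> {1..k}"
    let ?U = "upper k j u"
    have xi: "set_integrable lborel {0..?U} (\<lambda>s. exp (\<theta> * \<rho>) * ?P x j s)"
      using integrable_prod[OF xy(1)] by (rule set_integrable_mult_right)
    have "(LBINT s:{0..?U}. ?P y j s) \<le> (LBINT s:{0..?U}. exp (\<theta> * \<rho>) * ?P x j s + ?c)"
    proof (rule set_integral_mono[OF integrable_prod[OF xy(2)] set_integral_add(1)[OF xi ci]])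
      fix s assume s: "s \<in> {0..?U}"
      have "v \<in> {1..k} - {j} \<Longrightarrow> u + (real v - real j) * s \<in> {0..1}" for v
        using upper_args[OF k3 u j _ s] by auto
      then show "?P y j s \<le> exp (\<theta> * \<rho>) * ?P x j s + ?c"
        using j r le xy by (intro prod_contract) (auto simp: admissible_def)
    qed
    also have "\<dots> = exp (\<theta> * \<rho>) * (LBINT s:{0..?U}. ?P x j s) + ?c * ?U"
      using upper_nonneg[OF k3 u j]
      by (subst set_integral_add(2)[OF xi ci]) (simp add: set_lebesgue_integral_def)
    finally show "(LBINT s:{0..?U}. ?P y j s) \<le> exp (\<theta> * \<rho>) * (LBINT s:{0..?U}. ?P x j s) + ?c * ?U" .
  qed
  also have "\<dots> = exp (\<theta> * \<rho>) * Lam k x u + ?c * (\<Sum>j=1..k. upper k j u)"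
    unfolding Lam_def by (simp add: sum.distrib sum_distrib_left)
  also have "\<dots> \<le> exp (\<theta> * \<rho>) * Lam k x u + ?c * alpha k"
    using sum_upper_le[OF k3] c0 t0 th by (intro add_left_mono mult_left_mono) auto
  finally have "kd * Lam k y u \<le> kd * (exp (\<theta> * \<rho>) * Lam k x u + ?c * alpha k)"
    using k3 by (intro mult_left_mono) auto
  also have "\<dots> = exp (\<theta> * \<rho>) * (kd * Lam k x u) +
      (exp (\<theta> * \<rho>) - 1) * ((kd * t ^ (k - 1) * alpha k) / (\<theta> * exp \<theta>))"
    by (simp add: algebra_simps)
  also have "\<dots> \<le> exp (\<theta> * \<rho>) * (kd * Lam k x u) + (exp (\<theta> * \<rho>) - 1) * 1"
    using sub c0 th by (intro add_left_mono mult_left_mono) auto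
  finally show ?thesis by (simp add: algebra_simps)
qed

lemma Lam_bounds:
  assumes x: "admissible x" and u: "u \<in> {0..1}"
  shows "0 \<le> Lam k x u" "Lam k x u \<le> t ^ (k - 1) * alpha k"
proof -
  let ?P = "\<lambda>j s. kern k j x u s"
  have P: "0 \<le> ?P j s" for j s using x by (intro prod_nonneg) (auto simp: admissible_def)
  show "0 \<le> Lam k x u"
    unfolding Lam_def set_lebesgue_integral_def
    using P by (intro sum_nonneg Bochner_Integration.integral_nonneg) (simp add: indicator_def)
  have "Lam k x u \<le> (\<Sum>j=1..k. t ^ (k - 1) * upper k j u)"
    unfolding Lam_def
  proof (rule sum_mono)
    fix j assume j: "j \<in> {1..k}"
    have ci: "set_integrable lborel {0..upper k j u} (\<lambda>s. t ^ (k - 1))"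
      by (rule borel_integrable_atLeastAtMost') auto
    have "(LBINT s:{0..upper k j u}. ?P j s) \<le> (LBINT s:{0..upper k j u}. t ^ (k - 1))"
    proof (rule set_integral_mono[OF integrable_prod[OF x] ci])
      fix s
      have "?P j s \<le> (\<Prod>i\<in>{1..k} - {j}. t)" using x by (intro prod_mono) (auto simp: admissible_def)
      then show "?P j s \<le> t ^ (k - 1)" using j by simp
    qed
    also have "\<dots> = t ^ (k - 1) * upper k j u"
      using upper_nonneg[OF k3 u j] by (simp add: set_lebesgue_integral_def)
    finally show "(LBINT s:{0..upper k j u}. ?P j s) \<le> t ^ (k - 1) * upper k j u" .
  qed
  also have "\<dots> \<le> t ^ (k - 1) * alpha k"
    using sum_upper_le[OF k3] t0 by (simp add: sum_distrib_left[symmetric])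
  finally show "Lam k x u \<le> t ^ (k - 1) * alpha k" .
qed

lemma ln_div_exp: "ln (t / (t * exp (- z))) = z"
  using t0 by (simp add: ln_div ln_mult)

lemma amp_Phi: "amp k t (Phi k t x u) = 1 + kd * Lam k x u"
  unfolding amp_def Phi_eq ln_div_exp ..

lemma Phi_bounds:
  assumes "admissible x" "u \<in> {0..1}"
  shows "0 < Phi k t x u" "Phi k t x u \<le> t"
  using Lam_bounds(1)[OF assms] t0 by (auto simp: Phi_eq)

lemma Phi_contract:
  assumes "admissible x" "admissible y" "u \<in> {0..1}" "0 \<le> \<rho>"
    and "\<And>v. v \<in> {0..1} \<Longrightarrow> amp k t (x v) \<le> exp \<rho> * amp k t (y v)"
  shows "amp k t (Phi k t y u) \<le> exp (\<theta> * \<rho>) * amp k t (Phi k t x u)"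
  unfolding amp_Phi by (rule Lam_contract[OF assms])

lemma Phi_cong:
  assumes "\<And>v. v \<in> {0..1} \<Longrightarrow> x v = y v" "u \<in> {0..1}"
  shows "Phi k t x u = Phi k t y u"
proof -
  have "(LBINT s:{0..upper k j u}. kern k j x u s) =
      (LBINT s:{0..upper k j u}. kern k j y u s)" if j: "j \<in> {1..k}" for j
  proof (rule set_lebesgue_integral_cong)
    show "\<forall>s. s \<in> {0..upper k j u} \<longrightarrow> kern k j x u s =
      kern k j y u s"
      using upper_args[OF k3 assms(2) j] assms(1) by (intro allI impI prod.cong refl) blast
  qed simp
  then have "Lam k x u = Lam k y u" unfolding Lam_def by (rule sum.cong[OF refl])
  then show ?thesis by (simp add: Phi_eq)
qed

definition ampmax :: real where
  "ampmax = 1 + kd * (t ^ (k - 1) * alpha k)"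

lemma ampmax_ge: "1 \<le> ampmax"
  unfolding ampmax_def using k3 t0 alpha_pos[OF k3] by simp

lemma amp_Phi_bounds:
  assumes "admissible x" "u \<in> {0..1}"
  shows "1 \<le> amp k t (Phi k t x u)" "amp k t (Phi k t x u) \<le> ampmax"
proof -
  show "1 \<le> amp k t (Phi k t x u)" using Lam_bounds(1)[OF assms] k3 unfolding amp_Phi by simp
  show "amp k t (Phi k t x u) \<le> ampmax" unfolding amp_Phi ampmax_def
    using Lam_bounds(2)[OF assms] k3 by (intro add_left_mono mult_left_mono) auto
qed

lemma amp_inject:
  assumes "0 < a" "0 < b" "amp k t a = amp k t b"
  shows "a = b"
proof -
  have "ln (t / a) = ln (t / b)" using assms k3 by (simp add: amp_def)
  then show ?thesis using assms t0 by (simp add: ln_div)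
qed

text \<open>Any two fixed points are comparable up to the factor \<open>ampmax\<close>, and each
  application of \<open>Phi_contract\<close> improves the exponent by \<theta>. As
  \<open>Phi\<close> reverses the comparison, the two functions change roles at every step, so the
  induction treats all pairs at once.\<close>

lemma fixed_point_unique:
  assumes "admissible x" "admissible y"
    and x: "\<And>u. u \<in> {0..1} \<Longrightarrow> x u = Phi k t x u" and y: "\<And>u. u \<in> {0..1} \<Longrightarrow> y u = Phi k t y u"
    and u: "u \<in> {0..1}"
  shows "x u = y u"
proof -
  have *: "amp k t (y v) \<le> exp (\<theta> ^ r * ln ampmax) * amp k t (x v)" if "v \<in> {0..1}"
    "admissible x" "admissible y" "\<And>u. u \<in> {0..1} \<Longrightarrow> x u = Phi k t x u"
    "\<And>u. u \<in> {0..1} \<Longrightarrow> y u = Phi k t y u" for v r x y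
    using that
  proof (induction r arbitrary: v x y)
    case 0
    have "amp k t (y v) \<le> ampmax * 1" using 0 amp_Phi_bounds(2) by simp
    also have "\<dots> \<le> ampmax * amp k t (x v)"
      using 0 amp_Phi_bounds(1)[of x v] ampmax_ge by (intro mult_left_mono) auto
    finally show ?case using ampmax_ge by simp
  next
    case (Suc r)
    have "amp k t (Phi k t y v) \<le> exp (\<theta> * (\<theta> ^ r * ln ampmax)) * amp k t (Phi k t x v)"
      by (rule Phi_contract) (use Suc th ampmax_ge in auto)
    then show ?case using Suc.prems by (simp add: mult.assoc)
  qed
  have lim: "(\<lambda>r. exp (\<theta> ^ r * ln ampmax) * c) \<longlonglongrightarrow> c" for c
  proof -
    have "(\<lambda>r. exp (\<theta> ^ r * ln ampmax) * c) \<longlonglongrightarrow> exp (0 * ln ampmax) * c"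
      using th by (intro tendsto_intros LIMSEQ_power_zero) auto
    then show ?thesis by simp
  qed
  have "amp k t (y u) \<le> amp k t (x u)"
    by (rule LIMSEQ_le_const[OF lim]) (use *[OF u assms(1,2) x y] in blast)
  moreover have "amp k t (x u) \<le> amp k t (y u)"
    by (rule LIMSEQ_le_const[OF lim]) (use *[OF u assms(2,1) y x] in blast)
  ultimately show ?thesis
    using amp_inject assms u by (auto simp: admissible_def)
qed

section \<open>Existence and continuity of the fixed point\<close>

definition clamp1 :: "real \<Rightarrow> real" where
  "clamp1 v = max 0 (min 1 v)"

lemma clamp1 [simp]: "clamp1 v \<in> {0..1}" "0 \<le> clamp1 v" "clamp1 v \<le> 1" "0 \<le> u \<Longrightarrow> u \<le> 1 \<Longrightarrow> clamp1 u = u"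
  by (auto simp: clamp1_def)

lemma continuous_clamp1: "continuous_on A clamp1"
  unfolding clamp1_def by (intro continuous_intros)

lemma continuous_upper: "j \<in> {1..k} \<Longrightarrow> continuous_on A (upper k j)"
  unfolding upper_def using k3
  by (cases "j = 1"; cases "j = k") (auto intro!: continuous_intros)

text \<open>Moves the dependence on \<open>u\<close> from the range of integration into the
  integrand, as the continuity of parametrised integrals is used over a fixed range.\<close>

lemma LBINT_scale:
  fixes f :: "real \<Rightarrow> real"
  assumes "0 \<le> U"
  shows "(LBINT s:{0..U}. f s) = U * (LBINT s:{0..1}. f (U * s))"
proof (cases "U = 0")
  case True
  have "(LBINT s:{0}. f s) = 0" unfolding set_lebesgue_integral_def
    by (rule integral_eq_zero_AE) (use AE_lborel_singleton[of 0] in eventually_elim, simp)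
  then show ?thesis using True by simp
next
  case False
  have "indicator {0..U} (U * s) = (indicator {0..1} s :: real)" for s
    using assms False by (auto simp: indicator_def mult_le_cancel_left1 zero_le_mult_iff)
  then show ?thesis
    unfolding set_lebesgue_integral_def
    using assms False by (subst lborel_integral_real_affine[where c = U and t = 0]) auto
qed

text \<open>Composition with \<open>clamp1\<close> freezes the function beyond the ends of the unit
  interval, so that the iteration and its uniform limit can live on the whole line.\<close>

lemma continuous_Lam:
  assumes x: "continuous_on UNIV x"
  shows "continuous_on UNIV (\<lambda>v. Lam k x (clamp1 v))"
proof -
  let ?g = "\<lambda>j v s. \<Prod>i\<in>{1..k} - {j}. x (clamp1 v + (real i - real j) * (upper k j (clamp1 v) * s))"
  have cu: "continuous_on A (\<lambda>v. upper k j (clamp1 v))" if "j \<in> {1..k}" for j A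
    by (rule continuous_on_compose2[OF continuous_upper[OF that, of UNIV] continuous_clamp1]) auto
  have cg: "continuous_on A (\<lambda>z. ?g j (fst z) (snd z))" if j: "j \<in> {1..k}" for j A
  proof -
    have c1: "continuous_on A (\<lambda>z::real \<times> real. clamp1 (fst z))"
      by (rule continuous_on_compose2[OF continuous_clamp1[of UNIV]]) (auto intro: continuous_intros)
    have c2: "continuous_on A (\<lambda>z::real \<times> real. upper k j (clamp1 (fst z)))"
      by (rule continuous_on_compose2[OF cu[OF j, of UNIV]]) (auto intro: continuous_intros)
    show ?thesis
      by (intro continuous_on_prod continuous_on_compose2[OF x]) (auto intro!: continuous_intros c1 c2)
  qed
  have "(LBINT s:{0..upper k j (clamp1 v)}. \<Prod>i\<in>{1..k} - {j}. x (clamp1 v + (real i - real j) * s))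
      = upper k j (clamp1 v) * integral (cbox 0 1) (?g j v)" if j: "j \<in> {1..k}" for j v
  proof -
    have "continuous_on {0..1} (?g j v)"
    proof -
      have "continuous_on {0..1} (\<lambda>s::real. (v, s))" by (intro continuous_intros)
      from continuous_on_compose2[OF cg[OF j, of UNIV] this] show ?thesis by simp
    qed
    then have "set_integrable lborel {0..1} (?g j v)" by (rule borel_integrable_atLeastAtMost')
    then have "(LBINT s:{0..1}. ?g j v s) = integral {0..1} (?g j v)" by (rule set_borel_integral_eq_integral(2))
    then show ?thesis
      by (subst LBINT_scale[OF upper_nonneg[OF k3 clamp1(1) j]]) simp
  qed
  then have "Lam k x (clamp1 v) = (\<Sum>j=1..k. upper k j (clamp1 v) * integral (cbox 0 1) (?g j v))" for v
    unfolding Lam_def by (intro sum.cong refl) blast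
  moreover have "continuous_on UNIV (\<lambda>v. \<Sum>j=1..k. upper k j (clamp1 v) * integral (cbox 0 1) (?g j v))"
    by (intro continuous_on_sum continuous_on_mult cu integral_continuous_on_param)
      (use cg in \<open>auto simp: case_prod_unfold\<close>)
  ultimately show ?thesis by simp
qed

primrec iter :: "nat \<Rightarrow> real \<Rightarrow> real" where
  "iter 0 = (\<lambda>v. t)"
| "iter (Suc r) = (\<lambda>v. Phi k t (iter r) (clamp1 v))"

lemma iter_cont_adm: "continuous_on UNIV (iter r) \<and> admissible (iter r)"
proof (induction r)
  case 0
  then show ?case using t0 by (auto simp: admissible_def)
next
  case (Suc r)
  then have c: "continuous_on UNIV (iter (Suc r))"
    unfolding iter.simps Phi_eq by (intro continuous_intros continuous_Lam) auto
  then have "iter (Suc r) \<in> borel_measurable borel" by (rule borel_measurable_continuous_onI)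
  moreover have "0 < iter (Suc r) v \<and> iter (Suc r) v \<le> t" for v
    using Phi_bounds[OF conjunct2[OF Suc.IH] clamp1(1)] by simp
  ultimately show ?case using c by (auto simp: admissible_def less_imp_le simp del: iter.simps)
qed

lemma iter_adm: "admissible (iter r)" and iter_cont: "continuous_on A (iter r)"
  using iter_cont_adm continuous_on_subset by blast+

lemma iter_pos: "0 < iter r v"
proof (cases r)
  case 0
  then show ?thesis using t0 by simp
next
  case (Suc n)
  then show ?thesis using Phi_bounds(1)[OF iter_adm clamp1(1)] by simp
qed

lemma iter_amp_bounds: "1 \<le> amp k t (iter r v)" "amp k t (iter r v) \<le> ampmax"
proof -
  have "amp k t t = 1" using t0 by (simp add: amp_def)
  then show "1 \<le> amp k t (iter r v)" "amp k t (iter r v) \<le> ampmax"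
    using amp_Phi_bounds[OF iter_adm clamp1(1)] ampmax_ge by (cases r; simp)+
qed

lemma iter_close:
  "amp k t (iter (Suc r) v) \<le> exp (\<theta> ^ r * ln ampmax) * amp k t (iter r v) \<and>
   amp k t (iter r v) \<le> exp (\<theta> ^ r * ln ampmax) * amp k t (iter (Suc r) v)"
proof (induction r arbitrary: v)
  case 0
  have "amp k t (iter a v) \<le> ampmax * amp k t (iter b v)" for a b
    using mult_mono[OF iter_amp_bounds(2)[of a v] iter_amp_bounds(1)[of b v]] ampmax_ge by simp
  then show ?case using ampmax_ge by (simp del: iter.simps)
next
  case (Suc r)
  have 1: "amp k t (Phi k t (iter (Suc r)) (clamp1 v)) \<le> exp (\<theta> * (\<theta> ^ r * ln ampmax)) * amp k t (Phi k t (iter r) (clamp1 v))"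
    by (rule Phi_contract[OF iter_adm iter_adm clamp1(1)]) (use Suc.IH th ampmax_ge in \<open>auto simp del: iter.simps\<close>)
  have 2: "amp k t (Phi k t (iter r) (clamp1 v)) \<le> exp (\<theta> * (\<theta> ^ r * ln ampmax)) * amp k t (Phi k t (iter (Suc r)) (clamp1 v))"
    by (rule Phi_contract[OF iter_adm iter_adm clamp1(1)]) (use Suc.IH th ampmax_ge in \<open>auto simp del: iter.simps\<close>)
  show ?case using 1 2 by (simp add: mult.assoc)
qed

definition lamp :: "nat \<Rightarrow> real \<Rightarrow> real" where
  "lamp r v = ln (amp k t (iter r v))"

lemma lamp_ge: "0 \<le> lamp r v"
  unfolding lamp_def using iter_amp_bounds(1) by simp

lemma exp_lamp: "exp (lamp r v) = amp k t (iter r v)"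
  unfolding lamp_def using iter_amp_bounds(1)[of r v] by simp

lemma ln_ratio_le: "0 < a \<Longrightarrow> 0 < b \<Longrightarrow> a \<le> exp c * b \<Longrightarrow> ln a - ln b \<le> c" for a b c :: real
proof -
  assume "0 < a" "0 < b" "a \<le> exp c * b"
  then have "ln a \<le> ln (exp c * b)" by simp
  also have "\<dots> = c + ln b" using \<open>0 < b\<close> by (simp add: ln_mult)
  finally show ?thesis by simp
qed

lemma lamp_close: "\<bar>lamp (Suc r) v - lamp r v\<bar> \<le> \<theta> ^ r * ln ampmax"
proof -
  have p: "0 < amp k t (iter r v)" for r using iter_amp_bounds(1)[of r v] by simp
  show ?thesis unfolding lamp_def
    using ln_ratio_le[OF p p conjunct1[OF iter_close]] ln_ratio_le[OF p p conjunct2[OF iter_close]]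
    by (simp add: abs_le_iff)
qed

text \<open>In the coordinate \<open>lamp\<close> consecutive iterates differ by at most a geometric
  sequence. The telescoping series starts at 0 because the constant \<open>t\<close> has
  \<open>amp\<close> equal to 1.\<close>

lemma lamp_uniform_limit: "\<exists>l. uniform_limit UNIV lamp l sequentially"
proof -
  have "uniform_limit UNIV (\<lambda>n v. \<Sum>i<n. lamp (Suc i) v - lamp i v) (\<lambda>v. \<Sum>i. lamp (Suc i) v - lamp i v) sequentially"
  proof (rule Weierstrass_m_test)
    show "norm (lamp (Suc r) v - lamp r v) \<le> \<theta> ^ r * ln ampmax" for r v
      using lamp_close by simp
    show "summable (\<lambda>r. \<theta> ^ r * ln ampmax)" using th by (intro summable_mult2 summable_geometric) auto
  qed
  moreover have "(\<Sum>i<n. lamp (Suc i) v - lamp i v) = lamp n v" for n v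
  proof -
    have "lamp 0 v = 0" using t0 by (simp add: lamp_def amp_def)
    then show ?thesis using sum_lessThan_telescope[of "\<lambda>i. lamp i v" n] by simp
  qed
  ultimately show ?thesis by auto
qed

lemma amp_of_exp:
  "amp k t (t * exp (- ((exp g - 1) / kd))) = exp g"
  unfolding amp_def ln_div_exp using k3 by simp

lemma continuous_fixed_point:
  "\<exists>X. continuous_on UNIV X \<and> (\<forall>v. 0 < X v \<and> X v \<le> t) \<and> (\<forall>u\<in>{0..1}. X u = Phi k t X u)"
proof -
  obtain l where l: "uniform_limit UNIV lamp l sequentially" using lamp_uniform_limit by blast
  \<comment> \<open>The limit is taken in the coordinate \<open>lamp\<close> and then inverted; the
    result is automatically positive, and it is at most \<open>t\<close> because \<open>l\<close> is
    nonnegative.\<close>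
  define X where "X v = t * exp (- ((exp (l v) - 1) / kd))" for v
  have lp: "(\<lambda>r. lamp r v) \<longlonglongrightarrow> l v" for v using l by (rule tendsto_uniform_limitI) simp
  have l0: "0 \<le> l v" for v by (rule LIMSEQ_le_const[OF lp]) (use lamp_ge in blast)
  have aX: "amp k t (X v) = exp (l v)" for v unfolding X_def by (rule amp_of_exp)
  have "continuous_on UNIV (lamp r)" for r
  proof -
    have nz: "amp k t (iter r v) \<noteq> 0" "iter r v \<noteq> 0" for v
      using iter_amp_bounds(1)[of r v] iter_pos[of r v] by auto
    have "continuous_on UNIV (\<lambda>v. amp k t (iter r v))"
      unfolding amp_def using nz(2) t0 by (intro continuous_intros iter_cont) auto
    then show ?thesis unfolding lamp_def using nz(1) by (intro continuous_on_ln) auto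
  qed
  then have "continuous_on UNIV l" by (intro uniform_limit_theorem[OF _ l]) auto
  then have cX: "continuous_on UNIV X" unfolding X_def using k3 by (intro continuous_intros) auto
  have X0: "0 < X v" "X v \<le> t" for v using t0 l0[of v] k3 by (auto simp: X_def)
  have adm: "admissible X"
    using X0 borel_measurable_continuous_onI[OF cX] by (auto simp: admissible_def less_imp_le)
  have "X u = Phi k t X u" if u: "u \<in> {0..1}" for u
  proof -
    let ?q = "ln (amp k t (Phi k t X u))"
    have pq: "1 \<le> amp k t (Phi k t X u)" by (rule amp_Phi_bounds(1)[OF adm u])
    have "(\<lambda>r. lamp (Suc r) u) \<longlonglongrightarrow> ?q"
    proof (rule LIMSEQ_I)
      fix e :: real assume e: "0 < e"
      have "\<forall>\<^sub>F r in sequentially. \<forall>v\<in>UNIV. dist (lamp r v) (l v) < e"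
        using uniform_limitD[OF l e] .
      then obtain N where N: "\<And>r v. r \<ge> N \<Longrightarrow> \<bar>lamp r v - l v\<bar> < e"
        unfolding eventually_sequentially by (auto simp: dist_real_def)
      show "\<exists>no. \<forall>r\<ge>no. norm (lamp (Suc r) u - ?q) < e"
      proof (intro exI allI impI)
        fix r assume r: "N \<le> r"
        have 1: "amp k t (iter r v) \<le> exp e * amp k t (X v)" for v
          unfolding aX exp_lamp[symmetric] exp_add[symmetric] using N[OF r, of v] by simp
        have 2: "amp k t (X v) \<le> exp e * amp k t (iter r v)" for v
          unfolding aX exp_lamp[symmetric] exp_add[symmetric] using N[OF r, of v] by simp
        have p: "0 < amp k t (Phi k t (iter r) u)" using amp_Phi_bounds(1)[OF iter_adm u, of r] by simp
        have p': "0 < amp k t (Phi k t X u)" using pq by simp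
        have te: "\<theta> * e < e" using th e by simp
        have "ln (amp k t (Phi k t X u)) - ln (amp k t (Phi k t (iter r) u)) \<le> \<theta> * e"
          by (rule ln_ratio_le[OF p' p]) (rule Phi_contract[OF iter_adm adm u], use e 1 in auto)
        moreover have "ln (amp k t (Phi k t (iter r) u)) - ln (amp k t (Phi k t X u)) \<le> \<theta> * e"
          by (rule ln_ratio_le[OF p p']) (rule Phi_contract[OF adm iter_adm u], use e 2 in auto)
        moreover have "lamp (Suc r) u = ln (amp k t (Phi k t (iter r) u))" using u by (simp add: lamp_def)
        ultimately show "norm (lamp (Suc r) u - ?q) < e" using te by (simp add: abs_less_iff)
      qed
    qed
    then have "l u = ?q" using LIMSEQ_unique LIMSEQ_Suc[OF lp] by blast
    then have "amp k t (X u) = amp k t (Phi k t X u)" using pq by (simp add: aX)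
    then show ?thesis using amp_inject X0 Phi_bounds(1)[OF adm u] by blast
  qed
  then show ?thesis using cX X0 by blast
qed

text \<open>\<open>x_star\<close> describes a function that is 0 outside the unit interval and
  positive inside, hence discontinuous on the line. \<open>X\<close> extends its restriction
  continuously and positively, and the later estimates are about \<open>X\<close>.\<close>

lemma x_star_ext:
  "\<exists>X. continuous_on UNIV X \<and> (\<forall>v. 0 < X v \<and> X v \<le> t) \<and> (\<forall>u\<in>{0..1}. x_star k t u = X u) \<and>
     (\<forall>u\<in>{0..1}. ln (t / X u) = Lam k X u)"
proof -
  obtain X where X: "continuous_on UNIV X" "\<And>v. 0 < X v" "\<And>v. X v \<le> t" "\<And>u. u \<in> {0..1} \<Longrightarrow> X u = Phi k t X u"
    using continuous_fixed_point by blast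
  define xs where "xs u = (if u \<in> {0..1} then X u else 0)" for u
  let ?P = "\<lambda>x. x \<in> borel_measurable lborel \<and> (\<forall>u. u \<notin> {0..1} \<longrightarrow> x u = 0) \<and>
       (\<forall>u\<in>{0..1}. 0 \<le> x u \<and> x u \<le> t) \<and> (\<forall>u\<in>{0..1}. x u = Phi k t x u)"
  have mX: "X \<in> borel_measurable borel" using X(1) by (rule borel_measurable_continuous_onI)
  have "xs \<in> borel_measurable lborel" unfolding xs_def using mX by measurable
  moreover have "xs u = Phi k t xs u" if "u \<in> {0..1}" for u
    using X(4)[OF that] that Phi_cong[of xs X u] by (simp add: xs_def)
  moreover have "0 \<le> xs u \<and> xs u \<le> t" for u using X(2,3)[of u] t0 by (simp add: xs_def less_imp_le)
  moreover have "xs u = 0" if "u \<notin> {0..1}" for u using that by (auto simp: xs_def)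
  ultimately have Pxs: "?P xs" by blast
  \<comment> \<open>Positivity is not part of the description; it follows from the fixed-point
    equation because \<open>Phi\<close> is \<open>t\<close> times an exponential.\<close>
  have adm: "admissible x" if P: "?P x" for x
  proof -
    have "0 < x u" if "u \<in> {0..1}" for u
    proof -
      have "x u = Phi k t x u" using P that by blast
      moreover have "0 < Phi k t x u" using t0 by (simp add: Phi_eq)
      ultimately show ?thesis by linarith
    qed
    moreover have "0 \<le> x v \<and> x v \<le> t" for v
    proof (cases "v \<in> {0..1}")
      case True
      then show ?thesis using P by blast
    next
      case False
      then have "x v = 0" using P by blast
      then show ?thesis using t0 by simp
    qed
    moreover have "x \<in> borel_measurable borel" using P by simp
    ultimately show ?thesis unfolding admissible_def by blast
  qed
  have "x_star k t = xs"
    unfolding x_star_def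
  proof (rule the_equality)
    show "?P xs" by (rule Pxs)
    fix x assume P: "?P x"
    show "x = xs"
    proof
      fix u
      show "x u = xs u"
      proof (cases "u \<in> {0..1}")
        case True
        show ?thesis by (rule fixed_point_unique[OF adm[OF P] adm[OF Pxs] _ _ True]) (use P Pxs in blast)+
      next
        case False
        then have "x u = 0" "xs u = 0" using P Pxs by blast+
        then show ?thesis by simp
      qed
    qed
  qed
  moreover have "ln (t / X u) = Lam k X u" if "u \<in> {0..1}" for u
    by (subst X(4)[OF that]) (simp only: Phi_eq ln_div_exp)
  ultimately show ?thesis using X(1-3) by (intro exI[of _ X]) (simp add: xs_def)
qed

end

text \<open>\<open>t < crit k\<close> means \<open>(k - 1) * t ^ (k - 1) * alpha k < exp 1\<close>,
  and \<open>\<theta> * exp \<theta>\<close> tends to \<open>exp 1\<close> as \<theta> approaches 1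
  from below.\<close>

lemma subcritical_theta:
  assumes "3 \<le> k" "0 < t" "t < crit k"
  shows "\<exists>\<theta>. subcritical k t \<theta>"
proof -
  have m: "0 < real k - 1" "real (k - 1) = real k - 1" using assms by auto
  have a: "0 < alpha k" using alpha_pos assms by simp
  have "t ^ (k - 1) = t powr (real k - 1)" using assms m powr_realpow[of t "k - 1"] by simp
  also have "\<dots> < crit k powr (real k - 1)" using assms m by (intro powr_less_mono2) auto
  also have "\<dots> = exp 1 / ((real k - 1) * alpha k)" using m a by (simp add: crit_def powr_powr)
  finally have lt: "(real k - 1) * t ^ (k - 1) * alpha k < exp 1"
    using m a by (simp add: field_simps)
  have "((\<lambda>\<theta>. \<theta> * exp \<theta>) \<longlongrightarrow> 1 * exp (1::real)) (at_left 1)"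
    by (intro tendsto_intros)
  then have "eventually (\<lambda>\<theta>. (real k - 1) * t ^ (k - 1) * alpha k < \<theta> * exp \<theta>) (at_left 1)"
    using lt by (simp add: order_tendstoD(1))
  moreover have "eventually (\<lambda>\<theta>::real. \<theta> \<in> {0<..<1}) (at_left 1)"
    by (rule eventually_at_left_real) simp
  ultimately have "eventually (\<lambda>\<theta>. (real k - 1) * t ^ (k - 1) * alpha k < \<theta> * exp \<theta> \<and> \<theta> \<in> {0<..<1}) (at_left 1)"
    by (rule eventually_conj)
  then obtain \<theta> where "(real k - 1) * t ^ (k - 1) * alpha k < \<theta> * exp \<theta>" "\<theta> \<in> {0<..<1}"
    using eventually_happens trivial_limit_at_left_real by fastforce
  then have "subcritical k t \<theta>" using assms by unfold_locales auto
  then show ?thesis ..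
qed

section \<open>Arithmetic progressions\<close>

definition AP :: "nat \<Rightarrow> nat \<Rightarrow> nat set set" where
  "AP k n = {A. is_kAP k A \<and> A \<subseteq> {1..n}}"

abbreviation AP_star :: "nat \<Rightarrow> nat \<Rightarrow> nat \<Rightarrow> nat set set" where
  "AP_star k n w \<equiv> {e\<in>AP k n. w \<in> e}"

abbreviation lprod :: "nat \<Rightarrow> nat \<Rightarrow> (real \<Rightarrow> real) \<Rightarrow> nat set \<Rightarrow> real" where
  "lprod n w X e \<equiv> \<Prod>v\<in>e - {w}. X (real v / real n)"

lemma is_kAP_image: "is_kAP k A \<longleftrightarrow> (\<exists>a b. 1 \<le> b \<and> A = (\<lambda>i. a + i * b) ` {..<k})"
proof -
  have "{a + i * b | i. i < k} = (\<lambda>i. a + i * b) ` {..<k}" for a b :: nat by auto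
  then show ?thesis unfolding is_kAP_def by simp
qed

lemma AP_card:
  assumes "e \<in> AP k n"
  shows "card e = k"
proof -
  obtain a b where ab: "1 \<le> b" "e = (\<lambda>i. a + i * b) ` {..<k}"
    using assms by (auto simp: AP_def is_kAP_image)
  have "inj_on (\<lambda>i. a + i * b) {..<k}" using ab(1) by (auto simp: inj_on_def)
  then show ?thesis using ab(2) by (simp add: card_image)
qed

lemma finite_AP: "finite (AP k n)"
  by (rule finite_subset[of _ "Pow {1..n}"]) (auto simp: AP_def)

section \<open>Bounded codegree of progressions\<close>

lemma card_le_of_cover:
  assumes "finite T" "\<And>e. e \<in> E \<Longrightarrow> \<exists>x\<in>T. R x e"
    and "\<And>x e e'. x \<in> T \<Longrightarrow> e \<in> E \<Longrightarrow> e' \<in> E \<Longrightarrow> R x e \<Longrightarrow> R x e' \<Longrightarrow> e = e'"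
  shows "card E \<le> card T"
proof -
  obtain g where g: "\<And>e. e \<in> E \<Longrightarrow> g e \<in> T \<and> R (g e) e" using assms(2) by metis
  have "inj_on g E" by (rule inj_onI) (metis g assms(3))
  then show ?thesis using g assms(1) by (intro card_inj_on_le[of g]) auto
qed

text \<open>The positions of two distinct points determine a progression, which gives
  \<open>k ^ 2\<close>. The weaker \<open>k ^ 6\<close> is the constant of \<open>AP_links\<close>,
  so one value serves both assumptions of the hypergraph locale.\<close>

lemma AP_codegree:
  assumes "v \<noteq> w" "3 \<le> k"
  shows "card {e\<in>AP k n. v \<in> e \<and> w \<in> e} \<le> k ^ 6"
proof -
  define R where "R x e \<longleftrightarrow> (\<exists>a b. e = (\<lambda>i. a + i * b) ` {..<k} \<and> v = a + fst x * b \<and> w = a + snd x * b)"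
    for x :: "nat \<times> nat" and e
  have "card {e\<in>AP k n. v \<in> e \<and> w \<in> e} \<le> card ({..<k} \<times> {..<k})"
  proof (rule card_le_of_cover)
    show "\<exists>x\<in>{..<k} \<times> {..<k}. R x e" if e: "e \<in> {e\<in>AP k n. v \<in> e \<and> w \<in> e}" for e
    proof -
      obtain a b where ab: "e = (\<lambda>i. a + i * b) ` {..<k}" using e unfolding AP_def is_kAP_image by blast
      then obtain i j where "i < k" "j < k" "v = a + i * b" "w = a + j * b" using e by auto
      then show ?thesis using ab by (intro bexI[of _ "(i, j)"]) (auto simp: R_def)
    qed
    show "e = e'" if R: "R x e" "R x e'" for x e e'
    proof -
      obtain a b where 1: "e = (\<lambda>i. a + i * b) ` {..<k}" "v = a + fst x * b" "w = a + snd x * b"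
        using R(1) unfolding R_def by blast
      obtain a' b' where 2: "e' = (\<lambda>i. a' + i * b') ` {..<k}" "v = a' + fst x * b'" "w = a' + snd x * b'"
        using R(2) unfolding R_def by blast
      have "(int (fst x) - int (snd x)) * int b = int v - int w" unfolding 1(2,3) by (simp add: algebra_simps)
      moreover have "(int (fst x) - int (snd x)) * int b' = int v - int w" unfolding 2(2,3) by (simp add: algebra_simps)
      moreover have "int (fst x) - int (snd x) \<noteq> 0" using assms(1) 1(2,3) by auto
      ultimately have "b = b'" by (metis mult_left_cancel of_nat_eq_iff)
      then show ?thesis using 1 2 by simp
    qed
  qed auto
  also have "\<dots> = k ^ 2" by (simp add: power2_eq_square)
  also have "\<dots> \<le> k ^ 6" using assms by (intro power_increasing) auto
  finally show ?thesis .
qed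

text \<open>Two progressions through distinct points \<open>v\<close> and \<open>w\<close> that share two further points are
  determined by the positions of these points: the positions give a linear equation for the
  common difference whose right-hand side does not vanish.\<close>
lemma AP_links:
  assumes "v \<noteq> w" "3 \<le> k"
  shows "card {e\<in>AP k n. w \<in> e \<and> v \<notin> e \<and> insert v (e - {w}) \<in> AP k n} \<le> k ^ 6"
proof -
  define R where "R = (\<lambda>(i, j1, j2, i', j1', j2') e. \<exists>a b a' b'. e = (\<lambda>i. a + i * b) ` {..<k} \<and>
    w = a + i * b \<and> v = a' + i' * b' \<and> a + j1 * b = a' + j1' * b' \<and> a + j2 * b = a' + j2' * b' \<and>
    a + j1 * b \<noteq> a + j2 * b)"
  let ?T = "{..<k} \<times> {..<k} \<times> {..<k} \<times> {..<k} \<times> {..<k} \<times> {..<k}"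
  have "card {e\<in>AP k n. w \<in> e \<and> v \<notin> e \<and> insert v (e - {w}) \<in> AP k n} \<le> card ?T"
  proof (rule card_le_of_cover)
    show "\<exists>x\<in>?T. R x e" if "e \<in> {e\<in>AP k n. w \<in> e \<and> v \<notin> e \<and> insert v (e - {w}) \<in> AP k n}" for e
    proof -
      have e: "e \<in> AP k n" "w \<in> e" "insert v (e - {w}) \<in> AP k n" using that by auto
      obtain a b where ab: "e = (\<lambda>i. a + i * b) ` {..<k}" using e(1) unfolding AP_def is_kAP_image by blast
      obtain a' b' where ab': "insert v (e - {w}) = (\<lambda>i. a' + i * b') ` {..<k}"
        using e(3) unfolding AP_def is_kAP_image by blast
      have "finite e" using ab by simp
      then have "card (e - {w}) = k - 1" using AP_card[OF e(1)] e(2) by simp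
      then have "2 \<le> card (e - {w})" using assms by simp
      then obtain x y where xy: "x \<in> e - {w}" "y \<in> e - {w}" "x \<noteq> y"
        by (metis One_nat_def Suc_1 card_le_Suc0_iff_eq card.infinite le_zero_eq not_less_eq_eq zero_neq_numeral)
      obtain i where i: "i < k" "w = a + i * b" using e(2) ab by auto
      obtain j1 where j1: "j1 < k" "x = a + j1 * b" using xy ab by auto
      obtain j2 where j2: "j2 < k" "y = a + j2 * b" using xy ab by auto
      have "v \<in> (\<lambda>i. a' + i * b') ` {..<k}" "x \<in> (\<lambda>i. a' + i * b') ` {..<k}" "y \<in> (\<lambda>i. a' + i * b') ` {..<k}"
        unfolding ab'[symmetric] using xy by auto
      then obtain i' j1' j2' where p: "i' < k" "v = a' + i' * b'" "j1' < k" "x = a' + j1' * b'" "j2' < k" "y = a' + j2' * b'"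
        by auto
      have "a + j1 * b = a' + j1' * b'" "a + j2 * b = a' + j2' * b'" "a + j1 * b \<noteq> a + j2 * b"
        using p(4,6) xy(3) j1(2) j2(2) by simp_all
      then have "R (i, j1, j2, i', j1', j2') e"
        unfolding R_def prod.case using ab i(2) p(2) by blast
      then show ?thesis using i j1 j2 p by (intro bexI[of _ "(i, j1, j2, i', j1', j2')"]) auto
    qed
    show "e = e'" if "x \<in> ?T" "R x e" "R x e'" for x e e'
    proof -
      obtain i j1 j2 i' j1' j2' where x: "x = (i, j1, j2, i', j1', j2')" by (metis prod_cases6)
      \<comment> \<open>Measured from \<open>w\<close> in one progression and from \<open>v\<close>
        in the other, the two shared points give two equations in \<open>b\<close> and
        \<open>b'\<close>; cross multiplication eliminates \<open>b'\<close>.\<close>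
      have key: "(int j2' - int j1') * (int w - int v) =
          ((int j1' - int i') * (int j2 - int i) - (int j2' - int i') * (int j1 - int i)) * int b"
        if "w = a + i * b" "v = a' + i' * b'" "a + j1 * b = a' + j1' * b'" "a + j2 * b = a' + j2' * b'" for a b a' b'
      proof -
        have w: "int w = int a + int i * int b" and v: "int v = int a' + int i' * int b'"
          using that by simp_all
        have 1: "int a + int j1 * int b = int a' + int j1' * int b'"
          using that(3) by (metis of_nat_add of_nat_mult)
        have 2: "int a + int j2 * int b = int a' + int j2' * int b'"
          using that(4) by (metis of_nat_add of_nat_mult)
        have e1: "int w - int v + (int j1 - int i) * int b = (int j1' - int i') * int b'"
          using 1 by (simp add: w v algebra_simps)
        have e2: "int w - int v + (int j2 - int i) * int b = (int j2' - int i') * int b'"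
          using 2 by (simp add: w v algebra_simps)
        have "(int j2' - int i') * (int w - int v + (int j1 - int i) * int b) =
            (int j1' - int i') * (int w - int v + (int j2 - int i) * int b)"
          unfolding e1 e2 by (simp add: algebra_simps)
        then show ?thesis by (simp add: algebra_simps)
      qed
      obtain a b a' b' where 1: "e = (\<lambda>i. a + i * b) ` {..<k}" "w = a + i * b" "v = a' + i' * b'"
        "a + j1 * b = a' + j1' * b'" "a + j2 * b = a' + j2' * b'" "a + j1 * b \<noteq> a + j2 * b"
        using \<open>R x e\<close> unfolding R_def x prod.case by blast
      obtain c d c' d' where 2: "e' = (\<lambda>i. c + i * d) ` {..<k}" "w = c + i * d" "v = c' + i' * d'"
        "c + j1 * d = c' + j1' * d'" "c + j2 * d = c' + j2' * d'" "c + j1 * d \<noteq> c + j2 * d"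
        using \<open>R x e'\<close> unfolding R_def x prod.case by blast
      define D where "D = (int j1' - int i') * (int j2 - int i) - (int j2' - int i') * (int j1 - int i)"
      have "D * int b = D * int d"
        using key[OF 1(2-5)] key[OF 2(2-5)] unfolding D_def by (rule trans[OF sym])
      moreover have "j1' \<noteq> j2'" using 1 by auto
      then have "(int j2' - int j1') * (int w - int v) \<noteq> 0" using assms(1) by simp
      then have "D * int b \<noteq> 0" using key[OF 1(2-5)] unfolding D_def by simp
      ultimately have "b = d" by simp
      then show ?thesis using 1(1,2) 2(1,2) by simp
    qed
  qed auto
  also have "\<dots> = k ^ 6" by (simp add: card_cartesian_product eval_nat_numeral)
  finally show ?thesis .
qed

text \<open>The integer counterpart of \<open>n * upper k j (w / n)\<close>: the largest difference
  with which \<open>w\<close> can stand in position \<open>j\<close> of a progression within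
  \<open>{1..n}\<close>. The \<open>w - 1\<close> reflects that the points start at 1.\<close>

definition maxdiff :: "nat \<Rightarrow> nat \<Rightarrow> nat \<Rightarrow> nat \<Rightarrow> nat" where
  "maxdiff k n w j = (if j = 1 then (n - w) div (k - 1) else if j = k then (w - 1) div (k - 1)
     else min ((w - 1) div (j - 1)) ((n - w) div (k - j)))"

lemma le_maxdiff_iff:
  assumes "3 \<le> k" "w \<in> {1..n}" "j \<in> {1..k}"
  shows "b \<le> maxdiff k n w j \<longleftrightarrow> (j - 1) * b + 1 \<le> w \<and> w + (k - j) * b \<le> n"
  using assms
  by (auto simp: maxdiff_def less_eq_div_iff_mult_less_eq mult.commute)

lemma maxdiff_bounds:
  assumes "3 \<le> k" "w \<in> {1..n}" "j \<in> {1..k}"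
  shows "real (maxdiff k n w j) \<le> real n * upper k j (real w / real n)"
    "real n * upper k j (real w / real n) \<le> real (maxdiff k n w j) + 1"
proof -
  define M where "M = maxdiff k n w j"
  have n0: "0 < real n" using assms by auto
  have sc: "real n * (real w / real n / c) = real w / c" "real n * ((1 - real w / real n) / c) = (real n - real w) / c" for c
  proof -
    show "real n * (real w / real n / c) = real w / c" using n0 by simp
    have "real n * ((1 - real w / real n) / c) = (real n * (1 - real w / real n)) / c" by simp
    also have "real n * (1 - real w / real n) = real n - real w" using n0 by (simp add: right_diff_distrib)
    finally show "real n * ((1 - real w / real n) / c) = (real n - real w) / c" .
  qed
  have up: "real n * upper k j (real w / real n) = (if j = 1 then (real n - real w) / (real k - 1)
      else if j = k then real w / (real j - 1) else min (real w / (real j - 1)) ((real n - real w) / (real k - real j)))"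
  proof -
    have "real n * min a b = min (real n * a) (real n * b)" for a b using n0 by (simp add: min_mult_distrib_left)
    then show ?thesis unfolding upper_def if_distrib[of "(*) (real n)"] by (simp only: sc)
  qed
  have rj: "real (j - 1) = real j - 1" "real (k - j) = real k - real j" using assms by auto
  have 1: "(j - 1) * M + 1 \<le> w" "w + (k - j) * M \<le> n"
    using le_maxdiff_iff[OF assms, of M] by (auto simp: M_def)
  have "(j - 1) * M \<le> w" using 1 by simp
  then have "real ((j - 1) * M) \<le> real w" "real (w + (k - j) * M) \<le> real n" using 1(2) by (simp_all only: of_nat_le_iff)
  then have r1: "(real j - 1) * real M \<le> real w" "real w + (real k - real j) * real M \<le> real n"
    by (simp_all only: of_nat_mult of_nat_add rj)
  show "real M \<le> real n * upper k j (real w / real n)"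
    unfolding up using r1 assms by (auto simp: field_simps)
  have "\<not> M + 1 \<le> maxdiff k n w j" by (simp add: M_def)
  then have "w < (j - 1) * (M + 1) + 1 \<or> n < w + (k - j) * (M + 1)"
    using le_maxdiff_iff[OF assms, of "M + 1"] by linarith
  then have "w \<le> (j - 1) * (M + 1) \<or> n < w + (k - j) * (M + 1)" by linarith
  then have "real w \<le> real ((j - 1) * (M + 1)) \<or> real n < real (w + (k - j) * (M + 1))"
    by (metis of_nat_le_iff of_nat_less_iff)
  then have r2: "real w \<le> (real j - 1) * (real M + 1) \<or> real n < real w + (real k - real j) * (real M + 1)"
    by (simp only: of_nat_mult of_nat_add rj of_nat_1)
  have w1: "1 \<le> real w" "real w \<le> real n" using assms by auto
  show "real n * upper k j (real w / real n) \<le> real M + 1"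
  proof (cases "real w \<le> (real j - 1) * (real M + 1)")
    case True
    then have "j \<noteq> 1" using w1 by auto
    then have "real w / (real j - 1) \<le> real M + 1" using True assms by (simp add: field_simps)
    then show ?thesis unfolding up using \<open>j \<noteq> 1\<close> by auto
  next
    case False
    then have f: "real n < real w + (real k - real j) * (real M + 1)" using r2 by blast
    then have "j \<noteq> k" using w1 by auto
    then have "(real n - real w) / (real k - real j) \<le> real M + 1" using f assms by (simp add: field_simps)
    then show ?thesis unfolding up using \<open>j \<noteq> k\<close> by auto
  qed
qed

text \<open>The position of \<open>w\<close> and the common difference parametrise the progressions
  through \<open>w\<close>. Writing the terms as \<open>w + i * b - j * b\<close>, in this order,
  keeps the truncated subtraction exact.\<close>

lemma AP_star_bij:
  assumes k: "3 \<le> k" and w: "w \<in> {1..n}"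
  shows "bij_betw (\<lambda>(j, b). (\<lambda>i. w + i * b - j * b) ` {1..k}) (SIGMA j:{1..k}. {1..maxdiff k n w j}) (AP_star k n w)"
  unfolding bij_betw_def
proof
  let ?S = "SIGMA j:{1..k}. {1..maxdiff k n w j}"
  let ?f = "\<lambda>(j, b). (\<lambda>i. w + i * b - j * b) ` {1..k}"
  have ip: "int (w + i * b - j * b) = int w + (int i - int j) * int b"
    if "(j, b) \<in> ?S" "i \<in> {1..k}" for i j b
  proof -
    have "(j - 1) * b + 1 \<le> w" using that le_maxdiff_iff[OF k w, of j b] by auto
    moreover have "j * b = (j - 1) * b + b" using that by (cases j) auto
    moreover have "b \<le> i * b" using that by auto
    ultimately have "j * b \<le> w + i * b" by linarith
    then show ?thesis by (simp add: of_nat_diff algebra_simps)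
  qed
  show "inj_on ?f ?S"
  proof (rule inj_onI, clarify)
    fix j b j' b' assume S: "j \<in> {1..k}" "b \<in> {1..maxdiff k n w j}" "j' \<in> {1..k}" "b' \<in> {1..maxdiff k n w j'}"
      and eq: "(\<lambda>i. w + i * b - j * b) ` {1..k} = (\<lambda>i. w + i * b' - j' * b') ` {1..k}"
    \<comment> \<open>One inequality for each end of the progression. With the two pairs exchanged
      it yields equality of both ends, and their distance then determines \<open>b\<close>.\<close>
    have le: "(1 - int j') * int b' \<le> (1 - int j) * int b \<and> (int k - int j) * int b \<le> (int k - int j') * int b'"
      if S: "(j, b) \<in> ?S" "(j', b') \<in> ?S" and eq: "(\<lambda>i. w + i * b - j * b) ` {1..k} = (\<lambda>i. w + i * b' - j' * b') ` {1..k}"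
      for j b j' b'
    proof
      have m: "\<exists>i'\<in>{1..k}. (int i - int j) * int b = (int i' - int j') * int b'" if i: "i \<in> {1..k}" for i
      proof -
        have "w + i * b - j * b \<in> (\<lambda>i. w + i * b' - j' * b') ` {1..k}" using i eq by blast
        then obtain i' where "i' \<in> {1..k}" "w + i * b - j * b = w + i' * b' - j' * b'" by auto
        then show ?thesis using ip[OF S(1) i] ip[OF S(2), of i'] by (intro bexI[of _ i']) auto
      qed
      obtain i' where "i' \<in> {1..k}" "(int 1 - int j) * int b = (int i' - int j') * int b'" using m[of 1] k by auto
      moreover have "(1 - int j') * int b' \<le> (int i' - int j') * int b'" using calculation by (intro mult_right_mono) auto
      ultimately show "(1 - int j') * int b' \<le> (1 - int j) * int b" by simp
      obtain i' where "i' \<in> {1..k}" "(int k - int j) * int b = (int i' - int j') * int b'" using m[of k] k by auto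
      moreover have "(int i' - int j') * int b' \<le> (int k - int j') * int b'" using calculation by (intro mult_right_mono) auto
      ultimately show "(int k - int j) * int b \<le> (int k - int j') * int b'" by simp
    qed
    have m1: "(j, b) \<in> ?S" "(j', b') \<in> ?S" using S by auto
    have e1: "(1 - int j) * int b = (1 - int j') * int b'" and e2: "(int k - int j) * int b = (int k - int j') * int b'"
      using le[OF m1 eq] le[OF m1(2,1) eq[symmetric]] by auto
    have "(int k - 1) * int b = (int k - 1) * int b'" using e1 e2 by (simp add: algebra_simps)
    then have b: "b = b'" using k by simp
    moreover have "0 < int b" using S by simp
    ultimately show "j = j' \<and> b = b'" using e1 by simp
  qed
  show "?f ` ?S = (AP_star k n w)"
  proof (intro equalityI subsetI)
    fix e assume "e \<in> ?f ` ?S"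
    then obtain j b where jb: "(j, b) \<in> ?S" and e: "e = (\<lambda>i. w + i * b - j * b) ` {1..k}" by auto
    have c: "(j - 1) * b + 1 \<le> w" "w + (k - j) * b \<le> n" "1 \<le> b" "j \<in> {1..k}"
      using jb le_maxdiff_iff[OF k w, of j b] by auto
    have jb1: "j * b = (j - 1) * b + b" using c by (cases j) auto
    define a where "a = w - (j - 1) * b"
    have pt: "w + Suc i * b - j * b = a + i * b" for i using c jb1 unfolding a_def by simp
    have "{1..k} = Suc ` {..<k}" using image_Suc_lessThan by simp
    then have e': "e = (\<lambda>i. a + i * b) ` {..<k}" unfolding e by (simp add: image_image pt del: mult_Suc)
    have "w \<in> e"
    proof -
      have "w = w + j * b - j * b" by simp
      then show ?thesis unfolding e using c by blast
    qed
    moreover have "e \<subseteq> {1..n}"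
    proof
      fix x assume "x \<in> e"
      then obtain i where i: "i < k" "x = a + i * b" unfolding e' by auto
      have "1 \<le> a" using c by (simp add: a_def)
      moreover have "i * b \<le> (k - 1) * b" using i by (intro mult_right_mono) auto
      moreover have "(k - 1) * b = (j - 1) * b + (k - j) * b" using c by (simp add: add_mult_distrib[symmetric])
      moreover have "a + (j - 1) * b = w" using c by (simp add: a_def)
      ultimately have "1 \<le> x" "x \<le> n" using c(2) i(2) by linarith+
      then show "x \<in> {1..n}" by simp
    qed
    ultimately show "e \<in> AP_star k n w" using e' c unfolding AP_def is_kAP_image by blast
  next
    fix e assume "e \<in> AP_star k n w"
    then have ee: "is_kAP k e" "e \<subseteq> {1..n}" "w \<in> e" by (auto simp: AP_def)
    then obtain a b where ab: "1 \<le> b" "e = (\<lambda>i. a + i * b) ` {..<k}" by (auto simp: is_kAP_image)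
    then obtain i0 where i0: "i0 < k" "w = a + i0 * b" using ee(3) by auto
    have mem: "a + 0 * b \<in> e" "a + (k - 1) * b \<in> e" unfolding ab(2) using k by (auto simp del: mult_0)
    then have r: "1 \<le> a" "a + (k - 1) * b \<le> n" using ee(2) by auto
    define j where "j = Suc i0"
    have j: "j \<in> {1..k}" using i0 by (auto simp: j_def)
    have "(k - 1) * b = i0 * b + (k - j) * b" using i0 by (simp add: j_def add_mult_distrib[symmetric])
    then have "b \<le> maxdiff k n w j" unfolding le_maxdiff_iff[OF k w j] using r i0 by (auto simp: j_def)
    then have jb: "(j, b) \<in> ?S" using j ab by auto
    have pt: "w + Suc i * b - j * b = a + i * b" for i using i0 by (simp add: j_def)
    have "{1..k} = Suc ` {..<k}" using image_Suc_lessThan by simp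
    then have "e = (\<lambda>i. w + i * b - j * b) ` {1..k}" unfolding ab(2) by (simp add: image_image pt del: mult_Suc)
    then show "e \<in> ?f ` ?S" using jb by force
  qed
qed

lemma prod_AP_minus:
  fixes X :: "real \<Rightarrow> real"
  assumes k: "3 \<le> k" and w: "w \<in> {1..n}" and j: "j \<in> {1..k}" and b: "b \<in> {1..maxdiff k n w j}"
  shows "(\<Prod>v\<in>(\<lambda>i. w + i * b - j * b) ` {1..k} - {w}. X (real v / real n)) =
    (kern k j X (real w / real n) (real b / real n))"
proof -
  have c: "(j - 1) * b + 1 \<le> w" "1 \<le> b" using b le_maxdiff_iff[OF k w j, of b] by auto
  have jb1: "j * b = (j - 1) * b + b" using j by (cases j) auto
  have le: "j * b \<le> w + i * b" if "i \<in> {1..k}" for i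
  proof -
    have "b \<le> i * b" using that by auto
    then show ?thesis using c jb1 by linarith
  qed
  have inj: "inj_on (\<lambda>i. w + i * b - j * b) {1..k}"
  proof (rule inj_onI)
    fix x y assume xy: "x \<in> {1..k}" "y \<in> {1..k}" "w + x * b - j * b = w + y * b - j * b"
    then have "w + x * b = w + y * b" using le[OF xy(1)] le[OF xy(2)] by linarith
    then show "x = y" using c by simp
  qed
  have "(\<lambda>i. w + i * b - j * b) ` ({1..k} - {j}) = (\<lambda>i. w + i * b - j * b) ` {1..k} - (\<lambda>i. w + i * b - j * b) ` {j}"
    using j by (intro inj_on_image_set_diff[OF inj]) auto
  then have "(\<lambda>i. w + i * b - j * b) ` {1..k} - {w} = (\<lambda>i. w + i * b - j * b) ` ({1..k} - {j})" by simp
  then have "(\<Prod>v\<in>(\<lambda>i. w + i * b - j * b) ` {1..k} - {w}. X (real v / real n)) =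
     (\<Prod>i\<in>{1..k} - {j}. X (real (w + i * b - j * b) / real n))"
    using inj by (simp add: prod.reindex[OF inj_on_diff])
  also have "\<dots> = (kern k j X (real w / real n) (real b / real n))"
  proof (rule prod.cong[OF refl])
    fix i assume "i \<in> {1..k} - {j}"
    then have "real (w + i * b - j * b) = real w + (real i - real j) * real b"
      using le[of i] by (simp add: of_nat_diff algebra_simps)
    then show "X (real (w + i * b - j * b) / real n) = X (real w / real n + (real i - real j) * (real b / real n))"
      by (simp add: add_divide_distrib)
  qed
  finally show ?thesis .
qed

lemma sum_AP_star:
  fixes X :: "real \<Rightarrow> real"
  assumes k: "3 \<le> k" and w: "w \<in> {1..n}"
  shows "(\<Sum>e\<in>AP_star k n w. lprod n w X e) =
    (\<Sum>j=1..k. \<Sum>b=1..maxdiff k n w j. kern k j X (real w / real n) (real b / real n))"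
proof -
  have "(\<Sum>e\<in>AP_star k n w. lprod n w X e) =
    (\<Sum>x\<in>(SIGMA j:{1..k}. {1..maxdiff k n w j}). \<Prod>v\<in>(case x of (j, b) \<Rightarrow> (\<lambda>i. w + i * b - j * b) ` {1..k}) - {w}. X (real v / real n))"
    by (rule sum.reindex_bij_betw[OF AP_star_bij[OF assms], symmetric])
  also have "\<dots> = (\<Sum>j=1..k. \<Sum>b=1..maxdiff k n w j. \<Prod>v\<in>(\<lambda>i. w + i * b - j * b) ` {1..k} - {w}. X (real v / real n))"
    by (subst sum.Sigma) (auto simp: case_prod_unfold)
  also have "\<dots> = (\<Sum>j=1..k. \<Sum>b=1..maxdiff k n w j. kern k j X (real w / real n) (real b / real n))"
    by (intro sum.cong refl prod_AP_minus[OF assms])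
  finally show ?thesis .
qed

lemma card_AP_star:
  assumes k: "3 \<le> k" and w: "w \<in> {1..n}"
  shows "real (card (AP_star k n w)) \<le> real n * alpha k"
proof -
  have "card (AP_star k n w) = card (SIGMA j:{1..k}. {1..maxdiff k n w j})"
    using bij_betw_same_card[OF AP_star_bij[OF assms]] by simp
  also have "\<dots> = (\<Sum>j=1..k. maxdiff k n w j)" by simp
  finally have "real (card (AP_star k n w)) = (\<Sum>j=1..k. real (maxdiff k n w j))" by simp
  also have "\<dots> \<le> (\<Sum>j=1..k. real n * upper k j (real w / real n))"
    by (intro sum_mono maxdiff_bounds(1)[OF assms])
  also have "\<dots> = real n * (\<Sum>j=1..k. upper k j (real w / real n))" by (simp add: sum_distrib_left)
  also have "\<dots> \<le> real n * alpha k" using sum_upper_le[OF k] by (intro mult_left_mono) auto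
  finally show ?thesis .
qed

section \<open>Riemann sums over progressions\<close>

lemma riemann_sum_error:
  fixes f :: "real \<Rightarrow> real"
  assumes f: "continuous_on UNIV f" and d: "0 \<le> \<delta>"
    and osc: "\<And>s s'. s \<in> {0..real M * \<delta>} \<Longrightarrow> s' \<in> {0..real M * \<delta>} \<Longrightarrow> \<bar>s - s'\<bar> \<le> \<delta> \<Longrightarrow> \<bar>f s - f s'\<bar> \<le> \<epsilon>"
  shows "\<bar>\<delta> * (\<Sum>b=1..M. f (real b * \<delta>)) - integral {0..real M * \<delta>} f\<bar> \<le> real M * \<delta> * \<epsilon>"
  using osc
proof (induction M)
  case 0
  then show ?case by simp
next
  case (Suc M)
  let ?a = "real M * \<delta>" and ?b = "real (Suc M) * \<delta>"
  have fi: "f integrable_on {a..b}" for a b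
    using f continuous_on_subset integrable_continuous_real by blast
  have ab: "0 \<le> ?a" "?a \<le> ?b" "?b = ?a + \<delta>" using d by (auto simp: algebra_simps)
  have "integral {0..?b} f = integral {0..?a} f + integral {?a..?b} f"
    using ab fi by (simp add: Henstock_Kurzweil_Integration.integral_combine)
  moreover have "\<bar>\<delta> * (\<Sum>b=1..M. f (real b * \<delta>)) - integral {0..?a} f\<bar> \<le> ?a * \<epsilon>"
    using ab by (intro Suc.IH Suc.prems) auto
  moreover have "\<bar>integral {?a..?b} f - \<delta> * f ?b\<bar> \<le> \<epsilon> * \<delta>"
  proof -
    have "integral {?a..?b} (\<lambda>s. f s - f ?b) = integral {?a..?b} f - integral {?a..?b} (\<lambda>s. f ?b)"
      by (rule Henstock_Kurzweil_Integration.integral_diff) (use fi in auto)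
    then have e: "integral {?a..?b} f - \<delta> * f ?b = integral {?a..?b} (\<lambda>s. f s - f ?b)"
      using ab by (simp add: mult.commute)
    have "norm (integral {?a..?b} (\<lambda>s. f s - f ?b)) \<le> \<epsilon> * (?b - ?a)"
    proof (rule integral_bound)
      show "continuous_on {?a..?b} (\<lambda>s. f s - f ?b)"
        using continuous_on_subset[OF f] by (intro continuous_intros) auto
      show "norm (f s - f ?b) \<le> \<epsilon>" if "s \<in> {?a..?b}" for s
      proof -
        have "0 \<le> s" using that ab by (meson atLeastAtMost_iff order_trans)
        then show ?thesis using Suc.prems[of s ?b] that ab d by auto
      qed
    qed (use ab in auto)
    then show ?thesis unfolding e using ab by simp
  qed
  ultimately show ?case using ab(3) by (simp add: algebra_simps abs_le_iff)
qed

lemma upper_le_1: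
  assumes "3 \<le> k" "u \<in> {0..1}" "j \<in> {1..k}"
  shows "upper k j u \<le> 1"
proof -
  have "u / c \<le> 1" "(1 - u) / c \<le> 1" if "1 \<le> c" for c using that assms by (auto simp: field_simps)
  then show ?thesis using assms by (auto simp: upper_def min_le_iff_disj)
qed

text \<open>The point is uniformity in \<open>w\<close>: as \<open>X\<close> is continuous on the
  whole line, the integrand is jointly continuous on the closed unit square, and one modulus of
  continuity serves all \<open>w\<close>.\<close>

lemma AP_riemann:
  fixes X :: "real \<Rightarrow> real"
  assumes k: "3 \<le> k" and X: "continuous_on UNIV X" "\<And>v. 0 < X v" "\<And>v. X v \<le> t" and e: "0 < \<epsilon>"
  shows "\<forall>\<^sub>F n in sequentially. \<forall>w\<in>{1..n}.
    \<bar>(\<Sum>e\<in>AP_star k n w. lprod n w X e) / real n - Lam k X (real w / real n)\<bar> \<le> \<epsilon>"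
    (is "\<forall>\<^sub>F n in _. \<forall>w\<in>_. \<bar>?err n w\<bar> \<le> _")
proof -
  define F where "F j u s = kern k j X u s" for j u s
  \<comment> \<open>Each of the \<open>k\<close> positions contributes two errors: that of the
    Riemann sum, and the integral over the remaining interval of length at most \<open>1 / n\<close>
    between \<open>maxdiff / n\<close> and \<open>upper\<close>.\<close>
  define \<epsilon>' where "\<epsilon>' = \<epsilon> / (2 * real k)"
  have e': "0 < \<epsilon>'" using e k by (simp add: \<epsilon>'_def)
  have t0: "0 < t" using X(2,3)[of 0] by linarith
  have cF: "continuous_on A (\<lambda>z. F j (fst z) (snd z))" for j A
    unfolding F_def by (intro continuous_on_prod continuous_on_compose2[OF X(1)] continuous_intros) auto
  have F0: "0 \<le> F j u s" for j u s unfolding F_def using X(2) by (intro prod_nonneg) (simp add: less_imp_le)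
  have Ft: "F j u s \<le> t ^ (k - 1)" if "j \<in> {1..k}" for j u s
  proof -
    have "F j u s \<le> (\<Prod>i\<in>{1..k} - {j}. t)" unfolding F_def using X(2,3) by (intro prod_mono) (simp add: less_imp_le)
    then show ?thesis using that by simp
  qed
  have "\<forall>j. \<exists>d>0. \<forall>z\<in>{0..1} \<times> {0..1}. \<forall>z'\<in>{0..1} \<times> {0..1}. dist z' z < d \<longrightarrow>
      dist (F j (fst z') (snd z')) (F j (fst z) (snd z)) < \<epsilon>'"
  proof
    fix j
    have "uniformly_continuous_on ({0..1} \<times> {0..1}) (\<lambda>z. F j (fst z) (snd z))"
      by (intro compact_uniformly_continuous cF compact_Times) auto
    then show "\<exists>d>0. \<forall>z\<in>{0..1} \<times> {0..1}. \<forall>z'\<in>{0..1} \<times> {0..1}. dist z' z < d \<longrightarrow>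
      dist (F j (fst z') (snd z')) (F j (fst z) (snd z)) < \<epsilon>'"
      using e' unfolding uniformly_continuous_on_def by blast
  qed
  then obtain d where d: "\<And>j. 0 < d j" "\<And>j z z'. z \<in> {0..1} \<times> {0..1} \<Longrightarrow> z' \<in> {0..1} \<times> {0..1} \<Longrightarrow> dist z' z < d j \<Longrightarrow>
      dist (F j (fst z') (snd z')) (F j (fst z) (snd z)) < \<epsilon>'" by metis
  have lim: "(\<lambda>n. 1 / real n) \<longlonglongrightarrow> 0" by (rule lim_const_over_n)
  have "\<forall>\<^sub>F n in sequentially. \<forall>j\<in>{1..k}. 1 / real n < d j"
    using d(1) by (intro eventually_ball_finite ballI order_tendstoD(2)[OF lim]) auto
  moreover have "\<forall>\<^sub>F n in sequentially. 1 / real n < \<epsilon>' / t ^ (k - 1)"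
    using e' t0 by (intro order_tendstoD(2)[OF lim]) simp
  moreover have "\<forall>\<^sub>F n in sequentially. 0 < n" by (rule eventually_gt_at_top)
  ultimately show ?thesis
  proof eventually_elim
    case (elim n)
    show ?case
    proof
      fix w assume w: "w \<in> {1..n}"
      define u where "u = real w / real n"
      have u: "u \<in> {0..1}" using w elim by (auto simp: u_def field_simps)
      have each: "\<bar>(\<Sum>b=1..maxdiff k n w j. F j u (real b / real n)) / real n - (LBINT s:{0..upper k j u}. F j u s)\<bar> \<le> \<epsilon> / real k"
        if j: "j \<in> {1..k}" for j
      proof -
        define M where "M = maxdiff k n w j"
        let ?U = "upper k j u" and ?f = "F j u"
        have MU: "real M / real n \<le> ?U" "?U \<le> (real M + 1) / real n"
          using maxdiff_bounds[OF k w j] elim by (auto simp: u_def M_def field_simps)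
        have cf: "continuous_on A ?f" for A
        proof -
          have "continuous_on A (\<lambda>s::real. (u, s))" by (intro continuous_intros)
          from continuous_on_compose2[OF cF[of UNIV j] this] show ?thesis by simp
        qed
        have fi: "?f integrable_on {a..b}" for a b using cf integrable_continuous_real by blast
        have U1: "?U \<le> 1" by (rule upper_le_1[OF k u j])
        have "\<bar>1 / real n * (\<Sum>b=1..M. ?f (real b * (1 / real n))) - integral {0..real M * (1 / real n)} ?f\<bar>
            \<le> real M * (1 / real n) * \<epsilon>'"
        proof (rule riemann_sum_error[OF cf])
          fix s s' assume s: "s \<in> {0..real M * (1 / real n)}" "s' \<in> {0..real M * (1 / real n)}" "\<bar>s - s'\<bar> \<le> 1 / real n"
          have "\<bar>s - s'\<bar> < d j" using s(3) elim(1) j by (meson le_less_trans)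
          then have "dist (u, s) (u, s') < d j" by (simp add: dist_Pair_Pair dist_real_def)
          moreover have "(u, s) \<in> {0..1} \<times> {0..1}" "(u, s') \<in> {0..1} \<times> {0..1}" using s u MU(1) U1 by auto
          ultimately have "dist (?f s) (?f s') < \<epsilon>'" using d(2)[of "(u, s')" "(u, s)" j] by simp
          then show "\<bar>?f s - ?f s'\<bar> \<le> \<epsilon>'" by (simp add: dist_real_def)
        qed simp
        moreover have "real M * (1 / real n) * \<epsilon>' \<le> 1 * \<epsilon>'" using MU(1) U1 e' by (intro mult_right_mono) auto
        ultimately have 1: "\<bar>(\<Sum>b=1..M. ?f (real b / real n)) / real n - integral {0..real M / real n} ?f\<bar> \<le> \<epsilon>'"
          by simp
        have "(LBINT s:{0..?U}. ?f s) = integral {0..?U} ?f"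
          by (rule set_borel_integral_eq_integral(2)[OF borel_integrable_atLeastAtMost'[OF cf]])
        also have "\<dots> = integral {0..real M / real n} ?f + integral {real M / real n..?U} ?f"
          using MU(1) fi by (simp add: Henstock_Kurzweil_Integration.integral_combine)
        finally have 2: "(LBINT s:{0..?U}. ?f s) = integral {0..real M / real n} ?f + integral {real M / real n..?U} ?f" .
        have "norm (integral {real M / real n..?U} ?f) \<le> t ^ (k - 1) * (?U - real M / real n)"
          using F0 Ft[OF j] by (intro integral_bound MU(1) cf) simp
        also have "\<dots> \<le> t ^ (k - 1) * (1 / real n)" using MU(2) t0 by (intro mult_left_mono) (auto simp: add_divide_distrib)
        also have "\<dots> \<le> \<epsilon>'" using elim t0 by (simp add: field_simps)
        finally have 3: "\<bar>integral {real M / real n..?U} ?f\<bar> \<le> \<epsilon>'" by simp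
        have "\<bar>(\<Sum>b=1..M. ?f (real b / real n)) / real n - (LBINT s:{0..?U}. ?f s)\<bar> \<le> 2 * \<epsilon>'"
          using 1 2 3 by linarith
        then show ?thesis unfolding M_def \<epsilon>'_def by simp
      qed
      have "?err n w =
        (\<Sum>j=1..k. (\<Sum>b=1..maxdiff k n w j. F j u (real b / real n)) / real n - (LBINT s:{0..upper k j u}. F j u s))"
        unfolding sum_AP_star[OF k w] Lam_def F_def u_def by (simp add: sum_subtractf sum_divide_distrib)
      also have "\<bar>\<dots>\<bar> \<le> (\<Sum>j=1..k. \<epsilon> / real k)"
        using each by (intro sum_abs[THEN order_trans] sum_mono) auto
      also have "\<dots> = \<epsilon>" using k by simp
      finally show "\<bar>?err n w\<bar> \<le> \<epsilon>" .
    qed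
  qed
qed

section \<open>Convergence of the marginals\<close>

lemma AP_sparse:
  assumes "3 \<le> k" "0 < p" "p < 1"
  shows "sparse_hypergraph {1..n} p (AP k n) k (k ^ 6)"
  by unfold_locales (use assms AP_card AP_codegree AP_links in \<open>auto simp: AP_def\<close>)

lemma exp_le_one_minus:
  fixes x :: real
  assumes "0 \<le> x" "x \<le> 1 / 2"
  shows "exp (- x - 2 * x\<^sup>2) \<le> 1 - x"
proof -
  have "- x - 2 * x\<^sup>2 \<le> ln (1 - x)" using ln_one_minus_pos_lower_bound[OF assms] .
  then have "exp (- x - 2 * x\<^sup>2) \<le> exp (ln (1 - x))" by simp
  then show ?thesis using assms by simp
qed

locale subcritical_profile = subcritical k t \<theta>
  for k :: nat and t \<theta> :: real +
  fixes X :: "real \<Rightarrow> real" and p :: "nat \<Rightarrow> real"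
  assumes X_cont: "continuous_on UNIV X" and X_pos: "\<And>v. 0 < X v" and X_le: "\<And>v. X v \<le> t"
    and X_fix: "\<And>u. u \<in> {0..1} \<Longrightarrow> ln (t / X u) = Lam k X u"
    and p_lim: "(\<lambda>n. real n powr (1 / (real k - 1)) * p n) \<longlonglongrightarrow> t"
begin

definition sc :: "nat \<Rightarrow> real" where
  "sc n = real n powr (1 / kd)"

text \<open>The value whose \<open>amp\<close> is \<open>exp \<rho>\<close> times that of the limit profile; it decreases in \<open>\<rho>\<close>.\<close>
definition bnd :: "real \<Rightarrow> real \<Rightarrow> real" where
  "bnd \<rho> v = t * exp (- ((exp \<rho> * amp k t (X v) - 1) / kd))"

abbreviation ub :: "nat \<Rightarrow> nat \<Rightarrow> real \<Rightarrow> bool" where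
  "ub n s \<rho> \<equiv> sparse_hypergraph.marg_ub {1..n} (p n) (AP k n) s (\<lambda>w. bnd (- \<rho>) (real w / real n) / sc n)"

abbreviation lb :: "nat \<Rightarrow> nat \<Rightarrow> real \<Rightarrow> bool" where
  "lb n s \<rho> \<equiv> sparse_hypergraph.marg_lb {1..n} (p n) (AP k n) s (\<lambda>w. bnd \<rho> (real w / real n) / sc n)"

lemma m0: "0 < real k - 1" "real (k - 1) = real k - 1"
  using k3 by auto

lemma amp_X_ge: "1 \<le> amp k t (X v)"
  using X_pos[of v] X_le[of v] m0 by (simp add: amp_def)

lemma X_adm: "admissible X"
  using X_pos X_le borel_measurable_continuous_onI[OF X_cont] by (auto simp: admissible_def less_imp_le)

lemma amp_X_Lam: "u \<in> {0..1} \<Longrightarrow> Lam k X u = (amp k t (X u) - 1) / kd"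
  using m0 by (simp add: amp_def X_fix)

lemma amp_X_le: "u \<in> {0..1} \<Longrightarrow> amp k t (X u) \<le> ampmax"
  using Lam_bounds(2)[OF X_adm] m0 by (simp add: amp_def X_fix ampmax_def)

lemma bnd_pos: "0 < bnd \<rho> v"
  using t0 by (simp add: bnd_def)

lemma amp_bnd: "amp k t (bnd \<rho> v) = exp \<rho> * amp k t (X v)"
  unfolding bnd_def amp_def[of k t "t * _"] ln_div_exp using m0 by simp

lemma sc_power: "0 < n \<Longrightarrow> sc n ^ (k - 1) = real n"
  using m0 by (simp add: sc_def powr_realpow[symmetric] powr_powr)

lemma sc_pos: "0 < n \<Longrightarrow> 0 < sc n"
  by (simp add: sc_def)

lemma scp_lim: "(\<lambda>n. sc n * p n) \<longlonglongrightarrow> t"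
  using p_lim by (simp add: sc_def)

lemma p_to_0: "p \<longlonglongrightarrow> 0"
proof -
  have "(\<lambda>n. sc n * p n * real n powr (- (1 / kd))) \<longlonglongrightarrow> t * 0"
    using m0 by (intro tendsto_mult scp_lim tendsto_neg_powr filterlim_real_sequentially) auto
  moreover have "\<forall>\<^sub>F n in sequentially. sc n * p n * real n powr (- (1 / kd)) = p n"
    using eventually_gt_at_top[of 0]
  proof eventually_elim
    case (elim n)
    then show ?case by (simp add: sc_def powr_minus field_simps)
  qed
  ultimately show ?thesis using Lim_transform_eventually by fastforce
qed

lemma p_pos_ev: "\<forall>\<^sub>F n in sequentially. 0 < p n \<and> p n < 1 \<and> 0 < n"
proof -
  have "\<forall>\<^sub>F n in sequentially. 0 < sc n * p n" by (rule order_tendstoD(1)[OF scp_lim t0])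
  moreover have "\<forall>\<^sub>F n in sequentially. p n < 1" by (rule order_tendstoD(2)[OF p_to_0]) simp
  moreover have "\<forall>\<^sub>F n in sequentially. 0 < n" by (rule eventually_gt_at_top)
  ultimately show ?thesis
  proof eventually_elim
    case (elim n)
    then show ?case using sc_pos[of n] by (simp add: zero_less_mult_iff)
  qed
qed

text \<open>For negative \<rho> the values of \<open>bnd\<close> can exceed \<open>t\<close>, but
  their \<open>amp\<close> stays positive, and nonnegative \<open>amp\<close> already bounds a
  product of \<open>k - 1\<close> values by this number, uniformly in \<rho>.\<close>

definition Pmax :: real where
  "Pmax = t ^ (k - 1) * exp 1"

lemma Pmax_pos: "0 < Pmax"
  using t0 by (simp add: Pmax_def)

lemma AP_link_card:
  assumes "e \<in> AP k n" "w \<in> e"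
  shows "finite (e - {w})" "card (e - {w}) = k - 1"
proof -
  have "finite e" using assms finite_subset[of e "{1..n}"] by (auto simp: AP_def)
  then show "finite (e - {w})" "card (e - {w}) = k - 1" using AP_card[OF assms(1)] assms(2) by auto
qed

lemma prod_bnd_le:
  assumes "e \<in> AP k n" "w \<in> e"
  shows "lprod n w (bnd \<rho>) e \<le> Pmax"
proof -
  have "0 \<le> (\<Sum>v\<in>e - {w}. amp k t (bnd \<rho> (real v / real n))) / kd"
    using m0 order_trans[OF zero_le_one amp_X_ge] by (intro divide_nonneg_pos sum_nonneg) (auto simp: amp_bnd)
  then show ?thesis
    unfolding Pmax_def using t0
    by (subst prod_eq_exp_amp[OF AP_link_card[OF assms] k3 t0]) (auto intro: bnd_pos mult_left_mono)
qed

lemma prod_bnd_scaled: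
  assumes "e \<in> AP k n" "w \<in> e" "0 < n"
  shows "(\<Prod>v\<in>e - {w}. bnd \<rho> (real v / real n) / sc n) = lprod n w (bnd \<rho>) e / real n"
  using AP_link_card[OF assms(1,2)] sc_power[OF assms(3)] by (simp add: prod_dividef)

text \<open>Subcriticality in discrete form: the degree bound \<open>n * alpha k\<close> takes the
  place of the total length of the integration ranges.\<close>

lemma theta_sum_le:
  assumes "w \<in> {1..n}" "0 \<le> c"
  shows "real (card (AP_star k n w)) / real n * (c * (t ^ (k - 1) / (\<theta> * exp \<theta>))) \<le> c / kd"
proof -
  have n: "0 < real n" using assms by auto
  have "real (card (AP_star k n w)) / real n \<le> alpha k"
    using card_AP_star[OF k3 assms(1)] n by (simp add: field_simps)
  then have "real (card (AP_star k n w)) / real n * (c * (t ^ (k - 1) / (\<theta> * exp \<theta>))) \<le>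
      alpha k * (c * (t ^ (k - 1) / (\<theta> * exp \<theta>)))"
    using assms t0 th by (intro mult_right_mono) auto
  also have "\<dots> = (c / kd) * ((kd * t ^ (k - 1) * alpha k) / (\<theta> * exp \<theta>))"
  proof -
    have *: "x * (c * (y / z)) = (c / m) * ((m * y * x) / z)" if "0 < m" for m x y z :: real
      using that by simp
    show ?thesis by (rule *[OF m0(1)])
  qed
  also have "\<dots> \<le> (c / kd) * 1"
    using sub th assms m0 by (intro mult_left_mono) auto
  finally show ?thesis by simp
qed

text \<open>The counterpart of \<open>Lam_contract\<close> for finite sums. Because the contraction
  acts on the sums themselves, the comparison with an integral is needed for the single function
  \<open>X\<close> and not for the bounds \<open>bnd\<close>.\<close>

lemma sum_contract:
  assumes w: "w \<in> {1..n}" and \<rho>: "0 \<le> \<rho>" and pos: "\<And>v. 0 < x v" "\<And>v. 0 < y v"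
    and le: "\<And>v. amp k t (x v) \<le> exp \<rho> * amp k t (y v)"
  shows "(\<Sum>e\<in>AP_star k n w. lprod n w y e) / real n \<le>
    exp (\<theta> * \<rho>) * ((\<Sum>e\<in>AP_star k n w. lprod n w x e) / real n)
     + (exp (\<theta> * \<rho>) - 1) / kd"
proof -
  let ?E = "AP_star k n w" and ?c = "exp (\<theta> * \<rho>) - 1"
  let ?P = "lprod n w" and ?d = "t ^ (k - 1) / (\<theta> * exp \<theta>)"
  have c0: "0 \<le> ?c" using \<rho> th by simp
  have "(\<Sum>e\<in>?E. ?P y e) \<le> (\<Sum>e\<in>?E. exp (\<theta> * \<rho>) * ?P x e + ?c * ?d)"
  proof (rule sum_mono)
    fix e assume "e \<in> ?E"
    then have e: "e \<in> AP k n" "w \<in> e" by auto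
    show "?P y e \<le> exp (\<theta> * \<rho>) * ?P x e + ?c * ?d"
      by (rule prod_contract[OF AP_link_card[OF e] \<rho> pos le])
  qed
  then have "(\<Sum>e\<in>?E. ?P y e) / real n \<le> (\<Sum>e\<in>?E. exp (\<theta> * \<rho>) * ?P x e + ?c * ?d) / real n"
    by (rule divide_right_mono) simp
  also have "\<dots> = exp (\<theta> * \<rho>) * ((\<Sum>e\<in>?E. ?P x e) / real n) + real (card ?E) / real n * (?c * ?d)"
    by (simp add: sum.distrib sum_distrib_left[symmetric] add_divide_distrib)
  finally show ?thesis using theta_sum_le[OF w c0] by linarith
qed

section \<open>The two passes between upper and lower bounds\<close>

lemma prod_bnd_small:
  assumes e: "e \<in> AP_star k n w" and n: "0 < n" "Pmax / real n < 1 / 2"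
  shows "0 \<le> lprod n w (bnd \<rho>) e"
    "lprod n w (bnd \<rho>) e / real n \<le> 1 / 2"
proof -
  show "0 \<le> lprod n w (bnd \<rho>) e" by (intro prod_nonneg less_imp_le[OF bnd_pos])
  have "lprod n w (bnd \<rho>) e / real n \<le> Pmax / real n"
    using e prod_bnd_le by (intro divide_right_mono) auto
  then show "lprod n w (bnd \<rho>) e / real n \<le> 1 / 2" using n(2) by linarith
qed

lemma lower_from_upper:
  assumes \<rho>: "0 \<le> \<rho>" and \<epsilon>: "0 < \<epsilon>" and U: "\<And>s. \<forall>\<^sub>F n in sequentially. ub n s \<rho>"
  shows "\<forall>\<^sub>F n in sequentially. lb n s (\<theta> * \<rho> + \<epsilon>)"
proof -
  \<comment> \<open>Half of the least gain in the exponent of \<open>bnd\<close> when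
    \<open>\<theta> * \<rho>\<close> is replaced by \<open>\<theta> * \<rho> + \<epsilon>\<close>,
    attained for \<open>amp\<close> equal to 1. One half pays for the Riemann error, which
    \<open>sum_contract\<close> multiplies by \<open>exp (\<theta> * \<rho>)\<close> (hence \<eta>),
    the other for the distance of \<kappa> from its limit \<open>t\<close>.\<close>
  define \<zeta> where "\<zeta> = exp (\<theta> * \<rho>) * (exp \<epsilon> - 1) / kd / 2"
  have \<zeta>: "0 < \<zeta>" using \<epsilon> m0 by (simp add: \<zeta>_def)
  define \<eta> where "\<eta> = \<zeta> / exp (\<theta> * \<rho>)"
  have \<eta>: "0 < \<eta>" using \<zeta> by (simp add: \<eta>_def)
  \<comment> \<open>\<open>C / n\<close> bounds the quadratic losses of
    \<open>exp_le_one_minus\<close> over a star: at most \<open>n * alpha k\<close> edges with a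
    loss of \<open>2 * (Pmax / n) ^ 2\<close> each.\<close>
  define C where "C = 2 * Pmax\<^sup>2 * alpha k"
  define \<kappa> where "\<kappa> n = sc n * p n * ((1 - p n) ^ (s * k ^ 6) * exp (- (C / real n)))" for n
  have "\<kappa> \<longlonglongrightarrow> t * ((1 - 0) ^ (s * k ^ 6) * exp (- 0))"
    unfolding \<kappa>_def by (intro tendsto_intros scp_lim p_to_0 lim_const_over_n)
  then have "\<kappa> \<longlonglongrightarrow> t" by simp
  moreover have "t * exp (- \<zeta>) < t" using \<zeta> t0 by simp
  ultimately have "\<forall>\<^sub>F n in sequentially. t * exp (- \<zeta>) < \<kappa> n" by (rule order_tendstoD(1))
  moreover have "\<forall>\<^sub>F n in sequentially. Pmax / real n < 1 / 2"
    by (rule order_tendstoD(2)[OF lim_const_over_n]) simp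
  moreover note AP_riemann[OF k3 X_cont X_pos X_le \<eta>] p_pos_ev U[of "s + k"]
  ultimately show ?thesis
  proof eventually_elim
    case (elim n)
    interpret sparse_hypergraph "{1..n}" "p n" "AP k n" k "k ^ 6"
      using AP_sparse k3 elim by blast
    define hi where "hi w = bnd (- \<rho>) (real w / real n) / sc n" for w
    have n: "0 < n" using elim by simp
    show "lb n s (\<theta> * \<rho> + \<epsilon>)"
      unfolding marg_lb_def
    proof (intro allI impI, elim conjE)
      fix S F w
      assume S: "S \<subseteq> {1..n}" "card S \<le> s" "residual S F" "w \<in> {1..n} - S" "{} \<notin> F" "{w} \<notin> F"
      let ?E = "AP_star k n w"
      define P where "P e = lprod n w (bnd (- \<rho>)) e" for e
      define a where "a = amp k t (X (real w / real n))"
      define PS where "PS = (\<Sum>e\<in>?E. P e) / real n"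
      have w: "w \<in> {1..n}" "real w / real n \<in> {0..1}" using S by auto
      have a1: "1 \<le> a" unfolding a_def by (rule amp_X_ge)
      have Eq: "star w = ?E" by (simp add: star_def)
      have P: "0 \<le> P e" "P e \<le> Pmax" "prod hi (e - {w}) = P e / real n" if "e \<in> ?E" for e
        using that prod_bnd_le[of e n w "- \<rho>"] prod_bnd_scaled[of e n w "- \<rho>"] n prod_bnd_small(1)[OF that n elim(2)]
        by (auto simp: P_def hi_def)
      have P2: "P e / real n \<le> 1 / 2" if "e \<in> ?E" for e
        unfolding P_def by (rule prod_bnd_small(2)[OF that n elim(2)])
      have "p n * ((1 - p n) ^ (s * k ^ 6) * (\<Prod>e\<in>star w. 1 - prod hi (e - {w}))) \<le> marg F w"
      proof (rule marg_lower_step[OF _ _ _ S])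
        show "marg_ub (s + k) hi" unfolding hi_def by (rule elim(5))
        show "0 \<le> hi v" for v using bnd_pos sc_pos[OF n] by (simp add: hi_def less_imp_le)
        show "prod hi (e - {w}) \<le> 1" if "e \<in> star w" for e
          using P(3)[of e] P2[of e] that unfolding Eq by linarith
      qed
      moreover have "exp (- PS - C / real n) \<le> (\<Prod>e\<in>star w. 1 - prod hi (e - {w}))"
      proof -
        have "(\<Sum>e\<in>?E. 2 * (P e / real n)\<^sup>2) \<le> (\<Sum>e\<in>?E. 2 * (Pmax / real n)\<^sup>2)"
          using P(1,2) by (intro sum_mono mult_left_mono power_mono divide_right_mono) auto
        also have "\<dots> = real (card ?E) * (2 * (Pmax / real n)\<^sup>2)" by simp
        also have "\<dots> \<le> real n * alpha k * (2 * (Pmax / real n)\<^sup>2)"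
          using card_AP_star[OF k3 w(1)] by (rule mult_right_mono) simp
        also have "\<dots> = C / real n" using n by (simp add: C_def power2_eq_square field_simps)
        finally have q: "(\<Sum>e\<in>?E. 2 * (P e / real n)\<^sup>2) \<le> C / real n" .
        have "exp (- PS - C / real n) \<le> exp (\<Sum>e\<in>?E. - (P e / real n) - 2 * (P e / real n)\<^sup>2)"
          using q by (simp add: PS_def sum_subtractf sum_negf sum_divide_distrib)
        also have "\<dots> = (\<Prod>e\<in>?E. exp (- (P e / real n) - 2 * (P e / real n)\<^sup>2))"
          by (rule exp_sum) (simp add: finite_AP)
        also have "\<dots> \<le> (\<Prod>e\<in>?E. 1 - P e / real n)"
          using P(1) P2 by (intro prod_mono conjI exp_le_one_minus) auto
        finally show ?thesis unfolding Eq using P(3) by simp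
      qed
      ultimately have "p n * ((1 - p n) ^ (s * k ^ 6) * exp (- PS - C / real n)) \<le> marg F w"
        using elim(4) by (meson less_imp_le mult_left_mono order_trans zero_le_power diff_ge_0_iff_ge)
      then have "sc n * (p n * ((1 - p n) ^ (s * k ^ 6) * exp (- PS - C / real n))) \<le> sc n * marg F w"
        using sc_pos[OF n] by (intro mult_left_mono) auto
      moreover have "exp (- PS - C / real n) = exp (- (C / real n)) * exp (- PS)"
        by (simp add: exp_add[symmetric])
      ultimately have 1: "\<kappa> n * exp (- PS) \<le> sc n * marg F w"
        unfolding \<kappa>_def by (simp only: mult.assoc)
      have "(\<Sum>e\<in>?E. lprod n w X e) / real n \<le> (a - 1) / kd + \<eta>"
        using elim(3) w amp_X_Lam[OF w(2)] unfolding a_def by (auto simp: abs_le_iff dest: bspec[of _ _ w])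
      then have "exp (\<theta> * \<rho>) * ((\<Sum>e\<in>?E. lprod n w X e) / real n)
          \<le> exp (\<theta> * \<rho>) * ((a - 1) / kd + \<eta>)" by (intro mult_left_mono) auto
      then have "PS \<le> exp (\<theta> * \<rho>) * ((a - 1) / kd + \<eta>) + (exp (\<theta> * \<rho>) - 1) / kd"
      proof -
        assume *: "exp (\<theta> * \<rho>) * ((\<Sum>e\<in>?E. lprod n w X e) / real n)
          \<le> exp (\<theta> * \<rho>) * ((a - 1) / kd + \<eta>)"
        have "amp k t (X v) \<le> exp \<rho> * amp k t (bnd (- \<rho>) v)" for v
          by (simp add: amp_bnd mult.assoc[symmetric] exp_add[symmetric])
        from sum_contract[where x = X and y = "bnd (- \<rho>)", OF w(1) \<rho> X_pos bnd_pos this] show ?thesis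
          using * unfolding PS_def P_def by linarith
      qed
      also have "\<dots> = (exp (\<theta> * \<rho>) * a - 1) / kd + \<zeta>"
      proof -
        have "E * ((a - 1) / m + \<zeta> / E) + (E - 1) / m = (E * a - 1) / m + \<zeta>" if "0 < E" for E m :: real
          using that by (simp add: algebra_simps diff_divide_distrib add_divide_distrib)
        then show ?thesis unfolding \<eta>_def by simp
      qed
      finally have 2: "PS \<le> (exp (\<theta> * \<rho>) * a - 1) / kd + \<zeta>" .
      have "exp (\<theta> * \<rho>) * (exp \<epsilon> - 1) * 1 \<le> exp (\<theta> * \<rho>) * (exp \<epsilon> - 1) * a"
        using a1 \<epsilon> by (intro mult_left_mono) auto
      then have "2 * \<zeta> \<le> exp (\<theta> * \<rho>) * (exp \<epsilon> - 1) * a / kd"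
      proof -
        have *: "2 * (x / m / 2) \<le> y / m" if "x * 1 \<le> y" "0 < m" for x y m :: real
          using that by (simp add: divide_right_mono)
        show ?thesis unfolding \<zeta>_def by (rule *[OF _ m0(1)]) fact
      qed
      also have "\<dots> = (exp (\<theta> * \<rho> + \<epsilon>) * a - 1) / kd - (exp (\<theta> * \<rho>) * a - 1) / kd"
        by (simp add: exp_add algebra_simps diff_divide_distrib)
      finally have 3: "2 * \<zeta> \<le> (exp (\<theta> * \<rho> + \<epsilon>) * a - 1) / kd - (exp (\<theta> * \<rho>) * a - 1) / kd" .
      have "bnd (\<theta> * \<rho> + \<epsilon>) (real w / real n) \<le> t * exp (- \<zeta> - PS)"
        unfolding bnd_def a_def[symmetric] using 2 3 t0 by (intro mult_left_mono) auto
      also have "\<dots> = t * exp (- \<zeta>) * exp (- PS)" by (simp add: exp_add[symmetric])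
      also have "\<dots> \<le> \<kappa> n * exp (- PS)" using elim(1) by (intro mult_right_mono) auto
      finally have "bnd (\<theta> * \<rho> + \<epsilon>) (real w / real n) \<le> sc n * marg F w" using 1 by linarith
      then show "bnd (\<theta> * \<rho> + \<epsilon>) (real w / real n) / sc n \<le> marg F w"
        using sc_pos[OF n] by (simp add: field_simps)
    qed
  qed
qed

text \<open>Here \<open>1 - x \<le> exp (- x)\<close> loses nothing; the losses are the factor
  \<open>1 / (1 - p n)\<close> and the blocked edges, boundedly many terms of size at most
  \<open>Pmax / n\<close>. Both disappear in the limit of \<kappa>.\<close>

lemma upper_from_lower:
  assumes \<rho>: "0 \<le> \<rho>" and \<epsilon>: "0 < \<epsilon>" and L: "\<And>s. \<forall>\<^sub>F n in sequentially. lb n s \<rho>"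
  shows "\<forall>\<^sub>F n in sequentially. ub n s (\<theta> * \<rho> + \<epsilon>)"
proof -
  define \<zeta> where "\<zeta> = exp (- (\<theta> * \<rho>)) * (1 - exp (- \<epsilon>)) / kd / 2"
  have \<zeta>: "0 < \<zeta>" using \<epsilon> m0 by (simp add: \<zeta>_def)
  \<comment> \<open>\<open>blocked_bound s\<close> for the constant \<open>k ^ 6\<close>, spelled
    out because it has to be fixed before the hypergraph of a particular \<open>n\<close> is
    available.\<close>
  define bb where "bb = s * k ^ 6 + (((s + 1) * (s + 1) * k ^ 6) * (k * k ^ 6) + s * k ^ 6)"
  define C where "C = Pmax * real bb"
  define \<kappa> where "\<kappa> n = sc n * p n / (1 - p n) * exp (C / real n)" for n
  have "\<kappa> \<longlonglongrightarrow> t / (1 - 0) * exp 0"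
    unfolding \<kappa>_def by (intro tendsto_intros scp_lim p_to_0 lim_const_over_n) auto
  then have "\<kappa> \<longlonglongrightarrow> t" by simp
  moreover have "t < t * exp \<zeta>" using \<zeta> t0 by simp
  ultimately have "\<forall>\<^sub>F n in sequentially. \<kappa> n < t * exp \<zeta>" by (rule order_tendstoD(2))
  moreover have "\<forall>\<^sub>F n in sequentially. Pmax / real n < 1 / 2"
    by (rule order_tendstoD(2)[OF lim_const_over_n]) simp
  moreover note AP_riemann[OF k3 X_cont X_pos X_le \<zeta>] p_pos_ev L[of "s + k"]
  ultimately show ?thesis
  proof eventually_elim
    case (elim n)
    interpret sparse_hypergraph "{1..n}" "p n" "AP k n" k "k ^ 6"
      using AP_sparse k3 elim by blast
    define lo where "lo w = bnd \<rho> (real w / real n) / sc n" for w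
    have n: "0 < n" using elim by simp
    have bb: "blocked_bound s = bb" unfolding blocked_bound_def bb_def ..
    show "ub n s (\<theta> * \<rho> + \<epsilon>)"
      unfolding marg_ub_def
    proof (intro allI impI, elim conjE)
      fix S F w
      assume S: "S \<subseteq> {1..n}" "card S \<le> s" "residual S F" "w \<in> {1..n} - S"
      let ?E = "AP_star k n w"
      define P where "P e = lprod n w (bnd \<rho>) e" for e
      define a where "a = amp k t (X (real w / real n))"
      define PS where "PS = (\<Sum>e\<in>?E. P e) / real n"
      have w: "w \<in> {1..n}" "real w / real n \<in> {0..1}" using S by auto
      have a1: "1 \<le> a" unfolding a_def by (rule amp_X_ge)
      have Eq: "star w = ?E" by (simp add: star_def)
      have finE: "finite ?E" by (simp add: finite_AP)
      have P: "0 \<le> P e" "P e \<le> Pmax" "prod lo (e - {w}) = P e / real n" if "e \<in> ?E" for e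
        using that prod_bnd_le[of e n w \<rho>] prod_bnd_scaled[of e n w \<rho>] n prod_bnd_small(1)[OF that n elim(2)]
        by (auto simp: P_def lo_def)
      have P2: "P e / real n \<le> 1 / 2" if "e \<in> ?E" for e
        unfolding P_def by (rule prod_bnd_small(2)[OF that n elim(2)])
      have "\<exists>B\<subseteq>star w. card B \<le> blocked_bound s \<and>
          marg F w \<le> p n / (1 - p n) * (\<Prod>e\<in>star w - B. 1 - prod lo (e - {w}))"
      proof (rule marg_upper_step[OF _ _ _ S])
        show "marg_lb (s + k) lo" unfolding lo_def by (rule elim(5))
        show "0 \<le> lo v" for v using bnd_pos sc_pos[OF n] by (simp add: lo_def less_imp_le)
        show "prod lo (e - {w}) \<le> 1" if "e \<in> star w" for e
          using P(3)[of e] P2[of e] that unfolding Eq by linarith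
      qed
      then obtain B where B: "B \<subseteq> ?E" "card B \<le> bb"
        "marg F w \<le> p n / (1 - p n) * (\<Prod>e\<in>?E - B. 1 - prod lo (e - {w}))" unfolding Eq bb by blast
      have "(\<Prod>e\<in>?E - B. 1 - prod lo (e - {w})) \<le> (\<Prod>e\<in>?E - B. exp (- (P e / real n)))"
      proof (rule prod_mono)
        fix e assume "e \<in> ?E - B"
        then have e: "e \<in> ?E" by (rule DiffD1)
        show "0 \<le> 1 - prod lo (e - {w}) \<and> 1 - prod lo (e - {w}) \<le> exp (- (P e / real n))"
          using P2[OF e] P(3)[OF e] exp_ge_add_one_self[of "- (P e / real n)"] by linarith
      qed
      also have "\<dots> = exp (- ((\<Sum>e\<in>?E - B. P e) / real n))"
        using finE by (simp add: exp_sum[symmetric] sum_negf sum_divide_distrib)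
      also have "\<dots> \<le> exp (- PS + C / real n)"
      proof -
        have "(\<Sum>e\<in>B. P e) \<le> real (card B) * Pmax" using B(1) P(2) by (intro sum_bounded_above) auto
        also have "\<dots> \<le> C" using B(2) Pmax_pos by (simp add: C_def)
        finally have "(\<Sum>e\<in>?E. P e) \<le> (\<Sum>e\<in>?E - B. P e) + C"
          using sum.subset_diff[OF B(1) finE, of P] by linarith
        then have "PS \<le> ((\<Sum>e\<in>?E - B. P e) + C) / real n" unfolding PS_def by (intro divide_right_mono) auto
        then show ?thesis by (simp add: add_divide_distrib)
      qed
      finally have pr: "(\<Prod>e\<in>?E - B. 1 - prod lo (e - {w})) \<le> exp (- PS + C / real n)" .
      have "marg F w \<le> p n / (1 - p n) * exp (- PS + C / real n)"
        using B(3) pr elim(4) by (meson divide_nonneg_nonneg less_imp_le mult_left_mono order_trans diff_ge_0_iff_ge)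
      then have "sc n * marg F w \<le> sc n * (p n / (1 - p n) * exp (- PS + C / real n))"
        using sc_pos[OF n] by (intro mult_left_mono) auto
      also have "\<dots> = \<kappa> n * exp (- PS)" unfolding \<kappa>_def exp_add by simp
      finally have 1: "sc n * marg F w \<le> \<kappa> n * exp (- PS)" .
      have "(a - 1) / kd - \<zeta> \<le> (\<Sum>e\<in>?E. lprod n w X e) / real n"
        using elim(3) w amp_X_Lam[OF w(2)] unfolding a_def by (auto simp: abs_le_iff dest: bspec[of _ _ w])
      then have "(a - 1) / kd - \<zeta> \<le> exp (\<theta> * \<rho>) * PS + (exp (\<theta> * \<rho>) - 1) / kd"
      proof -
        assume *: "(a - 1) / kd - \<zeta> \<le> (\<Sum>e\<in>?E. lprod n w X e) / real n"
        have "amp k t (bnd \<rho> v) \<le> exp \<rho> * amp k t (X v)" for v by (simp add: amp_bnd)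
        from sum_contract[where x = "bnd \<rho>" and y = X, OF w(1) \<rho> bnd_pos X_pos this] show ?thesis using * unfolding PS_def P_def by linarith
      qed
      then have "a / kd - \<zeta> \<le> exp (\<theta> * \<rho>) * (PS + 1 / kd)"
        by (simp add: algebra_simps diff_divide_distrib)
      then have "exp (- (\<theta> * \<rho>)) * (a / kd - \<zeta>) \<le>
          exp (- (\<theta> * \<rho>)) * (exp (\<theta> * \<rho>) * (PS + 1 / kd))"
        by (intro mult_left_mono) auto
      also have "\<dots> = PS + 1 / kd"
        by (simp add: mult.assoc[symmetric] exp_add[symmetric])
      finally have "exp (- (\<theta> * \<rho>)) * (a / kd) - exp (- (\<theta> * \<rho>)) * \<zeta> - 1 / kd \<le> PS"
        by (simp add: algebra_simps)
      moreover have "exp (- (\<theta> * \<rho>)) * \<zeta> \<le> 1 * \<zeta>" using \<zeta> th \<rho> by (intro mult_right_mono) auto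
      ultimately have 2: "(exp (- (\<theta> * \<rho>)) * a - 1) / kd - \<zeta> \<le> PS"
        by (simp add: diff_divide_distrib)
      have "exp (- (\<theta> * \<rho>)) * (1 - exp (- \<epsilon>)) * 1 \<le> exp (- (\<theta> * \<rho>)) * (1 - exp (- \<epsilon>)) * a"
        using a1 \<epsilon> by (intro mult_left_mono) auto
      then have "2 * \<zeta> \<le> exp (- (\<theta> * \<rho>)) * (1 - exp (- \<epsilon>)) * a / kd"
      proof -
        have *: "2 * (x / m / 2) \<le> y / m" if "x * 1 \<le> y" "0 < m" for x y m :: real
          using that by (simp add: divide_right_mono)
        show ?thesis unfolding \<zeta>_def by (rule *[OF _ m0(1)]) fact
      qed
      also have "\<dots> = (exp (- (\<theta> * \<rho>)) * a - 1) / kd - (exp (- (\<theta> * \<rho>)) * exp (- \<epsilon>) * a - 1) / kd"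
        by (simp add: diff_divide_distrib[symmetric] algebra_simps)
      also have "exp (- (\<theta> * \<rho>)) * exp (- \<epsilon>) = exp (- (\<theta> * \<rho> + \<epsilon>))" by (simp add: exp_add[symmetric])
      finally have 3: "2 * \<zeta> \<le> (exp (- (\<theta> * \<rho>)) * a - 1) / kd - (exp (- (\<theta> * \<rho> + \<epsilon>)) * a - 1) / kd" .
      have "sc n * marg F w \<le> t * exp \<zeta> * exp (- PS)"
        using 1 elim(1) by (meson exp_ge_zero less_imp_le mult_right_mono order_trans)
      also have "\<dots> = t * exp (\<zeta> - PS)" by (simp add: exp_add[symmetric])
      also have "\<dots> \<le> bnd (- (\<theta> * \<rho> + \<epsilon>)) (real w / real n)"
        unfolding bnd_def a_def[symmetric] using 2 3 t0 by (intro mult_left_mono) auto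
      finally show "marg F w \<le> bnd (- (\<theta> * \<rho> + \<epsilon>)) (real w / real n) / sc n"
        using sc_pos[OF n] by (simp add: field_simps)
    qed
  qed
qed

text \<open>Rests on \<open>marg_le_p\<close> alone. The factor 2 pushes the \<open>amp\<close> of
  the bound down to at most 1/2, so the bound exceeds \<open>t\<close> by at least the fixed factor
  \<open>exp (1 / (2 * kd))\<close>, which absorbs the error in \<open>sc n * p n\<close>.\<close>

lemma upper_base: "\<forall>\<^sub>F n in sequentially. ub n s (ln (2 * ampmax))"
proof -
  have "t < t * exp (1 / (2 * kd))" using t0 m0 by simp
  then have "\<forall>\<^sub>F n in sequentially. sc n * p n < t * exp (1 / (2 * kd))"
    by (rule order_tendstoD(2)[OF scp_lim])
  with p_pos_ev show ?thesis
  proof eventually_elim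
    case (elim n)
    interpret sparse_hypergraph "{1..n}" "p n" "AP k n" k "k ^ 6"
      using AP_sparse k3 elim by blast
    have n: "0 < n" using elim by simp
    show "ub n s (ln (2 * ampmax))"
      unfolding marg_ub_def
    proof (intro allI impI, elim conjE)
      fix S F w
      assume w: "w \<in> {1..n} - S"
      have u: "real w / real n \<in> {0..1}" using w by auto
      have e: "exp (- ln (2 * ampmax)) = 1 / (2 * ampmax)" using ampmax_ge by (simp add: exp_minus inverse_eq_divide)
      have half: "exp (- ln (2 * ampmax)) * amp k t (X (real w / real n)) \<le> 1 / 2"
        unfolding e using amp_X_le[OF u] ampmax_ge by (simp add: field_simps)
      have "1 / (2 * kd) \<le> - ((exp (- ln (2 * ampmax)) * amp k t (X (real w / real n)) - 1) / kd)"
      proof -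
        have *: "1 / (2 * m) \<le> - ((y - 1) / m)" if "y \<le> 1 / 2" "0 < m" for y m :: real
          using that by (simp add: field_simps)
        show ?thesis by (rule *[OF half m0(1)])
      qed
      then have "t * exp (1 / (2 * kd)) \<le> bnd (- ln (2 * ampmax)) (real w / real n)"
        unfolding bnd_def using t0 by (intro mult_left_mono) auto
      then have "sc n * p n \<le> bnd (- ln (2 * ampmax)) (real w / real n)" using elim by linarith
      then have "p n \<le> bnd (- ln (2 * ampmax)) (real w / real n) / sc n"
        using sc_pos[OF n] by (simp add: field_simps)
      moreover have "marg F w \<le> p n" using w by (intro marg_le_p) auto
      ultimately show "marg F w \<le> bnd (- ln (2 * ampmax)) (real w / real n) / sc n" by linarith
    qed
  qed
qed

text \<open>\<open>q\<close> lies strictly between \<theta> and 1, and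
  \<open>(q - \<theta>) * \<rho>\<close> is the room given to the vanishing error of a pass. All
  \<open>s\<close> are carried along because a pass at \<open>s\<close> uses the previous one at
  \<open>s + k\<close>.\<close>

lemma sandwich_iter:
  defines "q \<equiv> (1 + \<theta>) / 2"
  shows "(\<forall>s. \<forall>\<^sub>F n in sequentially. ub n s (q ^ (2 * r) * ln (2 * ampmax))) \<and>
    (\<forall>s. \<forall>\<^sub>F n in sequentially. lb n s (q ^ (2 * r + 1) * ln (2 * ampmax)))"
proof -
  have q: "0 < q" "q < 1" "\<theta> < q" using th by (auto simp: q_def)
  have l0: "0 < ln (2 * ampmax)" using ampmax_ge by simp
  have UL: "\<forall>\<^sub>F n in sequentially. lb n s (q * \<rho>)" if "0 < \<rho>" "\<And>s. \<forall>\<^sub>F n in sequentially. ub n s \<rho>" for s \<rho>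
    using lower_from_upper[of \<rho> "(q - \<theta>) * \<rho>" s] that q by (simp add: algebra_simps)
  have LU: "\<forall>\<^sub>F n in sequentially. ub n s (q * \<rho>)" if "0 < \<rho>" "\<And>s. \<forall>\<^sub>F n in sequentially. lb n s \<rho>" for s \<rho>
    using upper_from_lower[of \<rho> "(q - \<theta>) * \<rho>" s] that q by (simp add: algebra_simps)
  have step: "\<forall>\<^sub>F n in sequentially. lb n s (q ^ (2 * r + 1) * ln (2 * ampmax))"
    if U: "\<And>s. \<forall>\<^sub>F n in sequentially. ub n s (q ^ (2 * r) * ln (2 * ampmax))" for r s
    using UL[OF _ U, of s] q l0 by (simp add: mult.assoc)
  show ?thesis
  proof (induction r)
    case 0
    then show ?case using upper_base step[of 0] by simp
  next
    case (Suc r)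
    have U: "\<forall>\<^sub>F n in sequentially. ub n s (q ^ (2 * Suc r) * ln (2 * ampmax))" for s
      using LU[of "q ^ (2 * r + 1) * ln (2 * ampmax)" s] Suc q l0 by (simp add: mult.assoc)
    then show ?case using step[of "Suc r"] by blast
  qed
qed

lemma abs_exp_diff_le:
  fixes x y :: real
  assumes "0 \<le> x" "0 \<le> y"
  shows "\<bar>exp (- x) - exp (- y)\<bar> \<le> \<bar>x - y\<bar>"
proof -
  have *: "exp (- x) - exp (- y) \<le> y - x" if "0 \<le> x" "x \<le> y" for x y :: real
  proof -
    have "1 - exp (- (y - x)) \<le> y - x" using exp_ge_add_one_self[of "- (y - x)"] by linarith
    moreover have "0 \<le> 1 - exp (- (y - x))" using that by simp
    ultimately have "exp (- x) * (1 - exp (- (y - x))) \<le> 1 * (y - x)"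
      using that by (intro mult_mono) auto
    moreover have "exp (- x) * (1 - exp (- (y - x))) = exp (- x) - exp (- y)"
      by (simp add: right_diff_distrib exp_add[symmetric])
    ultimately show ?thesis by simp
  qed
  show ?thesis
  proof (cases "x \<le> y")
    case True
    then have "exp (- y) \<le> exp (- x)" by simp
    then show ?thesis using *[OF assms(1) True] True by simp
  next
    case False
    then have "exp (- x) \<le> exp (- y)" by simp
    then show ?thesis using *[OF assms(2), of x] False by simp
  qed
qed

lemma bnd_close:
  assumes "u \<in> {0..1}"
  shows "\<bar>bnd \<rho> u - X u\<bar> \<le> t * exp (1 / kd) * ampmax / kd * \<bar>exp \<rho> - 1\<bar>"
proof -
  define a where "a = amp k t (X u)"
  have a: "1 \<le> a" "a \<le> ampmax" using amp_X_ge amp_X_le[OF assms] by (auto simp: a_def)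
  have X: "X u = bnd 0 u"
  proof (rule amp_inject[OF X_pos bnd_pos])
    show "amp k t (X u) = amp k t (bnd 0 u)" by (simp add: amp_bnd)
  qed
  have b: "bnd \<rho> u = t * exp (1 / kd) * exp (- (exp \<rho> * a / kd))" for \<rho>
    unfolding bnd_def a_def[symmetric] by (simp add: exp_add[symmetric] diff_divide_distrib)
  have "\<bar>bnd \<rho> u - X u\<bar> = t * exp (1 / kd) * \<bar>exp (- (exp \<rho> * a / kd)) - exp (- (exp 0 * a / kd))\<bar>"
    unfolding X b using t0 by (simp add: right_diff_distrib[symmetric] abs_mult)
  also have "\<dots> \<le> t * exp (1 / kd) * \<bar>exp \<rho> * a / kd - exp 0 * a / kd\<bar>"
    using t0 a m0 by (intro mult_left_mono abs_exp_diff_le) auto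
  also have "\<bar>exp \<rho> * a / kd - exp 0 * a / kd\<bar> = \<bar>exp \<rho> - 1\<bar> * (a / kd)"
  proof -
    have "exp \<rho> * a / kd - exp 0 * a / kd = (exp \<rho> - 1) * (a / kd)"
      by (simp add: left_diff_distrib diff_divide_distrib)
    then show ?thesis using a m0 by (simp add: abs_mult)
  qed
  also have "t * exp (1 / kd) * (\<bar>exp \<rho> - 1\<bar> * (a / kd)) \<le>
      t * exp (1 / kd) * (\<bar>exp \<rho> - 1\<bar> * (ampmax / kd))"
    using t0 a m0 by (intro mult_left_mono divide_right_mono) auto
  finally show ?thesis by (simp add: mult_ac)
qed

text \<open>The number of passes \<open>r\<close> is chosen from \<delta> before \<open>n\<close>
  grows, so only finitely many eventual bounds are combined. The full set of progressions is
  residual with nothing exposed, which is the case \<open>s = 0\<close>.\<close>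

lemma marg_AP_limit:
  assumes "0 < \<delta>"
  shows "\<forall>\<^sub>F n in sequentially. \<forall>w\<in>{1..n}.
    \<bar>sc n * binomial_subset.marg {1..n} (p n) (AP k n) w - X (real w / real n)\<bar> \<le> \<delta>"
proof -
  define q where "q = (1 + \<theta>) / 2"
  have q: "0 < q" "q < 1" using th by (auto simp: q_def)
  define l where "l = ln (2 * ampmax)"
  define C where "C = t * exp (1 / kd) * ampmax / kd"
  have qr: "(\<lambda>r. q ^ (2 * r)) \<longlonglongrightarrow> 0"
    unfolding power_mult using q by (intro LIMSEQ_power_zero) (simp add: power_less_one_iff abs_square_less_1)
  have "(\<lambda>r. C * \<bar>exp (- (q ^ (2 * r) * l)) - 1\<bar>) \<longlonglongrightarrow> C * \<bar>exp (- (0 * l)) - 1\<bar>"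
    by (intro tendsto_intros qr)
  then have "\<forall>\<^sub>F r in sequentially. C * \<bar>exp (- (q ^ (2 * r) * l)) - 1\<bar> < \<delta>"
    using assms by (intro order_tendstoD(2)) auto
  moreover have "(\<lambda>r. C * \<bar>exp (q * q ^ (2 * r) * l) - 1\<bar>) \<longlonglongrightarrow> C * \<bar>exp (q * 0 * l) - 1\<bar>"
    by (intro tendsto_intros qr)
  then have "\<forall>\<^sub>F r in sequentially. C * \<bar>exp (q * q ^ (2 * r) * l) - 1\<bar> < \<delta>"
    using assms by (intro order_tendstoD(2)) auto
  ultimately have "\<forall>\<^sub>F r in sequentially. C * \<bar>exp (- (q ^ (2 * r) * l)) - 1\<bar> < \<delta> \<and> C * \<bar>exp (q * q ^ (2 * r) * l) - 1\<bar> < \<delta>"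
    by (rule eventually_conj)
  then obtain r where r: "C * \<bar>exp (- (q ^ (2 * r) * l)) - 1\<bar> < \<delta>" "C * \<bar>exp (q ^ (2 * r + 1) * l) - 1\<bar> < \<delta>"
    unfolding eventually_sequentially by auto
  have "\<forall>\<^sub>F n in sequentially. ub n 0 (q ^ (2 * r) * l)" "\<forall>\<^sub>F n in sequentially. lb n 0 (q ^ (2 * r + 1) * l)"
    using sandwich_iter[of r] unfolding q_def l_def by blast+
  with p_pos_ev show ?thesis
  proof eventually_elim
    case (elim n)
    interpret sparse_hypergraph "{1..n}" "p n" "AP k n" k "k ^ 6"
      using AP_sparse k3 elim by blast
    have n: "0 < n" using elim by simp
    have res: "residual {} (AP k n)" by (auto simp: residual_def)
    have ne: "{} \<notin> AP k n" "{w} \<notin> AP k n" for w using AP_card[of _ k n] k3 by force+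
    show ?case
    proof
      fix w assume w: "w \<in> {1..n}"
      have u: "real w / real n \<in> {0..1}" using w by auto
      have "marg (AP k n) w \<le> bnd (- (q ^ (2 * r) * l)) (real w / real n) / sc n"
        using elim(2) res w unfolding marg_ub_def by (metis Diff_empty card.empty empty_subsetI order_refl)
      then have "sc n * marg (AP k n) w \<le> bnd (- (q ^ (2 * r) * l)) (real w / real n)"
        using sc_pos[OF n] by (simp add: field_simps)
      moreover have "bnd (q ^ (2 * r + 1) * l) (real w / real n) / sc n \<le> marg (AP k n) w"
        using elim(3) res w ne unfolding marg_lb_def by (metis Diff_empty card.empty empty_subsetI order_refl)
      then have "bnd (q ^ (2 * r + 1) * l) (real w / real n) \<le> sc n * marg (AP k n) w"
        using sc_pos[OF n] by (simp add: field_simps)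
      moreover have "\<bar>bnd (- (q ^ (2 * r) * l)) (real w / real n) - X (real w / real n)\<bar> \<le> \<delta>"
        using bnd_close[OF u, of "- (q ^ (2 * r) * l)"] r(1) unfolding C_def by linarith
      moreover have "\<bar>bnd (q ^ (2 * r + 1) * l) (real w / real n) - X (real w / real n)\<bar> \<le> \<delta>"
        using bnd_close[OF u, of "q ^ (2 * r + 1) * l"] r(2) unfolding C_def by linarith
      ultimately show "\<bar>sc n * marg (AP k n) w - X (real w / real n)\<bar> \<le> \<delta>" by linarith
    qed
  qed
qed

end

section \<open>The logarithmic limit\<close>

lemma avoids_AP_iff:
  assumes "I \<subseteq> {1..n}"
  shows "num_kAP k I = 0 \<longleftrightarrow> avoids (AP k n) I"
proof -
  have "finite I" by (rule finite_subset[OF assms]) simp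
  then have "finite {A. is_kAP k A \<and> A \<subseteq> I}" by - (rule finite_subset[of _ "Pow I"], auto)
  then have "num_kAP k I = 0 \<longleftrightarrow> {A. is_kAP k A \<and> A \<subseteq> I} = {}" by (simp add: num_kAP_def)
  also have "\<dots> \<longleftrightarrow> avoids (AP k n) I" using assms by (auto simp: avoids_def AP_def)
  finally show ?thesis .
qed

lemma rprob_cong:
  assumes "\<And>I. I \<subseteq> V \<Longrightarrow> A I = B I"
  shows "rprob V p A = rprob V p B"
  unfolding rprob_def using assms by (intro sum.cong) auto

text \<open>The link to the random subset. \<open>rprob\<close> is an explicit polynomial in
  \<open>p\<close>, which gives differentiability and measurability in \<open>p\<close>
  directly.\<close>

lemma prob_rand_subset:
  assumes "0 \<le> p" "p \<le> 1"
  shows "measure_pmf.prob (rand_subset n p) {S. A {j. S j}} = rprob {1..n} p A"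
proof -
  let ?V = "{1..n}"
  let ?f = "\<lambda>I (j::nat). j \<in> I"
  have inj: "inj_on ?f B" for B by (auto simp: inj_on_def fun_eq_iff)
  have pm: "pmf (rand_subset n p) (?f I) = p ^ card I * (1 - p) ^ card (?V - I)" if "I \<subseteq> ?V" for I
  proof -
    have "pmf (rand_subset n p) (?f I) = (\<Prod>j\<in>?V. pmf (bernoulli_pmf p) (j \<in> I))"
      unfolding rand_subset_def using that by (intro pmf_Pi') auto
    also have "\<dots> = (\<Prod>j\<in>I. pmf (bernoulli_pmf p) (j \<in> I)) * (\<Prod>j\<in>?V - I. pmf (bernoulli_pmf p) (j \<in> I))"
      using that by (subst prod.subset_diff[OF that]) (auto simp: mult.commute)
    also have "(\<Prod>j\<in>I. pmf (bernoulli_pmf p) (j \<in> I)) = (\<Prod>j\<in>I. p)" using assms by (intro prod.cong) auto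
    also have "(\<Prod>j\<in>?V - I. pmf (bernoulli_pmf p) (j \<in> I)) = (\<Prod>j\<in>?V - I. 1 - p)" using assms by (intro prod.cong) auto
    finally show ?thesis by simp
  qed
  have "{S. A {j. S j}} \<inter> set_pmf (rand_subset n p) \<subseteq> ?f ` {I\<in>Pow ?V. A I}"
  proof
    fix S assume S: "S \<in> {S. A {j. S j}} \<inter> set_pmf (rand_subset n p)"
    then have "\<forall>x. x \<notin> ?V \<longrightarrow> S x = False"
      unfolding rand_subset_def using set_Pi_pmf_subset[of ?V False "\<lambda>_. bernoulli_pmf p"] by auto
    then have "{j. S j} \<in> {I\<in>Pow ?V. A I}" using S by auto
    moreover have "S = ?f {j. S j}" by simp
    ultimately show "S \<in> ?f ` {I\<in>Pow ?V. A I}" by blast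
  qed
  then have "{S. A {j. S j}} \<inter> set_pmf (rand_subset n p) = ?f ` {I\<in>Pow ?V. A I} \<inter> set_pmf (rand_subset n p)"
    by auto
  then have "measure_pmf.prob (rand_subset n p) {S. A {j. S j}} = measure_pmf.prob (rand_subset n p) (?f ` {I\<in>Pow ?V. A I})"
    by (metis measure_Int_set_pmf)
  also have "\<dots> = sum (pmf (rand_subset n p)) (?f ` {I\<in>Pow ?V. A I})"
    by (rule measure_measure_pmf_finite) simp
  also have "\<dots> = (\<Sum>I\<in>{I\<in>Pow ?V. A I}. p ^ card I * (1 - p) ^ card (?V - I))"
    using pm by (subst sum.reindex[OF inj]) (auto intro!: sum.cong)
  also have "\<dots> = rprob ?V p A"
    unfolding rprob_def by (rule sum.mono_neutral_cong_left) auto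
  finally show ?thesis .
qed

lemma rprob_0:
  assumes "finite V" "A {}"
  shows "rprob V 0 A = 1"
proof -
  have "rprob V 0 A = (\<Sum>I\<in>{{}}. of_bool (A I) * (0 ^ card I * (1 - 0) ^ card (V - I)))"
    unfolding rprob_def
  proof (rule sum.mono_neutral_right)
    show "\<forall>I\<in>Pow V - {{}}. of_bool (A I) * (0 ^ card I * (1 - 0) ^ card (V - I)) = (0::real)"
    proof
      fix I assume I: "I \<in> Pow V - {{}}"
      then have "finite I" using assms(1) finite_subset by auto
      then have "card I \<noteq> 0" using I by auto
      then show "of_bool (A I) * (0 ^ card I * (1 - 0) ^ card (V - I)) = (0::real)" by simp
    qed
  qed (use assms in auto)
  then show ?thesis using assms by simp
qed

text \<open>The weight of \<open>I\<close> has logarithmic derivative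
  \<open>(card I - card V * q) / (q * (1 - q))\<close>; counting \<open>card I\<close> point by
  point turns the sum into the probabilities of \<open>j \<in> I\<close>.\<close>

lemma rprob_deriv:
  assumes V: "finite V" and q: "0 < q" "q < 1"
  shows "((\<lambda>q. rprob V q A) has_real_derivative
    ((\<Sum>j\<in>V. rprob V q (\<lambda>I. j \<in> I \<and> A I)) - real (card V) * q * rprob V q A) / (q * (1 - q))) (at q)"
proof -
  let ?w = "\<lambda>q I. q ^ card I * (1 - q) ^ card (V - I)"
  have pw: "real a * x ^ (a - 1) = real a * x ^ a / x" if "x \<noteq> 0" for a and x :: real
    using that by (cases a) auto
  have d: "((\<lambda>q. ?w q I) has_real_derivative ?w q I * (real (card I) - real (card V) * q) / (q * (1 - q))) (at q)"
    if I: "I \<subseteq> V" for I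
  proof -
    have c: "real (card (V - I)) = real (card V) - real (card I)"
      using I V by (simp add: card_Diff_subset finite_subset card_mono of_nat_diff)
    have "((\<lambda>q. ?w q I) has_real_derivative
        (real (card I) * q ^ (card I - 1)) * (1 - q) ^ card (V - I) -
        q ^ card I * (real (card (V - I)) * (1 - q) ^ (card (V - I) - 1))) (at q)"
      by (auto intro!: derivative_eq_intros simp: algebra_simps)
    moreover have "(real (card I) * q ^ (card I - 1)) * (1 - q) ^ card (V - I) -
        q ^ card I * (real (card (V - I)) * (1 - q) ^ (card (V - I) - 1)) =
        ?w q I * (real (card I) - real (card V) * q) / (q * (1 - q))"
    proof -
      have "a * x / q * y - x * (b * y / r) = x * y * (a * r - b * q) / (q * r)" if "q \<noteq> 0" "r \<noteq> 0" for a b x y q r :: real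
        using that by (simp add: field_simps)
      from this[of q "1 - q" "real (card I)" "q ^ card I" "(1 - q) ^ card (V - I)" "real (card (V - I))"]
      have "real (card I) * q ^ card I / q * (1 - q) ^ card (V - I) -
        q ^ card I * (real (card (V - I)) * (1 - q) ^ card (V - I) / (1 - q)) =
        ?w q I * (real (card I) * (1 - q) - real (card (V - I)) * q) / (q * (1 - q))" using q by simp
      moreover have "real (card I) * (1 - q) - real (card (V - I)) * q = real (card I) - real (card V) * q"
        unfolding c by (simp add: algebra_simps)
      moreover have "real (card I) * q ^ (card I - 1) = real (card I) * q ^ card I / q"
        "real (card (V - I)) * (1 - q) ^ (card (V - I) - 1) = real (card (V - I)) * (1 - q) ^ card (V - I) / (1 - q)"
        using q by (intro pw; simp)+
      ultimately show ?thesis by (simp only:)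
    qed
    ultimately show ?thesis by simp
  qed
  have "((\<lambda>q. rprob V q A) has_real_derivative
      (\<Sum>I\<in>Pow V. of_bool (A I) * (?w q I * (real (card I) - real (card V) * q) / (q * (1 - q))))) (at q)"
    unfolding rprob_def by (intro DERIV_sum DERIV_cmult d) auto
  moreover have "(\<Sum>I\<in>Pow V. of_bool (A I) * (?w q I * (real (card I) - real (card V) * q) / (q * (1 - q)))) =
     ((\<Sum>j\<in>V. rprob V q (\<lambda>I. j \<in> I \<and> A I)) - real (card V) * q * rprob V q A) / (q * (1 - q))"
  proof -
    have "(\<Sum>j\<in>V. rprob V q (\<lambda>I. j \<in> I \<and> A I)) = (\<Sum>I\<in>Pow V. \<Sum>j\<in>V. of_bool (j \<in> I \<and> A I) * ?w q I)"
      unfolding rprob_def by (rule sum.swap)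
    also have "\<dots> = (\<Sum>I\<in>Pow V. of_bool (A I) * ?w q I * real (card I))"
    proof (rule sum.cong[OF refl])
      fix I assume "I \<in> Pow V"
      then have I: "V \<inter> I = I" by auto
      have "(\<Sum>j\<in>V. of_bool (j \<in> I \<and> A I) * ?w q I) = (\<Sum>j\<in>V. of_bool (j \<in> I)) * (of_bool (A I) * ?w q I)"
        unfolding sum_distrib_right by (intro sum.cong refl) auto
      also have "(\<Sum>j\<in>V. of_bool (j \<in> I) :: real) = real (card I)"
        using V I by (simp add: Collect_conj_eq)
      finally show "(\<Sum>j\<in>V. of_bool (j \<in> I \<and> A I) * ?w q I) = of_bool (A I) * ?w q I * real (card I)" by simp
    qed
    finally have s: "(\<Sum>j\<in>V. rprob V q (\<lambda>I. j \<in> I \<and> A I)) = (\<Sum>I\<in>Pow V. of_bool (A I) * ?w q I * real (card I))" .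
    show ?thesis unfolding s unfolding rprob_def sum_distrib_left sum_subtractf[symmetric] sum_divide_distrib
      by (intro sum.cong refl) (simp add: algebra_simps)
  qed
  ultimately show ?thesis by simp
qed

section \<open>The logarithm of the avoidance probability as an integral\<close>

definition av :: "nat \<Rightarrow> nat \<Rightarrow> real \<Rightarrow> real" where
  "av k n q = rprob {1..n} q (avoids (AP k n))"

text \<open>\<open>marg\<close> for the progressions, stated outside the locale so that it is a
  total function of \<open>q\<close> that can be measured and integrated.\<close>

definition mg :: "nat \<Rightarrow> nat \<Rightarrow> real \<Rightarrow> nat \<Rightarrow> real" where
  "mg k n q j = rprob {1..n} q (\<lambda>I. j \<in> I \<and> avoids (AP k n) I) / av k n q"

definition psc :: "nat \<Rightarrow> nat \<Rightarrow> real" where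
  "psc k n = real n powr (1 / (real k - 1))"

text \<open>For \<open>0 < \<tau> < psc k n\<close> this is the derivative in \<tau> of
  \<open>psc k n / n * ln (av k n (\<tau> / psc k n))\<close>. The rescaled variable lets all
  \<open>n\<close> share essentially the same range of integration.\<close>

definition dens :: "nat \<Rightarrow> nat \<Rightarrow> real \<Rightarrow> real" where
  "dens k n \<tau> = ((\<Sum>j=1..n. psc k n * mg k n (\<tau> / psc k n) j) / \<tau> / real n - 1) / (1 - \<tau> / psc k n)"

lemma avoids_AP_empty: "3 \<le> k \<Longrightarrow> avoids (AP k n) {}"
  unfolding avoids_def using AP_card[of _ k n] by force

lemma av_pos: "3 \<le> k \<Longrightarrow> 0 \<le> q \<Longrightarrow> q < 1 \<Longrightarrow> 0 < av k n q"
  unfolding av_def by (intro rprob_pos avoids_AP_empty) auto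

lemma psc_pos: "0 < n \<Longrightarrow> 0 < psc k n"
  by (simp add: psc_def)

lemma mg_eq_marg:
  assumes "0 < q" "q < 1" "j \<in> {1..n}"
  shows "mg k n q j = binomial_subset.marg {1..n} q (AP k n) j"
proof -
  interpret binomial_subset "{1..n}" q by unfold_locales (use assms in auto)
  show ?thesis unfolding mg_def av_def using marg_eq[OF assms(3)] by simp
qed

lemma mg_bounds:
  assumes "0 < q" "q < 1" "j \<in> {1..n}"
  shows "0 \<le> mg k n q j" "mg k n q j \<le> q"
proof -
  interpret binomial_subset "{1..n}" q by unfold_locales (use assms in auto)
  show "0 \<le> mg k n q j" "mg k n q j \<le> q"
    unfolding mg_eq_marg[OF assms] using marg_nonneg marg_le_p assms by auto
qed

lemma mg_measurable [measurable]: "(\<lambda>q. mg k n q j) \<in> borel_measurable borel"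
  unfolding mg_def av_def rprob_def by measurable

lemma dens_measurable [measurable]: "dens k n \<in> borel_measurable borel"
  unfolding dens_def[abs_def] by measurable

text \<open>Supplies a dominating constant independent of \<open>n\<close>: each marginal is at most
  the density, so the averaged ratio lies between 0 and 1 (it is 0 by convention at
  \<open>\<tau> = 0\<close>), and the denominator is at least 1/2.\<close>

lemma dens_bound:
  assumes "0 < n" "0 \<le> \<tau>" "\<tau> \<le> psc k n / 2"
  shows "\<bar>dens k n \<tau>\<bar> \<le> 2"
proof -
  have h: "0 < psc k n" using psc_pos assms by simp
  define Y where "Y = (\<Sum>j=1..n. psc k n * mg k n (\<tau> / psc k n) j) / \<tau> / real n"
  have Y: "0 \<le> Y \<and> Y \<le> 1"
  proof (cases "\<tau> = 0")
    case True
    then show ?thesis by (simp add: Y_def)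
  next
    case False
    then have q: "0 < \<tau> / psc k n" "\<tau> / psc k n < 1" using assms h by (auto simp: field_simps)
    have "(\<Sum>j=1..n. psc k n * mg k n (\<tau> / psc k n) j) \<le> (\<Sum>j=1..n. \<tau>)"
    proof (rule sum_mono)
      fix j assume "j \<in> {1..n}"
      then have "psc k n * mg k n (\<tau> / psc k n) j \<le> psc k n * (\<tau> / psc k n)"
        using mg_bounds(2)[OF q] h by (intro mult_left_mono) auto
      then show "psc k n * mg k n (\<tau> / psc k n) j \<le> \<tau>" using h by simp
    qed
    then have "(\<Sum>j=1..n. psc k n * mg k n (\<tau> / psc k n) j) / \<tau> \<le> real n"
      using False assms by (simp add: field_simps)
    moreover have "0 \<le> (\<Sum>j=1..n. psc k n * mg k n (\<tau> / psc k n) j)"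
      using mg_bounds(1)[OF q] h by (intro sum_nonneg) auto
    ultimately have "0 \<le> Y" "Y \<le> real n / real n"
      unfolding Y_def using assms(2) by (intro divide_nonneg_nonneg divide_right_mono; simp)+
    then show ?thesis using assms by simp
  qed
  have d: "1 / 2 \<le> 1 - \<tau> / psc k n" using assms h by (simp add: field_simps)
  then have "0 \<le> 1 - \<tau> / psc k n" by linarith
  then have "\<bar>dens k n \<tau>\<bar> = \<bar>Y - 1\<bar> / (1 - \<tau> / psc k n)"
    unfolding dens_def Y_def[symmetric] by (simp add: abs_divide)
  also have "\<dots> \<le> 1 / (1 / 2)" using Y d by (intro frac_le) auto
  finally show ?thesis by simp
qed

text \<open>\<open>dens\<close> divides by \<tau>, so the derivative is taken only in the interior
  of the interval; the boundary term at 0 vanishes because at density 0 the avoidance probability is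
  1.\<close>

lemma ln_av_integral:
  assumes k: "3 \<le> k" and n: "0 < n" and b: "0 \<le> b" "b < psc k n"
  shows "(dens k n has_integral psc k n / real n * ln (av k n (b / psc k n))) {0..b}"
proof -
  define h where "h = psc k n"
  have h: "0 < h" using psc_pos n by (simp add: h_def)
  define f where "f \<tau> = h / real n * ln (av k n (\<tau> / h))" for \<tau>
  have f0: "f 0 = 0" unfolding f_def av_def using avoids_AP_empty[OF k] by (simp add: rprob_0)
  have ap: "0 < av k n (\<tau> / h)" if "\<tau> \<in> {0..b}" for \<tau>
    using that b h by (intro av_pos[OF k]) (auto simp: h_def)
  have "(dens k n has_integral f b - f 0) {0..b}"
  proof (rule fundamental_theorem_of_calculus_interior[OF b(1)])
    have "continuous_on {0..b} (\<lambda>\<tau>. av k n (\<tau> / h))"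
      unfolding av_def rprob_def using h by (intro continuous_intros) auto
    then show "continuous_on {0..b} f" unfolding f_def using ap
      by (intro continuous_intros) (metis less_irrefl)+
    fix \<tau> assume \<tau>: "\<tau> \<in> {0<..<b}"
    define q where "q = \<tau> / h"
    have q: "0 < q" "q < 1" using \<tau> b h by (auto simp: q_def h_def)
    have a: "0 < av k n q" using ap[of \<tau>] \<tau> by (simp add: q_def)
    define S where "S = (\<Sum>j=1..n. rprob {1..n} q (\<lambda>I. j \<in> I \<and> avoids (AP k n) I))"
    define A where "A = (S - real n * q * av k n q) / (q * (1 - q))"
    have dA: "(av k n has_real_derivative A) (at q)"
      unfolding A_def S_def av_def[abs_def] using rprob_deriv[of "{1..n}" q "avoids (AP k n)"] q by simp
    have "((\<lambda>\<tau>. \<tau> / h) has_real_derivative 1 / h) (at \<tau>)" by (rule DERIV_cdivide[OF DERIV_ident])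
    from DERIV_chain2[OF dA[unfolded q_def] this]
    have "((\<lambda>\<tau>. av k n (\<tau> / h)) has_real_derivative A * (1 / h)) (at \<tau>)" .
    then have "(f has_real_derivative h / real n * (1 / av k n q * (A * (1 / h)))) (at \<tau>)"
      unfolding f_def using a n by (auto intro!: derivative_eq_intros simp: q_def)
    moreover have "h / real n * (1 / av k n q * (A * (1 / h))) = dens k n \<tau>"
    proof -
      have "(\<Sum>j=1..n. h * mg k n q j) = h * (S / av k n q)"
        unfolding S_def mg_def by (simp add: sum_distrib_left sum_divide_distrib)
      then have "dens k n \<tau> = (h * (S / av k n q) / \<tau> / real n - 1) / (1 - q)"
        unfolding dens_def h_def[symmetric] q_def[symmetric] by simp
      moreover have "q * h = \<tau>" using h by (simp add: q_def)
      ultimately have d: "dens k n \<tau> = (h * (S / av k n q) / (q * h) / real n - 1) / (1 - q)" by simp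
      have "h / N * (1 / v * ((S - N * q * v) / (q * r) * (1 / h))) = (h * (S / v) / (q * h) / N - 1) / r"
        if "0 < h" "0 < N" "0 < v" "0 < q" "0 < r" for h N v q r S :: real
        using that by (simp add: field_simps)
      from this[of h "real n" "av k n q" q "1 - q" S] show ?thesis
        unfolding d A_def using h n a q by simp
    qed
    ultimately show "(f has_vector_derivative dens k n \<tau>) (at \<tau>)"
      by (simp add: has_real_derivative_iff_has_vector_derivative)
  qed
  then show ?thesis unfolding f0 by (simp add: f_def h_def)
qed

text \<open>Collects for one \<open>t\<close> what the remaining argument uses, without \<theta>:
  the contraction factor depends on \<open>t\<close>, which is about to become the variable of
  integration.\<close>

definition profile :: "nat \<Rightarrow> real \<Rightarrow> (real \<Rightarrow> real) \<Rightarrow> bool" where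
  "profile k t X \<longleftrightarrow> continuous_on UNIV X \<and> (\<forall>v. 0 < X v \<and> X v \<le> t) \<and> (\<forall>u\<in>{0..1}. x_star k t u = X u) \<and>
    (\<forall>p \<delta>. (\<lambda>n. psc k n * p n) \<longlonglongrightarrow> t \<longrightarrow> 0 < \<delta> \<longrightarrow>
      (\<forall>\<^sub>F n in sequentially. 0 < p n \<and> p n < 1 \<and> 0 < n \<and>
         (\<forall>w\<in>{1..n}. \<bar>psc k n * mg k n (p n) w - X (real w / real n)\<bar> \<le> \<delta>)))"

lemma profileD:
  assumes "profile k t X"
  shows "continuous_on UNIV X" "0 < X v" "X v \<le> t" "u \<in> {0..1} \<Longrightarrow> x_star k t u = X u"
    and "(\<lambda>n. psc k n * p n) \<longlonglongrightarrow> t \<Longrightarrow> 0 < \<delta> \<Longrightarrow>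
      \<forall>\<^sub>F n in sequentially. 0 < p n \<and> p n < 1 \<and> 0 < n \<and>
         (\<forall>w\<in>{1..n}. \<bar>psc k n * mg k n (p n) w - X (real w / real n)\<bar> \<le> \<delta>)"
  using assms unfolding profile_def by blast+

lemma x_star_profile:
  assumes "3 \<le> k" "0 < t" "t < crit k"
  shows "\<exists>X. profile k t X"
proof -
  obtain \<theta> where "subcritical k t \<theta>" using subcritical_theta[OF assms] by blast
  then interpret subcritical k t \<theta> .
  obtain X where X: "continuous_on UNIV X" "\<And>v. 0 < X v" "\<And>v. X v \<le> t" "\<And>u. u \<in> {0..1} \<Longrightarrow> x_star k t u = X u"
    "\<And>u. u \<in> {0..1} \<Longrightarrow> ln (t / X u) = Lam k X u" using x_star_ext by blast
  have "\<forall>\<^sub>F n in sequentially. 0 < p n \<and> p n < 1 \<and> 0 < n \<and>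
         (\<forall>w\<in>{1..n}. \<bar>psc k n * mg k n (p n) w - X (real w / real n)\<bar> \<le> \<delta>)"
    if p: "(\<lambda>n. psc k n * p n) \<longlonglongrightarrow> t" and d: "0 < \<delta>" for p \<delta>
  proof -
    interpret subcritical_profile k t \<theta> X p
      by unfold_locales (use X p in \<open>auto simp: psc_def\<close>)
    show ?thesis using p_pos_ev marg_AP_limit[OF d]
    proof eventually_elim
      case (elim n)
      then show ?case by (simp add: psc_def sc_def mg_eq_marg)
    qed
  qed
  then show ?thesis using X unfolding profile_def by (intro exI[of _ X]) blast
qed

lemma psc_times: "(\<lambda>n. psc k n * (t / psc k n)) \<longlonglongrightarrow> t"
proof (rule tendsto_eventually)
  show "\<forall>\<^sub>F n in sequentially. psc k n * (t / psc k n) = t"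
    using eventually_gt_at_top[of 0]
  proof eventually_elim
    case (elim n)
    then show ?case using psc_pos[of n k] by simp
  qed
qed

section \<open>Passage to the limit under the integral\<close>

lemma riemann_unit:
  fixes X :: "real \<Rightarrow> real"
  assumes X: "continuous_on UNIV X"
  shows "(\<lambda>n. (\<Sum>j=1..n. X (real j / real n)) / real n) \<longlonglongrightarrow> integral {0..1} X"
proof (rule LIMSEQ_I)
  fix e :: real assume e: "0 < e"
  have "uniformly_continuous_on {0..1} X"
    using X by (intro compact_uniformly_continuous) (auto intro: continuous_on_subset)
  then obtain d where d: "0 < d" "\<And>s s'. s \<in> {0..1} \<Longrightarrow> s' \<in> {0..1} \<Longrightarrow> \<bar>s - s'\<bar> < d \<Longrightarrow> \<bar>X s - X s'\<bar> < e / 2"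
    using e unfolding uniformly_continuous_on_def dist_real_def by (metis half_gt_zero)
  have "\<forall>\<^sub>F n in sequentially. 1 / real n < d \<and> 0 < n"
    using d(1) by (intro eventually_conj order_tendstoD(2)[OF lim_const_over_n] eventually_gt_at_top)
  then obtain N where N: "\<And>n. n \<ge> N \<Longrightarrow> 1 / real n < d \<and> 0 < n" unfolding eventually_sequentially by blast
  show "\<exists>no. \<forall>n\<ge>no. norm ((\<Sum>j=1..n. X (real j / real n)) / real n - integral {0..1} X) < e"
  proof (intro exI allI impI)
    fix n assume n: "N \<le> n"
    have "\<bar>1 / real n * (\<Sum>b=1..n. X (real b * (1 / real n))) - integral {0..real n * (1 / real n)} X\<bar> \<le> real n * (1 / real n) * (e / 2)"
    proof (rule riemann_sum_error[OF X])
      show "\<bar>X s - X s'\<bar> \<le> e / 2" if "s \<in> {0..real n * (1 / real n)}" "s' \<in> {0..real n * (1 / real n)}" "\<bar>s - s'\<bar> \<le> 1 / real n" for s s'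
        using d(2)[of s s'] N[OF n] that by auto
    qed simp
    then show "norm ((\<Sum>j=1..n. X (real j / real n)) / real n - integral {0..1} X) < e"
      using N[OF n] e by simp
  qed
qed

text \<open>For fixed \<open>t\<close> the densities \<open>t / psc k n\<close> have the required
  asymptotics, so the averaged scaled marginals are Riemann sums of the profile up to a vanishing
  error.\<close>

lemma dens_limit:
  assumes "3 \<le> k" "0 < t" "t < crit k"
  shows "(\<lambda>n. dens k n t) \<longlonglongrightarrow> (LBINT s:{0..1}. x_star k t s) / t - 1"
proof -
  obtain X where P: "profile k t X" using x_star_profile[OF assms] by blast
  note X = profileD(1,4)[OF P] and lim = profileD(5)[OF P]
  let ?q = "\<lambda>n. t / psc k n"
  let ?S = "\<lambda>n. (\<Sum>j=1..n. psc k n * mg k n (?q n) j) / real n"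
  let ?R = "\<lambda>n. (\<Sum>j=1..n. X (real j / real n)) / real n"
  have I: "(LBINT s:{0..1}. x_star k t s) = integral {0..1} X"
  proof -
    have "(LBINT s:{0..1}. x_star k t s) = (LBINT s:{0..1}. X s)"
      using X(2) by (intro set_lebesgue_integral_cong) auto
    also have "\<dots> = integral {0..1} X"
      by (intro set_borel_integral_eq_integral(2) borel_integrable_atLeastAtMost' continuous_on_subset[OF X(1)]) auto
    finally show ?thesis .
  qed
  have diff: "(\<lambda>n. ?S n - ?R n) \<longlonglongrightarrow> 0"
  proof (rule tendstoI)
    fix e :: real assume e: "0 < e"
    show "\<forall>\<^sub>F n in sequentially. dist (?S n - ?R n) 0 < e"
      using lim[OF psc_times half_gt_zero[OF e]]
    proof eventually_elim
      case (elim n)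
      have "\<bar>\<Sum>j=1..n. psc k n * mg k n (?q n) j - X (real j / real n)\<bar> \<le> (\<Sum>j=1..n. e / 2)"
        using elim by (intro sum_abs[THEN order_trans] sum_mono) auto
      then have "\<bar>(\<Sum>j=1..n. psc k n * mg k n (?q n) j - X (real j / real n))\<bar> / real n \<le> e / 2"
        using elim by (simp add: field_simps)
      then have "\<bar>(\<Sum>j=1..n. psc k n * mg k n (?q n) j - X (real j / real n)) / real n\<bar> \<le> e / 2"
        by simp
      then show ?case using e by (simp add: sum_subtractf diff_divide_distrib dist_real_def)
    qed
  qed
  have avg: "(\<lambda>n. ?S n) \<longlonglongrightarrow> integral {0..1} X"
    using tendsto_add[OF diff riemann_unit[OF X(1)]] by simp
  have "?q \<longlonglongrightarrow> 0"
  proof -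
    have "(\<lambda>n. t * real n powr (- (1 / (real k - 1)))) \<longlonglongrightarrow> t * 0"
      using assms by (intro tendsto_intros tendsto_neg_powr filterlim_real_sequentially) auto
    then show ?thesis by (simp add: psc_def powr_minus divide_inverse)
  qed
  then have "(\<lambda>n. (?S n / t - 1) / (1 - ?q n)) \<longlonglongrightarrow>
      (integral {0..1} X / t - 1) / (1 - 0)"
    using assms by (intro tendsto_intros avg) auto
  then show ?thesis unfolding dens_def I by (simp add: mult.commute)
qed

text \<open>\<open>x_star k t\<close> is described separately for each \<open>t\<close>, so its
  definition shows nothing about measurability in \<open>t\<close>. Measurability in the pair is
  inherited from the marginals, which are quotients of polynomials in the density and converge
  pointwise.\<close>

lemma x_star_jointly_measurable:
  assumes "3 \<le> k" "c < crit k"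
  shows "(\<lambda>(t, s). indicator ({0..c} \<times> {0..1}) (t, s) * (x_star k t s / t)) \<in> borel_measurable (lborel \<Otimes>\<^sub>M lborel)"
proof (rule borel_measurable_LIMSEQ_real)
  \<comment> \<open>The grid index just above \<open>s\<close>; the maximum with 1 covers
    \<open>s = 0\<close>.\<close>
  define J where "J n s = max 1 (nat \<lceil>s * real n\<rceil>)" for n :: nat and s :: real
  \<comment> \<open>The sum selects the term with index \<open>J n s\<close>; in this form
    measurability reduces to that of each \<open>mg k n _ j\<close> with constant
    \<open>j\<close>.\<close>
  define G where "G n = (\<lambda>(t, s). indicator ({0..c} \<times> {0..1}) (t, s) *
    ((\<Sum>j=1..n. if j = J n s then psc k n * mg k n (t / psc k n) j else 0) / t))" for n
  show "G n \<in> borel_measurable (lborel \<Otimes>\<^sub>M lborel)" for n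
    unfolding G_def J_def by measurable
  fix z :: "real \<times> real"
  obtain t s where z: "z = (t, s)" by force
  show "(\<lambda>n. G n z) \<longlonglongrightarrow> (case z of (t, s) \<Rightarrow> indicator ({0..c} \<times> {0..1}) (t, s) * (x_star k t s / t))"
  proof (cases "(t, s) \<in> {0..c} \<times> {0..1} \<and> t \<noteq> 0")
    case False
    then show ?thesis by (auto simp: z G_def)
  next
    case True
    then have t: "0 < t" "t < crit k" and s: "0 \<le> s" "s \<le> 1" using assms by auto
    obtain X where P: "profile k t X" using x_star_profile[OF assms(1) t] by blast
    note X = profileD(1,4)[OF P] and lim = profileD(5)[OF P]
    have J: "J n s \<in> {1..n}" "\<bar>real (J n s) / real n - s\<bar> \<le> 1 / real n" if n: "0 < n" for n
    proof -
      have sn: "0 \<le> s * real n" "s * real n \<le> real n" using s by (auto simp: mult_left_le_one_le)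
      have c: "s * real n \<le> of_int \<lceil>s * real n\<rceil>" "of_int \<lceil>s * real n\<rceil> < s * real n + 1" by linarith+
      have "\<lceil>s * real n\<rceil> \<le> int n" using sn by (simp add: ceiling_le_iff)
      then show "J n s \<in> {1..n}" using n s by (auto simp: J_def)
      have r: "real (nat \<lceil>s * real n\<rceil>) = of_int \<lceil>s * real n\<rceil>" using sn by simp
      have "\<bar>real (J n s) - s * real n\<bar> \<le> 1"
      proof (cases "nat \<lceil>s * real n\<rceil> = 0")
        case True
        then have "s * real n \<le> 0" using r c by simp
        then have "s * real n = 0" using sn by linarith
        then show ?thesis using True by (simp add: J_def)
      next
        case False
        then have "1 \<le> nat \<lceil>s * real n\<rceil>" by linarith
        then have "J n s = nat \<lceil>s * real n\<rceil>" unfolding J_def by (rule max_absorb2)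
        then show ?thesis using r c by simp
      qed
      moreover have "real (J n s) / real n - s = (real (J n s) - s * real n) / real n" using n by (simp add: field_simps)
      ultimately show "\<bar>real (J n s) / real n - s\<bar> \<le> 1 / real n" using n by (simp add: divide_right_mono)
    qed
    have "(\<lambda>n. real (J n s) / real n - s) \<longlonglongrightarrow> 0"
    proof (rule tendsto_rabs_zero_cancel, rule tendsto_sandwich[OF _ _ tendsto_const lim_const_over_n[of 1]])
      show "\<forall>\<^sub>F n in sequentially. \<bar>real (J n s) / real n - s\<bar> \<le> 1 / real n"
        using eventually_gt_at_top[of 0] J(2) by (rule eventually_mono)
    qed simp
    then have "(\<lambda>n. real (J n s) / real n) \<longlonglongrightarrow> s" by (rule LIM_zero_cancel)
    then have XJ: "(\<lambda>n. X (real (J n s) / real n)) \<longlonglongrightarrow> X s"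
      using X(1) by (intro isCont_tendsto_compose[of s X]) (auto simp: continuous_on_eq_continuous_at)
    have "(\<lambda>n. psc k n * mg k n (t / psc k n) (J n s) - X (real (J n s) / real n)) \<longlonglongrightarrow> 0"
    proof (rule tendstoI)
      fix e :: real assume e: "0 < e"
      show "\<forall>\<^sub>F n in sequentially. dist (psc k n * mg k n (t / psc k n) (J n s) - X (real (J n s) / real n)) 0 < e"
        using lim[OF psc_times half_gt_zero[OF e]]
      proof eventually_elim
        case (elim n)
        then have "\<bar>psc k n * mg k n (t / psc k n) (J n s) - X (real (J n s) / real n)\<bar> \<le> e / 2" using J(1) by blast
        then show ?case using e by (simp add: dist_real_def)
      qed
    qed
    from tendsto_add[OF this XJ]
    have "(\<lambda>n. psc k n * mg k n (t / psc k n) (J n s)) \<longlonglongrightarrow> X s" by simp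
    then have "(\<lambda>n. psc k n * mg k n (t / psc k n) (J n s) / t) \<longlonglongrightarrow> X s / t"
      using t by (intro tendsto_intros) auto
    moreover have "\<forall>\<^sub>F n in sequentially. psc k n * mg k n (t / psc k n) (J n s) / t = G n z"
      using eventually_gt_at_top[of 0]
    proof eventually_elim
      case (elim n)
      have "(\<Sum>j=1..n. if j = J n s then psc k n * mg k n (t / psc k n) j else 0) = psc k n * mg k n (t / psc k n) (J n s)"
        using J(1)[OF elim] by (simp add: sum.delta)
      then show ?case using True by (simp add: G_def z)
    qed
    ultimately have "(\<lambda>n. G n z) \<longlonglongrightarrow> X s / t" by (rule Lim_transform_eventually)
    then show ?thesis using True X(2)[of s] by (simp add: z)
  qed
qed

lemma x_star_bounds:
  assumes "3 \<le> k" "0 < t" "t < crit k" "s \<in> {0..1}"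
  shows "0 \<le> x_star k t s / t" "x_star k t s / t \<le> 1"
proof -
  obtain X where P: "profile k t X" using x_star_profile[OF assms(1-3)] by blast
  note X = profileD(2-4)[OF P]
  show "0 \<le> x_star k t s / t" "x_star k t s / t \<le> 1"
    using X(1)[of s] X(2)[of s] X(3)[OF assms(4)] assms(2) by auto
qed

text \<open>Dominated convergence in \<open>ln_av_integral\<close>. The upper limit
  \<open>psc k n * p n\<close> moves with \<open>n\<close>, so the integrands are cut off by an
  indicator; only \<open>t = 0\<close> and \<open>t = c\<close> are exceptional. Fubini then brings
  the iterated integral into the order of the claim.\<close>

lemma log_prob_limit:
  assumes k: "3 \<le> k" and c: "0 < c" "c < crit k" and p: "(\<lambda>n. psc k n * p n) \<longlonglongrightarrow> c"
  shows "(\<lambda>n. psc k n / real n * ln (av k n (p n))) \<longlonglongrightarrow>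
    (LBINT s:{0..1}. LBINT t:{0..c}. x_star k t s / t) - c"
proof -
  define F where "F t s = indicator ({0..c} \<times> {0..1}) (t, s) * (x_star k t s / t)" for t s
  have mF: "case_prod F \<in> borel_measurable (lborel \<Otimes>\<^sub>M lborel)"
    unfolding F_def[abs_def] using x_star_jointly_measurable[OF k c(2)] .
  have bF: "\<bar>F t s\<bar> \<le> 1" for t s
  proof (cases "t \<in> {0<..c} \<and> s \<in> {0..1}")
    case True
    then have "F t s = x_star k t s / t" "0 \<le> x_star k t s / t" "x_star k t s / t \<le> 1"
      using x_star_bounds[OF k, of t s] c by (auto simp: F_def)
    then show ?thesis by linarith
  next
    case False
    then have "F t s = 0" by (cases "t = 0") (auto simp: F_def indicator_def)
    then show ?thesis by simp
  qed
  have iF: "integrable (lborel \<Otimes>\<^sub>M lborel) (case_prod F)"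
  proof (rule integrableI_bounded_set[where A = "{0..c} \<times> {0..1}" and B = 1])
    show "emeasure (lborel \<Otimes>\<^sub>M lborel) ({0..c} \<times> {0..1::real}) < \<infinity>"
      using c by (subst lborel.emeasure_pair_measure_Times) (auto simp: ennreal_mult_less_top)
    show "AE x in lborel \<Otimes>\<^sub>M lborel. x \<in> {0..c} \<times> {0..1::real} \<longrightarrow> norm (case_prod F x) \<le> 1"
      using bF by (auto simp: case_prod_unfold)
    show "AE x in lborel \<Otimes>\<^sub>M lborel. x \<notin> {0..c} \<times> {0..1} \<longrightarrow> case_prod F x = 0"
      by (auto simp: F_def case_prod_unfold indicator_def)
  qed (use mF in auto)
  define g where "g t = (LINT s|lborel. F t s) - indicator {0..c} t" for t
  have intg: "integrable lborel (\<lambda>t. LINT s|lborel. F t s)"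
    using lborel_pair.integrable_fst[OF iF] by simp
  have mg': "g \<in> borel_measurable lborel"
    unfolding g_def[abs_def] using borel_measurable_integrable[OF intg] by measurable
  have g_eq: "g t = indicator {0..c} t * ((LBINT s:{0..1}. x_star k t s) / t - 1)" for t
    unfolding g_def F_def set_lebesgue_integral_def
    by (cases "t \<in> {0..c}") (auto simp: indicator_times)
  have Int_g: "(LINT t|lborel. g t) = (LBINT s:{0..1}. LBINT t:{0..c}. x_star k t s / t) - c"
  proof -
    have "(LINT t|lborel. g t) = (LINT t|lborel. LINT s|lborel. F t s) - (LINT t|lborel. indicator {0..c} t)"
      unfolding g_def using c by (intro Bochner_Integration.integral_diff intg) simp
    also have "(LINT t|lborel. indicator {0..c} t) = c" using c by simp
    also have "(LINT t|lborel. LINT s|lborel. F t s) = (LINT s|lborel. LINT t|lborel. F t s)"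
      using lborel_pair.Fubini_integral[OF iF] by simp
    also have "\<dots> = (LBINT s:{0..1}. LBINT t:{0..c}. x_star k t s / t)"
      unfolding set_lebesgue_integral_def F_def
    proof (intro Bochner_Integration.integral_cong refl)
      fix s :: real
      show "(LINT t|lborel. indicator ({0..c} \<times> {0..1}) (t, s) * (x_star k t s / t)) =
        indicator {0..1} s *\<^sub>R (LINT t|lborel. indicator {0..c} t *\<^sub>R (x_star k t s / t))"
        by (cases "s \<in> {0..1}") (auto simp: indicator_times)
    qed
    finally show ?thesis .
  qed
  \<comment> \<open>Holds for all large \<open>n\<close>. Setting the integrand to 0 for the other
    \<open>n\<close> makes the domination valid for every \<open>n\<close>, as the convergence
    theorem demands.\<close>
  define good where "good n \<longleftrightarrow> 0 < n \<and> 0 < psc k n * p n \<and> psc k n * p n \<le> c + 1 \<and> p n \<le> 1 / 2" for n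
  have good_ev: "\<forall>\<^sub>F n in sequentially. good n"
  proof -
    have "\<forall>\<^sub>F n in sequentially. 0 < psc k n * p n" by (rule order_tendstoD(1)[OF p c(1)])
    moreover have "\<forall>\<^sub>F n in sequentially. psc k n * p n < c + 1" by (rule order_tendstoD(2)[OF p]) simp
    moreover have "\<forall>\<^sub>F n in sequentially. p n < 1 / 2"
    proof -
      have "(\<lambda>n. psc k n * p n * real n powr (- (1 / (real k - 1)))) \<longlonglongrightarrow> c * 0"
        using k by (intro tendsto_mult p tendsto_neg_powr filterlim_real_sequentially) auto
      then have "\<forall>\<^sub>F n in sequentially. psc k n * p n * real n powr (- (1 / (real k - 1))) < 1 / 2"
        by (intro order_tendstoD(2)) auto
      then show ?thesis using eventually_gt_at_top[of 0]
      proof eventually_elim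
        case (elim n)
        then show ?case by (simp add: psc_def powr_minus field_simps)
      qed
    qed
    moreover have "\<forall>\<^sub>F n in sequentially. 0 < n" by (rule eventually_gt_at_top)
    ultimately show ?thesis by eventually_elim (simp add: good_def)
  qed
  define s where "s n t = (if good n then indicator {0..psc k n * p n} t * dens k n t else 0)" for n t
  have ms: "s n \<in> borel_measurable lborel" for n
    unfolding s_def[abs_def] by (cases "good n") auto
  have bs: "\<bar>s n t\<bar> \<le> 2 * indicator {0..c + 1} t" for n t
  proof (cases "good n \<and> t \<in> {0..psc k n * p n}")
    case True
    then have n: "0 < n" "good n" and t: "0 \<le> t" "t \<le> psc k n * p n" "t \<le> c + 1"
      unfolding good_def by auto
    have "psc k n * p n \<le> psc k n * (1 / 2)"
      using n psc_pos[of n k] unfolding good_def by (intro mult_left_mono) auto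
    then have "\<bar>dens k n t\<bar> \<le> 2" using t n by (intro dens_bound) auto
    then show ?thesis using True t by (simp add: s_def)
  next
    case False
    then have "s n t = 0" by (auto simp: s_def)
    then show ?thesis by simp
  qed
  have "(\<lambda>n. LINT t|lborel. s n t) \<longlonglongrightarrow> (LINT t|lborel. g t)"
  proof (rule integral_dominated_convergence[OF mg' ms])
    show "integrable lborel (\<lambda>t. 2 * indicator {0..c + 1} t :: real)" using c by simp
    show "AE t in lborel. norm (s n t) \<le> 2 * indicator {0..c + 1} t" for n using bs by auto
    show "AE t in lborel. (\<lambda>n. s n t) \<longlonglongrightarrow> g t"
      using AE_lborel_singleton[of 0] AE_lborel_singleton[of c]
    proof eventually_elim
      case (elim t)
      consider "t < 0" | "0 < t" "t < c" | "c < t" using elim by linarith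
      then show ?case
      proof cases
        case 1
        then have "s n t = 0" for n by (simp add: s_def)
        moreover have "g t = 0" using 1 by (simp add: g_eq)
        ultimately show ?thesis by simp
      next
        case 2
        have "\<forall>\<^sub>F n in sequentially. t < psc k n * p n" by (rule order_tendstoD(1)[OF p 2(2)])
        with good_ev have "\<forall>\<^sub>F n in sequentially. dens k n t = s n t"
          by eventually_elim (use 2 in \<open>simp add: s_def\<close>)
        moreover have "(\<lambda>n. dens k n t) \<longlonglongrightarrow> g t"
          using dens_limit[OF k 2(1)] 2 c by (simp add: g_eq)
        ultimately show ?thesis by (rule Lim_transform_eventually[rotated])
      next
        case 3
        have "\<forall>\<^sub>F n in sequentially. psc k n * p n < t" by (rule order_tendstoD(2)[OF p 3])
        then have "\<forall>\<^sub>F n in sequentially. s n t = 0" by eventually_elim (simp add: s_def)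
        moreover have "g t = 0" using 3 by (simp add: g_eq)
        ultimately show ?thesis by (simp add: tendsto_eventually)
      qed
    qed
  qed
  moreover have "\<forall>\<^sub>F n in sequentially. (LINT t|lborel. s n t) = psc k n / real n * ln (av k n (p n))"
    using good_ev
  proof eventually_elim
    case (elim n)
    define b where "b = psc k n * p n"
    have n: "0 < n" and h: "0 < psc k n" using elim psc_pos[of n k] by (auto simp: good_def)
    have pn: "0 < p n" "p n \<le> 1 / 2" using elim h by (auto simp: good_def zero_less_mult_iff)
    have b: "0 \<le> b" "b < psc k n" "b / psc k n = p n"
      using pn h by (auto simp: b_def)
    have "integrable lborel (\<lambda>t. 2 * indicator {0..c + 1} t :: real)" using c by simp
    then have "integrable lborel (s n)"
      by (rule Bochner_Integration.integrable_bound[OF _ ms]) (use bs[of n] in \<open>auto intro: order_trans\<close>)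
    then have si: "set_integrable lborel {0..b} (dens k n)"
      unfolding set_integrable_def s_def[abs_def] b_def using elim by simp
    have "(LINT t|lborel. s n t) = (LBINT t:{0..b}. dens k n t)"
      unfolding set_lebesgue_integral_def s_def b_def using elim by simp
    also have "\<dots> = integral {0..b} (dens k n)" by (rule set_borel_integral_eq_integral(2)[OF si])
    also have "\<dots> = psc k n / real n * ln (av k n (p n))"
      using integral_unique[OF ln_av_integral[OF k n b(1,2)]] unfolding b(3) .
    finally show ?case .
  qed
  ultimately show ?thesis unfolding Int_g by (rule Lim_transform_eventually)
qed

theorem mainTheorem5:
  fixes k :: nat and c :: real and p :: "nat \<Rightarrow> real"
  assumes "k \<ge> 3"
    and "0 < c" and "c < crit k"
    and "p \<sim>[at_top] (\<lambda>n. c * real n powr (- 1 / (real k - 1)))"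
  shows "((\<lambda>n. real n powr (- (real k - 2) / (real k - 1)) *
            ln (measure_pmf.prob (rand_subset n (p n)) {S. num_kAP k {j. S j} = 0}))
         \<longlonglongrightarrow> (LBINT s:{0..1}. LBINT t:{0..c}. x_star k t s / t) - c) \<and>
         ((\<lambda>n. SUP j\<in>{1..n}. \<bar>real n powr (1 / (real k - 1)) *
            (measure_pmf.prob (rand_subset n (p n)) {S. S j \<and> num_kAP k {j. S j} = 0} /
             measure_pmf.prob (rand_subset n (p n)) {S. num_kAP k {j. S j} = 0})
            - x_star k c (real j / real n)\<bar>)
         \<longlonglongrightarrow> 0)"
proof -
  have m: "0 < real k - 1" using assms(1) by simp
  have scp: "(\<lambda>n. psc k n * p n) \<longlonglongrightarrow> c"
  proof -
    have "((\<lambda>n. p n / (c * real n powr (- 1 / (real k - 1)))) \<longlongrightarrow> 1) at_top"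
    proof (rule asymp_equivD_strong[OF assms(4)])
      show "\<forall>\<^sub>F n in at_top. p n \<noteq> 0 \<or> c * real n powr (- 1 / (real k - 1)) \<noteq> 0"
        using eventually_gt_at_top[of 0] by eventually_elim (use assms(2) in simp)
    qed
    then have "((\<lambda>n. c * (p n / (c * real n powr (- 1 / (real k - 1))))) \<longlongrightarrow> c * 1) at_top"
      by (rule tendsto_mult_left)
    then have "((\<lambda>n. c * (p n / (c * real n powr (- 1 / (real k - 1))))) \<longlongrightarrow> c) at_top" by simp
    moreover have "\<forall>\<^sub>F n in sequentially. c * (p n / (c * real n powr (- 1 / (real k - 1)))) = psc k n * p n"
      using eventually_gt_at_top[of 0]
    proof eventually_elim
      case (elim n)
      then show ?case using assms(2) by (simp add: psc_def powr_minus divide_inverse)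
    qed
    ultimately show ?thesis by (rule Lim_transform_eventually)
  qed
  obtain X where P: "profile k c X" using x_star_profile[OF assms(1-3)] by blast
  note X = profileD(4)[OF P] and lim = profileD(5)[OF P]
  have pr: "measure_pmf.prob (rand_subset n (p n)) {S. num_kAP k {j. S j} = 0} = av k n (p n)"
    "measure_pmf.prob (rand_subset n (p n)) {S. S j \<and> num_kAP k {j. S j} = 0} =
      rprob {1..n} (p n) (\<lambda>I. j \<in> I \<and> avoids (AP k n) I)"
    if "0 < p n" "p n < 1" for n j
    using prob_rand_subset[of "p n" n "\<lambda>I. num_kAP k I = 0"]
      prob_rand_subset[of "p n" n "\<lambda>I. j \<in> I \<and> num_kAP k I = 0"] that
      rprob_cong[of "{1..n}" "\<lambda>I. num_kAP k I = 0" "avoids (AP k n)" "p n"]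
      rprob_cong[of "{1..n}" "\<lambda>I. j \<in> I \<and> num_kAP k I = 0" "\<lambda>I. j \<in> I \<and> avoids (AP k n) I" "p n"]
      avoids_AP_iff[of _ n k] by (simp_all add: av_def)
  have ev: "\<forall>\<^sub>F n in sequentially. 0 < p n \<and> p n < 1 \<and> 0 < n"
    using lim[OF scp zero_less_one] by eventually_elim simp
  show ?thesis
  proof
    have "\<forall>\<^sub>F n in sequentially. psc k n / real n * ln (av k n (p n)) =
       real n powr (- (real k - 2) / (real k - 1)) *
         ln (measure_pmf.prob (rand_subset n (p n)) {S. num_kAP k {j. S j} = 0})"
      using ev
    proof eventually_elim
      case (elim n)
      have "- (real k - 2) / (real k - 1) = 1 / (real k - 1) - 1" using m by (simp add: field_simps)
      then have "real n powr (- (real k - 2) / (real k - 1)) = psc k n / real n"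
        using elim by (simp add: psc_def powr_diff)
      then show ?case using elim pr(1)[of n] by simp
    qed
    then show "(\<lambda>n. real n powr (- (real k - 2) / (real k - 1)) *
            ln (measure_pmf.prob (rand_subset n (p n)) {S. num_kAP k {j. S j} = 0}))
         \<longlonglongrightarrow> (LBINT s:{0..1}. LBINT t:{0..c}. x_star k t s / t) - c"
      by (rule Lim_transform_eventually[OF log_prob_limit[OF assms(1-3) scp]])
    let ?g = "\<lambda>n j. \<bar>real n powr (1 / (real k - 1)) *
            (measure_pmf.prob (rand_subset n (p n)) {S. S j \<and> num_kAP k {j. S j} = 0} /
             measure_pmf.prob (rand_subset n (p n)) {S. num_kAP k {j. S j} = 0})
            - x_star k c (real j / real n)\<bar>"
    show "(\<lambda>n. SUP j\<in>{1..n}. ?g n j)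
         \<longlonglongrightarrow> 0"
    proof (rule tendstoI)
      fix e :: real assume e: "0 < e"
      show "\<forall>\<^sub>F n in sequentially. dist (SUP j\<in>{1..n}. ?g n j) 0 < e"
        using lim[OF scp half_gt_zero[OF e]]
      proof eventually_elim
        case (elim n)
        have g: "?g n j \<le> e / 2" if j: "j \<in> {1..n}" for j
        proof -
          have "real j / real n \<in> {0..1}" using j by auto
          then show ?thesis using elim j pr[of n] X by (simp add: mg_def psc_def)
        qed
        have ne: "{1..n} \<noteq> {}" using elim by simp
        have "(SUP j\<in>{1..n}. ?g n j) \<le> e / 2" using ne g by (rule cSUP_least)
        \<comment> \<open>The distance to 0 is an absolute value, so the supremum also has to be
          nonnegative; the index 1 shows this, since \<open>n\<close> is positive.\<close>
        moreover have "0 \<le> (SUP j\<in>{1..n}. ?g n j)"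
        proof -
          have "0 \<le> ?g n 1" by simp
          also have "\<dots> \<le> (SUP j\<in>{1..n}. ?g n j)" using elim by (intro cSUP_upper) auto
          finally show ?thesis .
        qed
        ultimately show ?case using e by (simp add: dist_real_def)
      qed
    qed
  qed
qed

end
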